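(* Let $M$ be a smooth manifold with a distribution $H\subseteq TM$ and let $m\in M$. The operation $$[\Phi^m]_H\ast[\Psi^m]_H=[(\Phi\circ\Psi)^m]_H,$$ where $\Phi,\Psi$ are parabolic flows of $(M,H)$ defined near $m$ whose flow lines through $m$ represent the given parabolic arrows, defines the structure of a Lie group on $T_HM_m$.
   Context: $M$ is a smooth manifold of dimension $p+q$, $H\subseteq TM$ is a distribution of rank $p$, and $N=TM/H$ has rank $q$. An $H$-coordinate chart at $m\in M$ is a coordinate chart $\phi:U\to\mathbb{R}^{p+q}$ on an open set $U\ni m$ with $\phi(m)=0$ such that the first $p$ coordinate vectors at $m$ span $H_m$. Two smooth curves $c_1,c_2$ in $M$, defined near $t=0$ and tangent to $H$ at $t=0$, satisfy $c_1\sim_Hc_2$ if $c_1(0)=c_2(0)$ and, in $H$-coordinates centered at that point, $c_1'(0)=c_2'(0)$ and $c_1''(0)-c_2''(0)\in\mathbb{R}^p\times\{0\}$. This does not depend on the choice of $H$-coordinates. An equivalence class $[c]_H$ is called a parabolic arrow at $c(0)$; $T_HM_m$ is the set of parabolic arrows at $m$. Given $H$-coordinates at $m$, the parabolic arrow $[c]_H$ of the curve $c(t)=(th,t^2n)$ (expressed in these coordinates, for small $t$), with $h\in\mathbb{R}^p$, $n\in\mathbb{R}^q$, is said to have Taylor coordinates $(h,n)\in\mathbb{R}^{p+q}$. This gives a bijection $F_m:\mathbb{R}^{p+q}\to T_HM_m$, and $T_HM_m$ carries the smooth structure for which each such $F_m$ is a diffeomorphism (this is independent of the $H$-coordinates).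 A local flow of $M$ is a smooth map $\Phi:V\to M$, $V\subseteq M\times\mathbb{R}$ open, written $\Phi_t(m)=\Phi(m,t)$, such that $\Phi_0(m)=m$ and each $\Phi_t$ is a local diffeomorphism where defined (no one-parameter group property is required). Flows compose by $(\Phi\circ\Psi)(m,t)=\Phi(\Psi(m,t),t)$ wherever this is defined. A parabolic flow of $(M,H)$ is a local flow whose generating vector field at $t=0$, $m\mapsto\frac{\partial\Phi}{\partial t}(m,0)$, is a section of $H$. For a parabolic flow, $\Phi^m(t)=\Phi(m,t)$ denotes the flow line through $m$; it is tangent to $H$ at $t=0$ and determines a parabolic arrow $[\Phi^m]_H\in T_HM_m$. *)

theory Defs
  imports "HOL-Analysis.Analysis" "HOL-Algebra.Group"
begin

subsection \<open>Smooth maps between normed spaces\<close>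

primrec times_differentiable_on ::
    "nat \<Rightarrow> 'a::real_normed_vector set \<Rightarrow> ('a \<Rightarrow> 'b::real_normed_vector) \<Rightarrow> bool" where
  "times_differentiable_on 0 S f \<longleftrightarrow> continuous_on S f"
| "times_differentiable_on (Suc k) S f \<longleftrightarrow>
     (\<forall>x\<in>S. f differentiable (at x)) \<and>
     (\<forall>v. times_differentiable_on k S (\<lambda>x. frechet_derivative f (at x) v))"

text \<open>\<open>C\<^sup>\<infinity>\<close> maps; only used for finite-dimensional spaces and open \<open>S\<close>. Values of \<open>f\<close> outside
  the open set \<open>S\<close> are irrelevant.\<close>

definition smooth_on :: "'a::real_normed_vector set \<Rightarrow> ('a \<Rightarrow> 'b::real_normed_vector) \<Rightarrow> bool" where
  "smooth_on S f \<longleftrightarrow> (\<forall>k. times_differentiable_on k S f)"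

subsection \<open>Smooth manifolds\<close>

type_synonym ('a, 'e) chart = "'a set \<times> ('a \<Rightarrow> 'e)"

definition is_chart :: "('a, 'e::euclidean_space) chart \<Rightarrow> bool" where
  "is_chart = (\<lambda>(U, \<phi>). inj_on \<phi> U \<and> open (\<phi> ` U))"

definition smoothly_compatible ::
    "('a, 'e::euclidean_space) chart \<Rightarrow> ('a, 'e) chart \<Rightarrow> bool" where
  "smoothly_compatible = (\<lambda>(U, \<phi>) (V, \<psi>).
     open (\<phi> ` (U \<inter> V)) \<and> open (\<psi> ` (U \<inter> V)) \<and>
     smooth_on (\<phi> ` (U \<inter> V)) (\<psi> \<circ> inv_into U \<phi>) \<and>
     smooth_on (\<psi> ` (U \<inter> V)) (\<phi> \<circ> inv_into V \<psi>))"

definition smooth_atlas :: "('a, 'e::euclidean_space) chart set \<Rightarrow> bool" where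
  "smooth_atlas A \<longleftrightarrow>
     (\<forall>c\<in>A. is_chart c) \<and> (\<forall>c\<in>A. \<forall>d\<in>A. smoothly_compatible c d)"

definition points :: "('a, 'e) chart set \<Rightarrow> 'a set" where
  "points A = (\<Union>(U, \<phi>)\<in>A. U)"

text \<open>A manifold is given by an atlas on its set of points. Its topology is the unique one for
  which the chart domains are open and the charts are homeomorphisms onto open sets.\<close>

definition manifold_topology :: "('a, 'e::euclidean_space) chart set \<Rightarrow> 'a topology" where
  "manifold_topology A =
     topology (\<lambda>W. W \<subseteq> points A \<and> (\<forall>(U, \<phi>)\<in>A. open (\<phi> ` (U \<inter> W))))"

lemma openin_manifold_topology:
  assumes "smooth_atlas A"
  shows "openin (manifold_topology A) W \<longleftrightarrow>
    W \<subseteq> points A \<and> (\<forall>(U, \<phi>)\<in>A. open (\<phi> ` (U \<inter> W)))"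
proof -
  have "istopology (\<lambda>W. W \<subseteq> points A \<and> (\<forall>(U, \<phi>)\<in>A. open (\<phi> ` (U \<inter> W))))"
    unfolding istopology_def
  proof (intro conjI allI impI)
    fix S T
    assume *: "S \<subseteq> points A \<and> (\<forall>(U, \<phi>)\<in>A. open (\<phi> ` (U \<inter> S)))"
      "T \<subseteq> points A \<and> (\<forall>(U, \<phi>)\<in>A. open (\<phi> ` (U \<inter> T)))"
    then show "S \<inter> T \<subseteq> points A"
      by blast
    show "\<forall>(U, \<phi>)\<in>A. open (\<phi> ` (U \<inter> (S \<inter> T)))"
    proof clarify
      fix U and \<phi> :: "'a \<Rightarrow> 'b"
      assume c: "(U, \<phi>) \<in> A"
      have "inj_on \<phi> U"
        using assms c by (auto simp: smooth_atlas_def is_chart_def)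
      then have "\<phi> ` (U \<inter> (S \<inter> T)) = \<phi> ` (U \<inter> S) \<inter> \<phi> ` (U \<inter> T)"
        by (auto simp: inj_on_def)
      moreover have "open (\<phi> ` (U \<inter> S))" "open (\<phi> ` (U \<inter> T))"
        using * c by blast+
      ultimately show "open (\<phi> ` (U \<inter> (S \<inter> T)))"
        by (metis open_Int)
    qed
  next
    fix \<K>
    assume *: "\<forall>K\<in>\<K>. K \<subseteq> points A \<and> (\<forall>(U, \<phi>)\<in>A. open (\<phi> ` (U \<inter> K)))"
    have "open (\<phi> ` (U \<inter> \<Union>\<K>))" if "(U, \<phi>) \<in> A" for U \<phi>
    proof -
      have "\<phi> ` (U \<inter> \<Union>\<K>) = (\<Union>K\<in>\<K>. \<phi> ` (U \<inter> K))"
        by blast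
      moreover have "open (\<Union>K\<in>\<K>. \<phi> ` (U \<inter> K))"
        using * that by (intro open_UN) blast
      ultimately show ?thesis
        by simp
    qed
    then show "\<forall>(U, \<phi>)\<in>A. open (\<phi> ` (U \<inter> \<Union>\<K>))"
      by blast
    show "\<Union>\<K> \<subseteq> points A"
      using * by blast
  qed
  then show ?thesis
    by (simp add: manifold_topology_def topology_inverse')
qed

definition smooth_manifold :: "('a, 'e::euclidean_space) chart set \<Rightarrow> bool" where
  "smooth_manifold A \<longleftrightarrow> smooth_atlas A \<and>
     Hausdorff_space (manifold_topology A) \<and> second_countable (manifold_topology A)"

text \<open>The charts of the maximal atlas containing \<open>A\<close>.\<close>

definition coord_chart :: "('a, 'e::euclidean_space) chart set \<Rightarrow> ('a, 'e) chart \<Rightarrow> bool" where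
  "coord_chart A c \<longleftrightarrow>
     is_chart c \<and> fst c \<subseteq> points A \<and> (\<forall>d\<in>A. smoothly_compatible c d)"

definition prod_atlas ::
    "('a, 'e) chart set \<Rightarrow> ('b, 'f) chart set \<Rightarrow> ('a \<times> 'b, 'e \<times> 'f) chart set" where
  "prod_atlas A B = {(U \<times> V, map_prod \<phi> \<psi>) | U \<phi> V \<psi>. (U, \<phi>) \<in> A \<and> (V, \<psi>) \<in> B}"

definition real_atlas :: "(real, real) chart set" where
  "real_atlas = {(UNIV, id)}"

definition smooth_map ::
    "('a, 'e::euclidean_space) chart set \<Rightarrow> ('b, 'f::euclidean_space) chart set \<Rightarrow>
     'a set \<Rightarrow> ('a \<Rightarrow> 'b) \<Rightarrow> bool" where
  "smooth_map A B S f \<longleftrightarrow>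
     (\<forall>x\<in>S. \<exists>U \<phi> V \<psi>. coord_chart A (U, \<phi>) \<and> coord_chart B (V, \<psi>) \<and>
        x \<in> U \<and> U \<subseteq> S \<and> f ` U \<subseteq> V \<and> smooth_on (\<phi> ` U) (\<psi> \<circ> f \<circ> inv_into U \<phi>))"

definition local_diffeo :: "('a, 'e::euclidean_space) chart set \<Rightarrow> 'a set \<Rightarrow> ('a \<Rightarrow> 'a) \<Rightarrow> bool" where
  "local_diffeo A S f \<longleftrightarrow>
     (\<forall>x\<in>S. \<exists>W. x \<in> W \<and> W \<subseteq> S \<and>
        openin (manifold_topology A) W \<and> openin (manifold_topology A) (f ` W) \<and>
        inj_on f W \<and> smooth_map A A W f \<and> smooth_map A A (f ` W) (inv_into W f))"

definition lie_group ::
    "('a, 'e::euclidean_space) chart set \<Rightarrow> ('a, 'c) monoid_scheme \<Rightarrow> bool" where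
  "lie_group A G \<longleftrightarrow> smooth_manifold A \<and> group G \<and> carrier G = points A \<and>
     smooth_map (prod_atlas A A) A (points A \<times> points A) (\<lambda>(x, y). mult G x y) \<and>
     smooth_map A A (points A) (m_inv G)"

subsection \<open>Tangent vectors\<close>

text \<open>Curves defined near \<open>0\<close> are total functions of which only the germ at \<open>0\<close> matters. A tangent
  vector at \<open>m\<close> is a class of smooth curves through \<open>m\<close> with equal velocity in all charts.\<close>

definition curve_at :: "('a, 'e::euclidean_space) chart set \<Rightarrow> 'a \<Rightarrow> (real \<Rightarrow> 'a) \<Rightarrow> bool" where
  "curve_at A m c \<longleftrightarrow> c 0 = m \<and> (\<exists>S. open S \<and> 0 \<in> S \<and> smooth_map real_atlas A S c)"

definition velocity :: "('a \<Rightarrow> 'e::real_normed_vector) \<Rightarrow> (real \<Rightarrow> 'a) \<Rightarrow> 'e" where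
  "velocity \<phi> c = vector_derivative (\<phi> \<circ> c) (at 0)"

definition acceleration :: "('a \<Rightarrow> 'e::real_normed_vector) \<Rightarrow> (real \<Rightarrow> 'a) \<Rightarrow> 'e" where
  "acceleration \<phi> c = vector_derivative (\<lambda>t. vector_derivative (\<phi> \<circ> c) (at t)) (at 0)"

definition tangent_vector ::
    "('a, 'e::euclidean_space) chart set \<Rightarrow> 'a \<Rightarrow> (real \<Rightarrow> 'a) \<Rightarrow> (real \<Rightarrow> 'a) set" where
  "tangent_vector A m c =
     {c'. curve_at A m c' \<and>
          (\<forall>U \<phi>. coord_chart A (U, \<phi>) \<and> m \<in> U \<longrightarrow> velocity \<phi> c' = velocity \<phi> c)}"

definition tangent_space ::
    "('a, 'e::euclidean_space) chart set \<Rightarrow> 'a \<Rightarrow> (real \<Rightarrow> 'a) set set" where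
  "tangent_space A m = {tangent_vector A m c | c. curve_at A m c}"

definition tangent_bundle ::
    "('a, 'e::euclidean_space) chart set \<Rightarrow> (real \<Rightarrow> 'a) set set" where
  "tangent_bundle A = (\<Union>m\<in>points A. tangent_space A m)"

text \<open>The components of a tangent vector in a chart. The linear structure of a tangent space is
  the one for which these component maps are linear.\<close>

definition tangent_coord :: "('a \<Rightarrow> 'e::real_normed_vector) \<Rightarrow> (real \<Rightarrow> 'a) set \<Rightarrow> 'e" where
  "tangent_coord \<phi> X = velocity \<phi> (SOME c. c \<in> X)"

definition smooth_vector_field ::
    "('a, 'e::euclidean_space) chart set \<Rightarrow> 'a set \<Rightarrow> ('a \<Rightarrow> (real \<Rightarrow> 'a) set) \<Rightarrow> bool" where
  "smooth_vector_field A W X \<longleftrightarrow>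
     (\<forall>x\<in>W. X x \<in> tangent_space A x) \<and>
     (\<forall>U \<phi>. coord_chart A (U, \<phi>) \<longrightarrow>
        smooth_on (\<phi> ` (U \<inter> W)) (\<lambda>y. tangent_coord \<phi> (X (inv_into U \<phi> y))))"

subsection \<open>Distributions\<close>

definition fibre ::
    "('a, 'e::euclidean_space) chart set \<Rightarrow> (real \<Rightarrow> 'a) set set \<Rightarrow> 'a \<Rightarrow> (real \<Rightarrow> 'a) set set" where
  "fibre A H m = H \<inter> tangent_space A m"

text \<open>Smooth subbundles of rank \<open>p\<close> of the tangent bundle.\<close>

definition distribution ::
    "('a, 'e::euclidean_space) chart set \<Rightarrow> nat \<Rightarrow> (real \<Rightarrow> 'a) set set \<Rightarrow> bool" where
  "distribution A p H \<longleftrightarrow> H \<subseteq> tangent_bundle A \<and>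
     (\<forall>m U \<phi>. coord_chart A (U, \<phi>) \<and> m \<in> U \<longrightarrow>
        subspace (tangent_coord \<phi> ` fibre A H m) \<and>
        dim (tangent_coord \<phi> ` fibre A H m) = p) \<and>
     (\<forall>m\<in>points A. \<exists>W X. openin (manifold_topology A) W \<and> m \<in> W \<and>
        (\<forall>i<p. smooth_vector_field A W (X i)) \<and>
        (\<forall>x\<in>W. \<forall>U \<phi>. coord_chart A (U, \<phi>) \<and> x \<in> U \<longrightarrow>
           tangent_coord \<phi> ` fibre A H x = span {tangent_coord \<phi> (X i x) | i. i < p}))"

text \<open>The first \<open>p\<close> indices, and \<open>\<real>\<^sup>p \<times> {0}\<close> inside \<open>\<real>\<^sup>n\<close>.\<close>

definition first_coords :: "nat \<Rightarrow> 'n::{finite,linorder} set" where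
  "first_coords p = {i. card {j. j < i} < p}"

definition horizontal :: "nat \<Rightarrow> (real ^ 'n::{finite,linorder}) set" where
  "horizontal p = {x. \<forall>i. i \<notin> first_coords p \<longrightarrow> x $ i = 0}"

definition H_chart ::
    "('a, real ^ 'n::{finite,linorder}) chart set \<Rightarrow> (real \<Rightarrow> 'a) set set \<Rightarrow> nat \<Rightarrow> 'a \<Rightarrow>
     ('a, real ^ 'n::{finite,linorder}) chart \<Rightarrow> bool" where
  "H_chart A H p m = (\<lambda>(U, \<phi>). coord_chart A (U, \<phi>) \<and> m \<in> U \<and> \<phi> m = 0 \<and>
     tangent_coord \<phi> ` fibre A H m = span ((\<lambda>i. axis i 1) ` first_coords p))"

subsection \<open>Parabolic arrows\<close>

definition tangent_curve_at ::
    "('a, 'e::euclidean_space) chart set \<Rightarrow> (real \<Rightarrow> 'a) set set \<Rightarrow> 'a \<Rightarrow> (real \<Rightarrow> 'a) \<Rightarrow> bool" where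
  "tangent_curve_at A H m c \<longleftrightarrow> curve_at A m c \<and> tangent_vector A m c \<in> H"

definition parabolic_equiv ::
    "('a, real ^ 'n::{finite,linorder}) chart set \<Rightarrow> (real \<Rightarrow> 'a) set set \<Rightarrow> nat \<Rightarrow>
     (real \<Rightarrow> 'a) \<Rightarrow> (real \<Rightarrow> 'a) \<Rightarrow> bool" where
  "parabolic_equiv A H p c1 c2 \<longleftrightarrow> c1 0 = c2 0 \<and>
     (\<forall>U \<phi>. H_chart A H p (c1 0) (U, \<phi>) \<longrightarrow>
        velocity \<phi> c1 = velocity \<phi> c2 \<and>
        acceleration \<phi> c1 - acceleration \<phi> c2 \<in> horizontal p)"

definition parabolic_arrow ::
    "('a, real ^ 'n::{finite,linorder}) chart set \<Rightarrow> (real \<Rightarrow> 'a) set set \<Rightarrow> nat \<Rightarrow>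
     (real \<Rightarrow> 'a) \<Rightarrow> (real \<Rightarrow> 'a) set" where
  "parabolic_arrow A H p c = {c'. tangent_curve_at A H (c 0) c' \<and> parabolic_equiv A H p c c'}"

definition parabolic_arrows ::
    "('a, real ^ 'n::{finite,linorder}) chart set \<Rightarrow> (real \<Rightarrow> 'a) set set \<Rightarrow> nat \<Rightarrow> 'a \<Rightarrow>
     (real \<Rightarrow> 'a) set set" where
  "parabolic_arrows A H p m = {parabolic_arrow A H p c | c. tangent_curve_at A H m c}"

text \<open>\<open>x = (h, n)\<close> is sent to the arrow of the curve \<open>(t h, t\<^sup>2 n)\<close>.\<close>

definition taylor_arrow ::
    "('a, real ^ 'n::{finite,linorder}) chart set \<Rightarrow> (real \<Rightarrow> 'a) set set \<Rightarrow> nat \<Rightarrow>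
     ('a, real ^ 'n::{finite,linorder}) chart \<Rightarrow> real ^ 'n::{finite,linorder} \<Rightarrow> (real \<Rightarrow> 'a) set" where
  "taylor_arrow A H p = (\<lambda>(U, \<phi>) x. parabolic_arrow A H p
     (\<lambda>t. inv_into U \<phi> (\<chi> i. if i \<in> first_coords p then t * x $ i else t\<^sup>2 * x $ i)))"

definition arrow_atlas ::
    "('a, real ^ 'n::{finite,linorder}) chart set \<Rightarrow> (real \<Rightarrow> 'a) set set \<Rightarrow> nat \<Rightarrow> 'a \<Rightarrow>
     ((real \<Rightarrow> 'a) set, real ^ 'n::{finite,linorder}) chart set" where
  "arrow_atlas A H p m =
     {(parabolic_arrows A H p m, inv_into UNIV (taylor_arrow A H p c)) | c. H_chart A H p m c}"

subsection \<open>Parabolic flows\<close>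

text \<open>A flow is a map \<open>\<Phi>\<close> paired with its domain \<open>V\<close>. The domain need not contain all of
  \<open>M \<times> {0}\<close>, so flows defined only near a point are included.\<close>

type_synonym 'a flow = "('a \<times> real) set \<times> ('a \<times> real \<Rightarrow> 'a)"

definition local_flow :: "('a, 'e::euclidean_space) chart set \<Rightarrow> 'a flow \<Rightarrow> bool" where
  "local_flow A = (\<lambda>(V, \<Phi>).
     openin (manifold_topology (prod_atlas A real_atlas)) V \<and>
     smooth_map (prod_atlas A real_atlas) A V \<Phi> \<and>
     (\<forall>x. (x, 0) \<in> V \<longrightarrow> \<Phi> (x, 0) = x) \<and>
     (\<forall>t. local_diffeo A {x. (x, t) \<in> V} (\<lambda>x. \<Phi> (x, t))))"

definition flow_comp :: "'a flow \<Rightarrow> 'a flow \<Rightarrow> 'a flow" where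
  "flow_comp = (\<lambda>(V, \<Phi>) (W, \<Psi>).
     ({(x, t). (x, t) \<in> W \<and> (\<Psi> (x, t), t) \<in> V}, \<lambda>(x, t). \<Phi> (\<Psi> (x, t), t)))"

definition flow_line :: "'a flow \<Rightarrow> 'a \<Rightarrow> real \<Rightarrow> 'a" where
  "flow_line F m = (\<lambda>t. snd F (m, t))"

definition defined_near :: "'a flow \<Rightarrow> 'a \<Rightarrow> bool" where
  "defined_near F m \<longleftrightarrow> (m, 0) \<in> fst F"

definition parabolic_flow ::
    "('a, 'e::euclidean_space) chart set \<Rightarrow> (real \<Rightarrow> 'a) set set \<Rightarrow> 'a flow \<Rightarrow> bool" where
  "parabolic_flow A H F \<longleftrightarrow> local_flow A F \<and>
     (\<forall>x. defined_near F x \<longrightarrow> tangent_vector A x (flow_line F x) \<in> H)"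

definition flow_arrow ::
    "('a, real ^ 'n::{finite,linorder}) chart set \<Rightarrow> (real \<Rightarrow> 'a) set set \<Rightarrow> nat \<Rightarrow> 'a \<Rightarrow>
     'a flow \<Rightarrow> (real \<Rightarrow> 'a) set" where
  "flow_arrow A H p m F = parabolic_arrow A H p (flow_line F m)"

definition arrow_mult ::
    "('a, real ^ 'n::{finite,linorder}) chart set \<Rightarrow> (real \<Rightarrow> 'a) set set \<Rightarrow> nat \<Rightarrow> 'a \<Rightarrow>
     (real \<Rightarrow> 'a) set \<Rightarrow> (real \<Rightarrow> 'a) set \<Rightarrow> (real \<Rightarrow> 'a) set" where
  "arrow_mult A H p m a b = (THE c. \<exists>F G.
     parabolic_flow A H F \<and> defined_near F m \<and> flow_arrow A H p m F = a \<and>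
     parabolic_flow A H G \<and> defined_near G m \<and> flow_arrow A H p m G = b \<and>
     c = flow_arrow A H p m (flow_comp F G))"

end

theory Submission
  imports Defs
begin

text \<open>
Parabolic arrows at \<open>m\<close> only see curves and flows to second order, so everything can be computed
in H-coordinates centred at \<open>m\<close>. There an arrow is recorded by its Taylor coordinates
\<open>x = (h, n)\<close>: the velocity \<open>h\<close>, which is horizontal, and half the vertical part \<open>n\<close> of the
acceleration. A change of H-coordinates acts on them by a polynomial map
(\<open>taylor_coord_change\<close>), because its derivative at the origin preserves the horizontal subspace
and the forgotten horizontal part of the acceleration therefore never becomes visible. Hence any
H-chart gives a global chart of the space of arrows, and two such charts are compatible.

Let \<open>f (y, t)\<close> be a parabolic flow in coordinates, with generator \<open>X\<close>, and let \<open>g\<close> be the line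
through the origin of a second one. Differentiating \<open>f (g t, t)\<close> twice at \<open>t = 0\<close>, with
\<open>f (y, 0) = y\<close>, shows that the velocities of the two flow lines add up, and that their
accelerations do so up to the extra term \<open>2 D X (0) (g' (0))\<close>
(\<open>second_derivative_flow_composition\<close>). The decisive point is that the vertical part of this
term depends only on \<open>X (0)\<close> and \<open>g' (0)\<close>, hence only on the two arrows. Indeed \<open>X\<close> is a section
of \<open>H\<close>. Choose a local frame \<open>Z\<^sub>j\<close> of \<open>H\<close> whose value at the origin is the standard basis of the
horizontal subspace, and write \<open>X = \<Sum> u\<^sub>j Z\<^sub>j\<close>. Differentiating a coefficient \<open>u\<^sub>j\<close> contributes
a multiple of \<open>Z\<^sub>j (0)\<close>, which is horizontal, so that only \<open>\<Sum> u\<^sub>j (0) D Z\<^sub>j (0)\<close> is left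
(\<open>derivative_of_section\<close>).

In Taylor coordinates the product is therefore \<open>x + y + b (x, y)\<close>, where \<open>b\<close> is bilinear, takes
vertical values and depends only on the horizontal parts of its arguments
(\<open>taylor_coord_flow_comp\<close>). Iterating \<open>b\<close> gives zero, so this is an associative law with neutral
element \<open>0\<close> and inverse \<open>- x + b (x, x)\<close>, and all its operations are polynomial
(\<open>lie_group_global_chart\<close>).

Every arrow is represented by a parabolic flow (\<open>ex_parabolic_flow\<close>): in coordinates one can take
\<open>y + t X (y) + t\<^sup>2 n\<close>, where \<open>X\<close> has the constant coefficients \<open>h\<close> in the frame \<open>Z\<^sub>j\<close>. Its
time-\<open>t\<close> maps are diffeomorphisms onto their images near \<open>m\<close> by the inverse function theorem
\<open>smooth_on_inv_into\<close>.
\<close>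

section \<open>Calculus of smooth maps\<close>

subsection \<open>Closure properties of k-fold differentiability\<close>

text \<open>The congruence premise makes the rule usable inside the inductive proof of
\<open>times_differentiable_on_cong\<close>, where congruence is only known for order \<open>k\<close>.\<close>

lemma times_differentiable_on_SucI:
  fixes f :: "'a::real_normed_vector \<Rightarrow> 'b::real_normed_vector"
  assumes "open S"
    and "\<And>x. x \<in> S \<Longrightarrow> (f has_derivative f' x) (at x)"
    and "\<And>v. times_differentiable_on k S (\<lambda>x. f' x v)"
    and cong: "\<And>g h :: 'a \<Rightarrow> 'b. times_differentiable_on k S g \<Longrightarrow> (\<And>x. x \<in> S \<Longrightarrow> g x = h x) \<Longrightarrow>
        times_differentiable_on k S h"
  shows "times_differentiable_on (Suc k) S f"
proof -
  have "frechet_derivative f (at x) = f' x" if "x \<in> S" for x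
    using frechet_derivative_at[OF assms(2)[OF that]] by simp
  then have "times_differentiable_on k S (\<lambda>x. frechet_derivative f (at x) v)" for v
    using cong[OF assms(3)[of v], of "\<lambda>x. frechet_derivative f (at x) v"] by simp
  then show ?thesis
    using assms(2) by (auto simp: differentiable_def)
qed

lemma times_differentiable_on_cong:
  assumes "open S" "times_differentiable_on k S f" "\<And>x. x \<in> S \<Longrightarrow> f x = g x"
  shows "times_differentiable_on k S g"
  using assms(2,3)
proof (induction k arbitrary: f g)
  case 0
  then show ?case by (auto cong: continuous_on_cong)
next
  case (Suc k)
  show ?case
  proof (rule times_differentiable_on_SucI[OF \<open>open S\<close>, where f' = "\<lambda>x. frechet_derivative f (at x)"])
    show "(g has_derivative frechet_derivative f (at x)) (at x)" if "x \<in> S" for x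
      by (rule has_derivative_transform_within_open[of f _ x UNIV S])
        (use that Suc.prems \<open>open S\<close> in \<open>simp_all add: frechet_derivative_works[symmetric]\<close>)
  qed (use Suc in auto)
qed

lemma times_differentiable_on_derivativeI:
  assumes "open S"
    and "\<And>x. x \<in> S \<Longrightarrow> (f has_derivative f' x) (at x)"
    and "\<And>v. times_differentiable_on k S (\<lambda>x. f' x v)"
  shows "times_differentiable_on (Suc k) S f"
  by (rule times_differentiable_on_SucI[OF assms])
    (simp, rule times_differentiable_on_cong[OF \<open>open S\<close>])

lemma times_differentiable_on_Suc_has_derivative:
  assumes "times_differentiable_on (Suc k) S f" "x \<in> S"
  shows "(f has_derivative frechet_derivative f (at x)) (at x)"
  using assms by (simp add: frechet_derivative_works[symmetric])

lemma times_differentiable_on_Suc_imp: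
  "times_differentiable_on (Suc k) S f \<Longrightarrow> times_differentiable_on k S f"
proof (induction k arbitrary: f)
  case 0
  then show ?case
    by (auto intro!: continuous_at_imp_continuous_on differentiable_imp_continuous_within)
qed auto

lemma times_differentiable_on_subset:
  "times_differentiable_on k S f \<Longrightarrow> T \<subseteq> S \<Longrightarrow> times_differentiable_on k T f"
  by (induction k arbitrary: f) (auto intro: continuous_on_subset)

lemma times_differentiable_on_local:
  assumes "\<And>x. x \<in> S \<Longrightarrow> \<exists>T. open T \<and> x \<in> T \<and> times_differentiable_on k T f"
  shows "times_differentiable_on k S f"
  using assms
proof (induction k arbitrary: f)
  case 0
  have "isCont f x" if "x \<in> S" for x
    using 0[OF that] continuous_on_interior interior_open by fastforce
  then show ?case
    by (simp add: continuous_at_imp_continuous_on)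
next
  case (Suc k)
  have "f differentiable at x" if "x \<in> S" for x
    using Suc.prems[OF that] by auto
  moreover have "times_differentiable_on k S (\<lambda>x. frechet_derivative f (at x) v)" for v
  proof (rule Suc.IH)
    show "\<exists>T. open T \<and> x \<in> T \<and> times_differentiable_on k T (\<lambda>x. frechet_derivative f (at x) v)"
      if "x \<in> S" for x
      using Suc.prems[OF that] by auto
  qed
  ultimately show ?case by simp
qed

lemma times_differentiable_on_const: "open S \<Longrightarrow> times_differentiable_on k S (\<lambda>x. c)"
proof (induction k arbitrary: c)
  case (Suc k)
  then show ?case
    by (intro times_differentiable_on_derivativeI[where f' = "\<lambda>x v. 0"]) auto
qed auto

lemma times_differentiable_on_bounded_linear_compose:
  assumes "bounded_linear L" "open S" "times_differentiable_on k S f"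
  shows "times_differentiable_on k S (\<lambda>x. L (f x))"
  using assms(3)
proof (induction k arbitrary: f)
  case 0
  then show ?case
    using bounded_linear.continuous_on[OF assms(1)] by auto
next
  case (Suc k)
  then show ?case
    by (intro times_differentiable_on_derivativeI[OF \<open>open S\<close>,
          where f' = "\<lambda>x v. L (frechet_derivative f (at x) v)"])
      (auto intro!: bounded_linear.has_derivative[OF assms(1)]
        simp: frechet_derivative_works[symmetric])
qed

lemma times_differentiable_on_add:
  assumes "open S" "times_differentiable_on k S f" "times_differentiable_on k S g"
  shows "times_differentiable_on k S (\<lambda>x. f x + g x)"
  using assms(2,3)
proof (induction k arbitrary: f g)
  case 0
  then show ?case by (auto intro: continuous_on_add)
next
  case (Suc k)
  then show ?case
    by (intro times_differentiable_on_derivativeI[OF \<open>open S\<close>, where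
          f' = "\<lambda>x v. frechet_derivative f (at x) v + frechet_derivative g (at x) v"])
      (auto intro!: has_derivative_add simp: frechet_derivative_works[symmetric])
qed

lemma times_differentiable_on_bilinear:
  assumes "bounded_bilinear P" "open S" "times_differentiable_on k S f" "times_differentiable_on k S g"
  shows "times_differentiable_on k S (\<lambda>x. P (f x) (g x))"
  using assms(3,4)
proof (induction k arbitrary: f g)
  case 0
  then show ?case using bounded_bilinear.continuous_on[OF assms(1)] by auto
next
  case (Suc k)
  note lower = Suc.prems[THEN times_differentiable_on_Suc_imp]
  show ?case
  proof (rule times_differentiable_on_derivativeI[OF \<open>open S\<close>])
    show "((\<lambda>x. P (f x) (g x)) has_derivative
        (\<lambda>v. P (f x) (frechet_derivative g (at x) v) + P (frechet_derivative f (at x) v) (g x))) (at x)"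
      if "x \<in> S" for x
      using that Suc.prems
      by (intro bounded_bilinear.FDERIV[OF assms(1)]) (auto simp: frechet_derivative_works[symmetric])
    show "times_differentiable_on k S
        (\<lambda>x. P (f x) (frechet_derivative g (at x) v) + P (frechet_derivative f (at x) v) (g x))" for v
      using Suc.prems lower by (intro times_differentiable_on_add[OF \<open>open S\<close>] Suc.IH) auto
  qed
qed

lemma times_differentiable_on_sum:
  assumes "open S" "\<And>i. i \<in> I \<Longrightarrow> times_differentiable_on k S (f i)"
  shows "times_differentiable_on k S (\<lambda>x. \<Sum>i\<in>I. f i x)"
  using assms(2)
  by (induction I rule: infinite_finite_induct)
    (auto intro!: times_differentiable_on_const times_differentiable_on_add[OF \<open>open S\<close>] \<open>open S\<close>)

text \<open>Differentiability of higher order is defined through derivatives in a fixed direction, whereas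
the chain rule applies \<open>D g\<close> in the moving direction \<open>D f (x) v\<close>. Expanding this direction in
a basis turns the derivative of the composition into a sum of products of functions to which the
induction hypothesis applies.\<close>

lemma times_differentiable_on_compose:
  fixes f :: "'a::real_normed_vector \<Rightarrow> 'b::euclidean_space" and g :: "'b \<Rightarrow> 'c::real_normed_vector"
  assumes "open S" "open T" "f ` S \<subseteq> T" "times_differentiable_on k S f" "times_differentiable_on k T g"
  shows "times_differentiable_on k S (\<lambda>x. g (f x))"
  using assms(4,5)
proof (induction k arbitrary: g)
  case 0
  then show ?case
    using continuous_on_compose2[of T g S f] assms(3) by auto
next
  case (Suc k)
  let ?D = "\<lambda>x v. \<Sum>b\<in>Basis. (frechet_derivative f (at x) v \<bullet> b) *\<^sub>R frechet_derivative g (at (f x)) b"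
  show ?case
  proof (rule times_differentiable_on_derivativeI[OF \<open>open S\<close>, of _ ?D])
    fix x assume x: "x \<in> S"
    then have g: "(g has_derivative frechet_derivative g (at (f x))) (at (f x))"
      using Suc.prems(2) assms(3) times_differentiable_on_Suc_has_derivative by blast
    interpret G: bounded_linear "frechet_derivative g (at (f x))"
      using g by (rule has_derivative_bounded_linear)
    have "?D x v = frechet_derivative g (at (f x)) (frechet_derivative f (at x) v)" for v
      by (subst (2) euclidean_representation[symmetric, of "frechet_derivative f (at x) v"])
        (simp add: G.sum G.scaleR)
    then show "((\<lambda>x. g (f x)) has_derivative ?D x) (at x)"
      using has_derivative_compose[OF times_differentiable_on_Suc_has_derivative[OF Suc.prems(1) x] g]
      by presburger
  next
    fix v
    have "times_differentiable_on k S (\<lambda>x. frechet_derivative g (at (f x)) b)" for b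
      using Suc.prems(2) by (intro Suc.IH times_differentiable_on_Suc_imp[OF Suc.prems(1)]) auto
    then show "times_differentiable_on k S (\<lambda>x. ?D x v)"
      using Suc.prems(1) \<open>open S\<close>
      by (intro times_differentiable_on_sum times_differentiable_on_bilinear[OF bounded_bilinear_scaleR]
          times_differentiable_on_bounded_linear_compose[OF bounded_linear_inner_left]) auto
  qed
qed

lemma times_differentiable_on_inverse:
  fixes f :: "'a::real_normed_vector \<Rightarrow> real"
  assumes "open S" "times_differentiable_on k S f" "\<And>x. x \<in> S \<Longrightarrow> f x \<noteq> 0"
  shows "times_differentiable_on k S (\<lambda>x. inverse (f x))"
  using assms(2)
proof (induction k)
  case 0
  then show ?case using assms(3) by (auto intro!: continuous_on_inverse)
next
  case (Suc k)
  show ?case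
  proof (rule times_differentiable_on_derivativeI[OF \<open>open S\<close>])
    show "((\<lambda>x. inverse (f x)) has_derivative
        (\<lambda>v. - (inverse (f x) * frechet_derivative f (at x) v * inverse (f x)))) (at x)" if "x \<in> S" for x
      using that Suc.prems assms(3)
      by (intro Deriv.has_derivative_inverse) (auto simp: frechet_derivative_works[symmetric])
    show "times_differentiable_on k S (\<lambda>x. - (inverse (f x) * frechet_derivative f (at x) v * inverse (f x)))" for v
      using Suc times_differentiable_on_Suc_imp[OF Suc.prems] \<open>open S\<close>
      by (intro times_differentiable_on_bounded_linear_compose[OF bounded_linear_minus[OF bounded_linear_ident]]
          times_differentiable_on_bilinear[OF bounded_bilinear_mult]) auto
  qed
qed

subsection \<open>Smoothness at a point\<close>

text \<open>Charts of a manifold are only comparable near a point. Smoothness at a point spares the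
bookkeeping of domains when transition maps are composed.\<close>

definition smooth_at :: "('a::real_normed_vector \<Rightarrow> 'b::real_normed_vector) \<Rightarrow> 'a \<Rightarrow> bool" where
  "smooth_at f x \<longleftrightarrow> (\<exists>T. open T \<and> x \<in> T \<and> smooth_on T f)"

lemma smooth_atE:
  assumes "smooth_at f x"
  obtains T where "open T" "x \<in> T" "smooth_on T f"
  using assms unfolding smooth_at_def by blast

lemma smooth_atI: "open T \<Longrightarrow> x \<in> T \<Longrightarrow> smooth_on T f \<Longrightarrow> smooth_at f x"
  unfolding smooth_at_def by blast

lemma smooth_on_subset: "smooth_on S f \<Longrightarrow> T \<subseteq> S \<Longrightarrow> smooth_on T f"
  by (auto simp: smooth_on_def intro: times_differentiable_on_subset)

lemma smooth_on_times_differentiable_on: "smooth_on S f \<Longrightarrow> times_differentiable_on k S f"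
  by (simp add: smooth_on_def)

lemma smooth_on_imp_continuous_on: "smooth_on S f \<Longrightarrow> continuous_on S f"
  using smooth_on_times_differentiable_on[of S f 0] by simp

lemma smooth_onI_smooth_at:
  assumes "\<And>x. x \<in> S \<Longrightarrow> smooth_at f x"
  shows "smooth_on S f"
  unfolding smooth_on_def
proof
  fix k
  show "times_differentiable_on k S f"
  proof (rule times_differentiable_on_local)
    show "\<exists>T. open T \<and> x \<in> T \<and> times_differentiable_on k T f" if "x \<in> S" for x
      using assms[OF that] by (auto simp: smooth_at_def smooth_on_def)
  qed
qed

lemma smooth_on_open_iff: "open S \<Longrightarrow> smooth_on S f \<longleftrightarrow> (\<forall>x\<in>S. smooth_at f x)"
  using smooth_onI_smooth_at[of S f] smooth_atI[of S _ f] by blast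

lemma eventually_smooth_at: "smooth_at f x \<Longrightarrow> eventually (smooth_at f) (nhds x)"
  by (elim smooth_atE) (auto simp: eventually_nhds intro: smooth_atI)

lemma smooth_at_imp_has_derivative:
  assumes "smooth_at f x"
  shows "(f has_derivative frechet_derivative f (at x)) (at x)"
proof -
  obtain T where "open T" "x \<in> T" "smooth_on T f" using smooth_atE[OF assms] .
  then show ?thesis
    using times_differentiable_on_Suc_has_derivative[of 0 T f x] by (simp add: smooth_on_def)
qed

lemma smooth_at_imp_isCont: "smooth_at f x \<Longrightarrow> isCont f x"
  using smooth_at_imp_has_derivative has_derivative_continuous by blast

lemma smooth_at_frechet_derivative:
  assumes "smooth_at f x"
  shows "smooth_at (\<lambda>y. frechet_derivative f (at y) v) x"
proof -
  obtain T where T: "open T" "x \<in> T" "smooth_on T f" using smooth_atE[OF assms] .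
  have "times_differentiable_on k T (\<lambda>y. frechet_derivative f (at y) v)" for k
    using smooth_on_times_differentiable_on[OF T(3), of "Suc k"] by simp
  then have "smooth_on T (\<lambda>y. frechet_derivative f (at y) v)"
    by (simp add: smooth_on_def)
  with T(1,2) show ?thesis by (rule smooth_atI)
qed

lemma smooth_at_cong:
  assumes "smooth_at f x" "eventually (\<lambda>y. f y = g y) (nhds x)"
  shows "smooth_at g x"
proof -
  obtain T where T: "open T" "x \<in> T" "smooth_on T f" using smooth_atE[OF assms(1)] .
  obtain T' where T': "open T'" "x \<in> T'" "\<And>y. y \<in> T' \<Longrightarrow> f y = g y"
    using assms(2) unfolding eventually_nhds by blast
  have "smooth_on (T \<inter> T') g"
    unfolding smooth_on_def
  proof
    fix k
    have "times_differentiable_on k (T \<inter> T') f"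
      using T(3) times_differentiable_on_subset[of k T f "T \<inter> T'"] by (simp add: smooth_on_def)
    then show "times_differentiable_on k (T \<inter> T') g"
      by (rule times_differentiable_on_cong[rotated]) (use T T' in auto)
  qed
  with T T' show ?thesis
    by (intro smooth_atI[of "T \<inter> T'"]) auto
qed

lemma smooth_at_common_neighbourhood:
  assumes "smooth_at f x" "smooth_at g x"
  obtains T where "open T" "x \<in> T" "smooth_on T f" "smooth_on T g"
proof -
  obtain T where "open T" "x \<in> T" "smooth_on T f" using smooth_atE[OF assms(1)] .
  moreover obtain T' where "open T'" "x \<in> T'" "smooth_on T' g" using smooth_atE[OF assms(2)] .
  ultimately show thesis
    by (intro that[of "T \<inter> T'"]) (auto intro: smooth_on_subset)
qed

lemma smooth_at_const: "smooth_at (\<lambda>x. c) x"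
  by (rule smooth_atI[of UNIV]) (simp_all add: smooth_on_def times_differentiable_on_const)

lemma smooth_at_ident: "smooth_at (\<lambda>x. x) x"
proof -
  have "times_differentiable_on k UNIV (\<lambda>x::'a. x)" for k
  proof (cases k)
    case (Suc k')
    have "times_differentiable_on (Suc k') UNIV (\<lambda>x::'a. x)"
      by (rule times_differentiable_on_derivativeI[where f' = "\<lambda>x v. v"])
        (simp_all add: times_differentiable_on_const)
    then show ?thesis using Suc by simp
  qed auto
  then show ?thesis
    by (intro smooth_atI[of UNIV]) (simp_all add: smooth_on_def)
qed

lemma smooth_at_bounded_linear_compose:
  "bounded_linear L \<Longrightarrow> smooth_at f x \<Longrightarrow> smooth_at (\<lambda>y. L (f y)) x"
  by (elim smooth_atE, rule smooth_atI)
    (auto simp: smooth_on_def intro: times_differentiable_on_bounded_linear_compose)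

lemmas smooth_at_bounded_linear = smooth_at_bounded_linear_compose[OF _ smooth_at_ident]

lemma smooth_at_bilinear:
  assumes "bounded_bilinear P" "smooth_at f x" "smooth_at g x"
  shows "smooth_at (\<lambda>y. P (f y) (g y)) x"
proof -
  obtain T where "open T" "x \<in> T" "smooth_on T f" "smooth_on T g"
    using smooth_at_common_neighbourhood[OF assms(2,3)] by blast
  then show ?thesis
    by (intro smooth_atI) (auto simp: smooth_on_def intro: times_differentiable_on_bilinear[OF assms(1)])
qed

lemma smooth_at_add:
  assumes "smooth_at f x" "smooth_at g x"
  shows "smooth_at (\<lambda>y. f y + g y) x"
proof -
  obtain T where "open T" "x \<in> T" "smooth_on T f" "smooth_on T g"
    using smooth_at_common_neighbourhood[OF assms] by blast
  then show ?thesis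
    by (intro smooth_atI) (auto simp: smooth_on_def intro: times_differentiable_on_add)
qed

lemmas smooth_at_scaleR = smooth_at_bilinear[OF bounded_bilinear_scaleR]
lemmas smooth_at_mult = smooth_at_bilinear[OF bounded_bilinear_mult]
lemmas smooth_at_minus = smooth_at_bounded_linear_compose[OF bounded_linear_minus[OF bounded_linear_ident]]
lemmas smooth_at_vec_nth = smooth_at_bounded_linear_compose[OF bounded_linear_vec_nth]

lemma smooth_at_diff: "smooth_at f x \<Longrightarrow> smooth_at g x \<Longrightarrow> smooth_at (\<lambda>y. f y - g y) x"
  unfolding diff_conv_add_uminus by (intro smooth_at_add smooth_at_minus)

lemma smooth_at_sum: "(\<And>i. i \<in> I \<Longrightarrow> smooth_at (f i) x) \<Longrightarrow> smooth_at (\<lambda>y. \<Sum>i\<in>I. f i y) x"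
  by (induction I rule: infinite_finite_induct) (auto intro: smooth_at_const smooth_at_add)

lemma smooth_at_prod:
  fixes f :: "'i \<Rightarrow> 'a::real_normed_vector \<Rightarrow> real"
  shows "(\<And>i. i \<in> I \<Longrightarrow> smooth_at (f i) x) \<Longrightarrow> smooth_at (\<lambda>y. \<Prod>i\<in>I. f i y) x"
  by (induction I rule: infinite_finite_induct) (auto intro: smooth_at_const smooth_at_mult)

lemma smooth_at_power2:
  fixes f :: "'a::real_normed_vector \<Rightarrow> real"
  shows "smooth_at f x \<Longrightarrow> smooth_at (\<lambda>y. (f y)\<^sup>2) x"
  by (simp add: power2_eq_square smooth_at_mult)

lemma smooth_at_Pair:
  assumes "smooth_at f x" "smooth_at g x"
  shows "smooth_at (\<lambda>y. (f y, g y)) x"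
proof -
  have l: "bounded_linear (\<lambda>a. (a, 0))" "bounded_linear (\<lambda>b. (0, b))"
    by (auto intro: bounded_linear_Pair bounded_linear_ident bounded_linear_zero)
  have "smooth_at (\<lambda>y. (f y, 0) + (0, g y)) x"
    by (intro smooth_at_add smooth_at_bounded_linear_compose[OF l(1)] smooth_at_bounded_linear_compose[OF l(2)] assms)
  then show ?thesis by simp
qed

lemma smooth_at_vec_lambda:
  fixes f :: "'n::finite \<Rightarrow> 'a::real_normed_vector \<Rightarrow> real"
  assumes "\<And>i. smooth_at (f i) x"
  shows "smooth_at (\<lambda>y. \<chi> i. f i y) x"
proof -
  have "(\<chi> i. f i y) = (\<Sum>i\<in>UNIV. f i y *\<^sub>R axis i 1)" for y
    by (simp add: vec_eq_iff axis_def if_distrib cong: if_cong)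
  then show ?thesis
    using assms by (auto intro!: smooth_at_sum smooth_at_scaleR smooth_at_const)
qed

lemma smooth_at_compose:
  fixes f :: "'a::real_normed_vector \<Rightarrow> 'b::euclidean_space"
  assumes "smooth_at f x" "smooth_at g (f x)"
  shows "smooth_at (\<lambda>y. g (f y)) x"
proof -
  obtain T where T: "open T" "x \<in> T" "smooth_on T f" using smooth_atE[OF assms(1)] .
  obtain T' where T': "open T'" "f x \<in> T'" "smooth_on T' g" using smooth_atE[OF assms(2)] .
  have "continuous_on T f"
    using T(3) by (rule smooth_on_imp_continuous_on)
  then have o: "open (T \<inter> f -` T')"
    using T T' by (simp add: continuous_open_preimage)
  have "smooth_on (T \<inter> f -` T') (\<lambda>y. g (f y))"
    unfolding smooth_on_def
  proof
    fix k
    have "times_differentiable_on k (T \<inter> f -` T') f"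
      using T(3) times_differentiable_on_subset[of k T f "T \<inter> f -` T'"] by (simp add: smooth_on_def)
    then show "times_differentiable_on k (T \<inter> f -` T') (\<lambda>y. g (f y))"
      by (rule times_differentiable_on_compose[OF o T'(1), rotated]) (use T'(3) in \<open>auto simp: smooth_on_def\<close>)
  qed
  with T T' o show ?thesis
    by (intro smooth_atI[of "T \<inter> f -` T'"]) auto
qed

lemma smooth_at_inverse:
  fixes f :: "'a::real_normed_vector \<Rightarrow> real"
  assumes "smooth_at f x" "f x \<noteq> 0"
  shows "smooth_at (\<lambda>y. inverse (f y)) x"
proof -
  obtain T where T: "open T" "x \<in> T" "smooth_on T f" using smooth_atE[OF assms(1)] .
  have "continuous_on T f"
    using T(3) by (rule smooth_on_imp_continuous_on)
  then have o: "open (T \<inter> f -` (- {0}))"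
    by (rule continuous_open_preimage) (use T in auto)
  have "smooth_on (T \<inter> f -` (- {0})) (\<lambda>y. inverse (f y))"
    using T unfolding smooth_on_def
    by (auto intro!: times_differentiable_on_inverse o intro: times_differentiable_on_subset)
  with T o assms(2) show ?thesis
    by (intro smooth_atI[of "T \<inter> f -` (- {0})"]) auto
qed

subsection \<open>Inverse maps\<close>

lemma smooth_at_det:
  fixes M :: "'a::real_normed_vector \<Rightarrow> real^'n^'n"
  assumes "\<And>i j. smooth_at (\<lambda>y. M y $ i $ j) x"
  shows "smooth_at (\<lambda>y. det (M y)) x"
  unfolding det_def using assms
  by (intro smooth_at_sum smooth_at_mult smooth_at_const smooth_at_prod)

text \<open>By invariance of domain the image is open and the inverse \<open>g\<close> is continuous, hence
differentiable with \<open>D g (y) v = (D f (g y))\<^sup>-\<^sup>1 v\<close>. By Cramer's rule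
\<open>(D f (x))\<^sup>-\<^sup>1 v\<close> is a quotient of determinants and thus smooth in \<open>x\<close>, so that \<open>D g\<close> is as
regular as \<open>g\<close> itself, and \<open>g\<close> gains one order of differentiability after the other.\<close>

lemma smooth_on_inv_into:
  fixes f :: "real^'n \<Rightarrow> real^'n"
  assumes S: "open S" and smooth: "smooth_on S f" and inj: "inj_on f S"
    and inj': "\<And>x v. x \<in> S \<Longrightarrow> frechet_derivative f (at x) v = 0 \<Longrightarrow> v = 0"
  shows "open (f ` S)" "smooth_on (f ` S) (inv_into S f)"
proof -
  let ?g = "inv_into S f" and ?D = "\<lambda>x. frechet_derivative f (at x)"
  have at: "smooth_at f x" if "x \<in> S" for x
    using smooth that S smooth_on_open_iff by blast
  have cont: "continuous_on S f"
    using smooth by (rule smooth_on_imp_continuous_on)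
  show o: "open (f ` S)"
    by (rule invariance_of_domain[OF cont S inj])
  have contg: "continuous_on (f ` S) ?g"
    by (rule continuous_on_inverse_open[OF S cont]) (auto simp: inj)
  let ?M = "\<lambda>x. matrix (?D x)"
  let ?J = "\<lambda>v x. \<chi> k. det (\<chi> i j. if j = k then v $ i else ?M x $ i $ j) * inverse (det (?M x))"
  have lin: "bounded_linear (?D x)" if "x \<in> S" for x
    using smooth_at_imp_has_derivative[OF at[OF that]] has_derivative_bounded_linear by blast
  have injD: "inj (?D x)" if "x \<in> S" for x
    using linear_injective_0[OF bounded_linear.linear[OF lin[OF that]]] inj' that by blast
  have det: "det (?M x) \<noteq> 0" if "x \<in> S" for x
    using det_nz_iff_inj[OF bounded_linear.linear[OF lin[OF that]]] injD[OF that] by simp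
  have linG: "bounded_linear (inv_into UNIV (?D x))" if "x \<in> S" for x
    using inj_linear_imp_inv_bounded_linear[OF lin[OF that] injD[OF that]] .
  have invD: "inv_into UNIV (?D x) \<circ> ?D x = id" if "x \<in> S" for x
    using injD[OF that] by simp
  have J: "inv_into UNIV (?D x) v = ?J v x" if "x \<in> S" for x v
  proof -
    have "?M x *v ?J v x = v"
      using cramer[OF det[OF that], of "?J v x" v] unfolding divide_inverse by simp
    then have "?D x (?J v x) = v"
      using lin[OF that] by (simp add: matrix_vector_mul(1) bounded_linear.linear)
    then show ?thesis
      using inv_f_f[OF injD[OF that], of "?J v x"] by simp
  qed
  have smJ: "smooth_at (?J v) x" if "x \<in> S" for v x
  proof -
    have M: "smooth_at (\<lambda>y. ?M y $ i $ j) x" for i j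
      unfolding matrix_def
      by (simp, intro smooth_at_vec_nth smooth_at_frechet_derivative at that)
    have "smooth_at (\<lambda>y. (\<chi> i j. if j = k then v $ i else ?M y $ i $ j) $ a $ b) x" for k a b
      by (cases "b = k") (simp_all add: M smooth_at_const)
    then have "smooth_at (\<lambda>y. det (\<chi> i j. if j = k then v $ i else ?M y $ i $ j)) x" for k
      by (rule smooth_at_det)
    moreover have "smooth_at (\<lambda>y. inverse (det (?M y))) x"
      by (rule smooth_at_inverse[OF smooth_at_det[OF M] det[OF that]])
    ultimately show ?thesis
      by (intro smooth_at_vec_lambda smooth_at_mult)
  qed
  have derg: "(?g has_derivative inv_into UNIV (?D (?g y))) (at y)" if y: "y \<in> f ` S" for y
  proof -
    have gS: "?g y \<in> S" using y by (auto simp: inv_into_into)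
    show ?thesis
    proof (rule has_derivative_inverse_basic)
      show "(f has_derivative ?D (?g y)) (at (?g y))"
        by (rule smooth_at_imp_has_derivative[OF at[OF gS]])
      show "bounded_linear (inv_into UNIV (?D (?g y)))" by (rule linG[OF gS])
      show "inv_into UNIV (?D (?g y)) \<circ> ?D (?g y) = id" by (rule invD[OF gS])
      show "isCont ?g y" using contg o y by (auto simp: continuous_on_eq_continuous_at)
    qed (use o y in \<open>auto simp: f_inv_into_f\<close>)
  qed
  have "times_differentiable_on k (f ` S) ?g" for k
  proof (induction k)
    case 0
    then show ?case by (simp add: contg)
  next
    case (Suc k)
    have "times_differentiable_on k (f ` S) (\<lambda>y. ?J v (?g y))" for v
    proof (rule times_differentiable_on_compose[OF o S _ Suc])
      show "?g ` f ` S \<subseteq> S" by (auto simp: inv_into_into)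
      show "times_differentiable_on k S (?J v)"
        using smJ smooth_onI_smooth_at[of S "?J v"] unfolding smooth_on_def by blast
    qed
    then have "times_differentiable_on k (f ` S) (\<lambda>y. inv_into UNIV (?D (?g y)) v)" for v
      by (rule times_differentiable_on_cong[OF o]) (simp add: J inv_into_into)
    then show ?case
      by (intro times_differentiable_on_derivativeI[OF o, of ?g "\<lambda>y. inv_into UNIV (?D (?g y))" k])
        (simp_all add: derg)
  qed
  then show "smooth_on (f ` S) ?g"
    by (simp add: smooth_on_def)
qed

subsection \<open>First and second derivatives\<close>

lemma frechet_derivative_cong_nhds:
  assumes "eventually (\<lambda>y. f y = g y) (nhds x)"
  shows "frechet_derivative f (at x) = frechet_derivative g (at x)"
proof -
  have *: "(g has_derivative D) (at x)"
    if "(f has_derivative D) (at x)" "eventually (\<lambda>y. f y = g y) (nhds x)" for f g :: "'a \<Rightarrow> 'b" and D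
  proof (rule has_derivative_transform_eventually[OF that(1)])
    show "\<forall>\<^sub>F y in at x. f y = g y"
      using that(2) by (simp add: eventually_at_filter eventually_mono)
    show "f x = g x"
      using eventually_nhds_x_imp_x[OF that(2)] .
  qed simp
  have "eventually (\<lambda>y. g y = f y) (nhds x)"
    using assms by eventually_elim simp
  then have "(f has_derivative D) (at x) \<longleftrightarrow> (g has_derivative D) (at x)" for D
    using *[of f D g] *[of g D f] assms by blast
  then show ?thesis
    by (simp add: frechet_derivative_def)
qed

lemma frechet_derivative_apply: "(f has_derivative D) (at x) \<Longrightarrow> frechet_derivative f (at x) v = D v"
  by (drule frechet_derivative_at) simp

lemma isCont_eventually_nhds:
  assumes "isCont f x" "eventually P (nhds (f x))"
  shows "eventually (\<lambda>y. P (f y)) (nhds x)"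
  using assms unfolding isCont_def tendsto_at_iff_tendsto_nhds by (simp add: filterlim_iff)

lemma frechet_derivative_bounded_linear:
  "smooth_at f x \<Longrightarrow> bounded_linear (frechet_derivative f (at x))"
  using smooth_at_imp_has_derivative has_derivative_bounded_linear by blast

lemma frechet_derivative_compose_smooth_at:
  assumes "smooth_at f x" "smooth_at g (f x)"
  shows "frechet_derivative (\<lambda>y. g (f y)) (at x) v =
    frechet_derivative g (at (f x)) (frechet_derivative f (at x) v)"
  by (rule frechet_derivative_apply[OF has_derivative_compose[OF
        smooth_at_imp_has_derivative[OF assms(1)] smooth_at_imp_has_derivative[OF assms(2)]]])

lemma frechet_derivative_bounded_linear_compose:
  assumes "bounded_linear L" "smooth_at f x"
  shows "frechet_derivative (\<lambda>y. L (f y)) (at x) v = L (frechet_derivative f (at x) v)"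
  by (rule frechet_derivative_apply[OF bounded_linear.has_derivative[OF assms(1)
        smooth_at_imp_has_derivative[OF assms(2)]]])

lemma frechet_derivative_linear: "bounded_linear L \<Longrightarrow> frechet_derivative L (at x) v = L v"
  using frechet_derivative_bounded_linear_compose[OF _ smooth_at_ident, of L x v] by simp

definition second_derivative ::
    "('a::real_normed_vector \<Rightarrow> 'b::real_normed_vector) \<Rightarrow> 'a \<Rightarrow> 'a \<Rightarrow> 'a \<Rightarrow> 'b" where
  "second_derivative f x v w = frechet_derivative (\<lambda>y. frechet_derivative f (at y) v) (at x) w"

lemma second_derivative_add_left:
  assumes "smooth_at f x"
  shows "second_derivative f x (v + v') w = second_derivative f x v w + second_derivative f x v' w"
proof -
  have "eventually (\<lambda>y. frechet_derivative f (at y) v + frechet_derivative f (at y) v' =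
      frechet_derivative f (at y) (v + v')) (nhds x)"
    using eventually_smooth_at[OF assms]
    by eventually_elim (simp add: linear_add[OF bounded_linear.linear[OF frechet_derivative_bounded_linear]])
  from frechet_derivative_cong_nhds[OF this] have "second_derivative f x (v + v') w =
      frechet_derivative (\<lambda>y. frechet_derivative f (at y) v + frechet_derivative f (at y) v') (at x) w"
    by (simp add: second_derivative_def)
  also have "\<dots> = second_derivative f x v w + second_derivative f x v' w"
    unfolding second_derivative_def
    by (rule frechet_derivative_apply[OF has_derivative_add[OF
          smooth_at_imp_has_derivative[OF smooth_at_frechet_derivative[OF assms, of v]]
          smooth_at_imp_has_derivative[OF smooth_at_frechet_derivative[OF assms, of v']]]])
  finally show ?thesis .
qed

lemma second_derivative_scaleR_left:
  assumes "smooth_at f x"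
  shows "second_derivative f x (c *\<^sub>R v) w = c *\<^sub>R second_derivative f x v w"
proof -
  have "eventually (\<lambda>y. c *\<^sub>R frechet_derivative f (at y) v =
      frechet_derivative f (at y) (c *\<^sub>R v)) (nhds x)"
    using eventually_smooth_at[OF assms]
    by eventually_elim (simp add: linear_scale[OF bounded_linear.linear[OF frechet_derivative_bounded_linear]])
  from frechet_derivative_cong_nhds[OF this] have "second_derivative f x (c *\<^sub>R v) w =
      frechet_derivative (\<lambda>y. c *\<^sub>R frechet_derivative f (at y) v) (at x) w"
    by (simp add: second_derivative_def)
  then show ?thesis
    unfolding second_derivative_def
    by (simp add: frechet_derivative_bounded_linear_compose[OF bounded_linear_scaleR_right
          smooth_at_frechet_derivative[OF assms]])
qed

lemma bilinear_second_derivative: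
  assumes "smooth_at f x"
  shows "bilinear (second_derivative f x)"
  unfolding bilinear_def
proof (intro conjI allI)
  show "linear (second_derivative f x v)" for v
    unfolding second_derivative_def
    by (simp add: bounded_linear.linear frechet_derivative_bounded_linear
        smooth_at_frechet_derivative assms)
  show "linear (\<lambda>v. second_derivative f x v w)" for w
    by (rule linearI) (simp_all add: second_derivative_add_left second_derivative_scaleR_left assms)
qed

lemma has_real_derivative_along_line:
  fixes f :: "'a::real_normed_vector \<Rightarrow> real"
  assumes "smooth_at f (c + s *\<^sub>R a)"
  shows "((\<lambda>s. f (c + s *\<^sub>R a)) has_real_derivative frechet_derivative f (at (c + s *\<^sub>R a)) a) (at s)"
proof -
  interpret D: bounded_linear "frechet_derivative f (at (c + s *\<^sub>R a))"
    by (rule frechet_derivative_bounded_linear[OF assms])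
  have "((\<lambda>s. c + s *\<^sub>R a) has_derivative (\<lambda>t. t *\<^sub>R a)) (at s)"
    by (auto intro!: derivative_eq_intros)
  from has_derivative_compose[OF this smooth_at_imp_has_derivative[OF assms]]
  have "((\<lambda>s. f (c + s *\<^sub>R a)) has_derivative
      (\<lambda>t. frechet_derivative f (at (c + s *\<^sub>R a)) (t *\<^sub>R a))) (at s)" .
  then show ?thesis
    by (simp add: has_field_derivative_def D.scaleR mult.commute[of _ "frechet_derivative f _ a"])
qed

text \<open>The mean value theorem, applied first in direction \<open>a\<close> and then in direction \<open>b\<close>. The second
difference is symmetric in \<open>a\<close> and \<open>b\<close>, which is where the symmetry of second derivatives comes
from.\<close>

lemma second_difference_mean_value:
  fixes f :: "'a::real_normed_vector \<Rightarrow> real"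
  assumes sm: "\<And>y. dist y x < r \<Longrightarrow> smooth_at f y" and h: "0 < h" "h * (norm a + norm b) < r"
  obtains p where "dist p x \<le> h * (norm a + norm b)"
    and "f (x + h *\<^sub>R a + h *\<^sub>R b) - f (x + h *\<^sub>R a) - f (x + h *\<^sub>R b) + f x =
      h * h * second_derivative f p a b"
proof -
  have close: "dist (x + s *\<^sub>R a + t *\<^sub>R b) x \<le> h * (norm a + norm b)"
    if "0 \<le> s" "s \<le> h" "0 \<le> t" "t \<le> h" for s t
  proof -
    have "norm (s *\<^sub>R a + t *\<^sub>R b) \<le> s * norm a + t * norm b"
      using norm_triangle_ineq[of "s *\<^sub>R a" "t *\<^sub>R b"] that by simp
    also have "\<dots> \<le> h * norm a + h * norm b"
      using that by (intro add_mono mult_right_mono) auto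
    finally show ?thesis
      by (simp add: dist_norm algebra_simps)
  qed
  have sm': "smooth_at f (x + s *\<^sub>R a + t *\<^sub>R b)"
    if "0 \<le> s" "s \<le> h" "0 \<le> t" "t \<le> h" for s t
    using sm close[OF that] h(2) le_less_trans by blast
  let ?D = "\<lambda>y. frechet_derivative f (at y) a"
  let ?g = "\<lambda>s. f ((x + h *\<^sub>R b) + s *\<^sub>R a) - f (x + s *\<^sub>R a)"
  have "(?g has_real_derivative ?D ((x + h *\<^sub>R b) + s *\<^sub>R a) - ?D (x + s *\<^sub>R a)) (at s)"
    if "0 \<le> s" "s \<le> h" for s
    using sm'[of s h] sm'[of s 0] that h
    by (intro DERIV_diff has_real_derivative_along_line) (simp_all add: algebra_simps)
  from MVT2[OF h(1) this] obtain \<xi> where \<xi>: "0 < \<xi>" "\<xi> < h"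
    "?g h - ?g 0 = (h - 0) * (?D ((x + h *\<^sub>R b) + \<xi> *\<^sub>R a) - ?D (x + \<xi> *\<^sub>R a))"
    by blast
  have "((\<lambda>t. ?D ((x + \<xi> *\<^sub>R a) + t *\<^sub>R b)) has_real_derivative
      second_derivative f ((x + \<xi> *\<^sub>R a) + t *\<^sub>R b) a b) (at t)" if "0 \<le> t" "t \<le> h" for t
    unfolding second_derivative_def
    using sm'[of \<xi> t] that \<xi> by (intro has_real_derivative_along_line smooth_at_frechet_derivative) auto
  from MVT2[OF h(1) this] obtain \<eta> where \<eta>: "0 < \<eta>" "\<eta> < h"
    "?D ((x + \<xi> *\<^sub>R a) + h *\<^sub>R b) - ?D ((x + \<xi> *\<^sub>R a) + 0 *\<^sub>R b) =
      (h - 0) * second_derivative f ((x + \<xi> *\<^sub>R a) + \<eta> *\<^sub>R b) a b"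
    by blast
  show thesis
  proof (rule that)
    show "dist (x + \<xi> *\<^sub>R a + \<eta> *\<^sub>R b) x \<le> h * (norm a + norm b)"
      using close \<xi> \<eta> by simp
    have "?D ((x + h *\<^sub>R b) + \<xi> *\<^sub>R a) - ?D (x + \<xi> *\<^sub>R a) =
        h * second_derivative f (x + \<xi> *\<^sub>R a + \<eta> *\<^sub>R b) a b"
      using \<eta>(3) by (simp add: add.assoc add.commute[of "h *\<^sub>R b"])
    with \<xi>(3) have "?g h - ?g 0 = h * (h * second_derivative f (x + \<xi> *\<^sub>R a + \<eta> *\<^sub>R b) a b)"
      by simp
    then show "f (x + h *\<^sub>R a + h *\<^sub>R b) - f (x + h *\<^sub>R a) - f (x + h *\<^sub>R b) + f x =
        h * h * second_derivative f (x + \<xi> *\<^sub>R a + \<eta> *\<^sub>R b) a b"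
      by (simp add: add.assoc add.commute[of "h *\<^sub>R b"] mult.assoc)
  qed
qed

text \<open>By \<open>second_difference_mean_value\<close> the two mixed derivatives agree at a pair of points
arbitrarily close to \<open>x\<close>; by continuity they agree at \<open>x\<close>.\<close>

lemma second_derivative_commute_real:
  fixes f :: "'a::real_normed_vector \<Rightarrow> real"
  assumes "smooth_at f x"
  shows "second_derivative f x a b = second_derivative f x b a"
proof (rule ccontr)
  let ?P = "\<lambda>y. second_derivative f y a b" and ?Q = "\<lambda>y. second_derivative f y b a"
  assume "?P x \<noteq> ?Q x"
  then have e: "\<bar>?P x - ?Q x\<bar> / 2 > 0" (is "?e > 0") by simp
  obtain r where r: "r > 0" "\<And>y. dist y x < r \<Longrightarrow> smooth_at f y"
    using eventually_smooth_at[OF assms] unfolding eventually_nhds_metric by blast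
  have "isCont ?P x" "isCont ?Q x"
    unfolding second_derivative_def
    by (intro smooth_at_imp_isCont smooth_at_frechet_derivative assms)+
  obtain d1 where d1: "d1 > 0" "\<And>y. dist y x < d1 \<Longrightarrow> dist (?P y) (?P x) < ?e"
    using \<open>isCont ?P x\<close> e unfolding continuous_at_eps_delta by blast
  obtain d2 where d2: "d2 > 0" "\<And>y. dist y x < d2 \<Longrightarrow> dist (?Q y) (?Q x) < ?e"
    using \<open>isCont ?Q x\<close> e unfolding continuous_at_eps_delta by blast
  note d = d1 d2
  \<comment> \<open>The summand 1 keeps k positive even if both directions vanish.\<close>
  define k where "k = norm a + norm b + 1"
  define h where "h = min r (min d1 d2) / k"
  have k: "k > 0" by (simp add: k_def add_nonneg_pos)
  have m: "min r (min d1 d2) > 0" using r(1) d(1,3) by simp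
  have h: "h > 0" unfolding h_def using k m by simp
  have hk: "h * k = min r (min d1 d2)" unfolding h_def using k by simp
  have small: "h * (norm a + norm b) < min r (min d1 d2)"
    unfolding hk[symmetric] using h by (simp add: k_def)
  obtain p where p: "dist p x \<le> h * (norm a + norm b)"
    "f (x + h *\<^sub>R a + h *\<^sub>R b) - f (x + h *\<^sub>R a) - f (x + h *\<^sub>R b) + f x = h * h * ?P p"
    using second_difference_mean_value[of x r f h a b] r h small by auto
  obtain q where q: "dist q x \<le> h * (norm b + norm a)"
    "f (x + h *\<^sub>R b + h *\<^sub>R a) - f (x + h *\<^sub>R b) - f (x + h *\<^sub>R a) + f x = h * h * ?Q q"
    using second_difference_mean_value[of x r f h b a] r h small by (auto simp: add.commute)
  have "f (x + h *\<^sub>R b + h *\<^sub>R a) = f (x + h *\<^sub>R a + h *\<^sub>R b)"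
    by (simp add: add.assoc add.commute[of "h *\<^sub>R b"])
  then have "h * h * ?P p = h * h * ?Q q"
    using p(2) q(2) by linarith
  then have "?P p = ?Q q" using h by simp
  moreover have "dist (?P p) (?P x) < ?e" "dist (?Q q) (?Q x) < ?e"
    using d(2)[of p] d(4)[of q] p(1) q(1) small by (auto simp: add.commute)
  ultimately show False
    unfolding dist_real_def by (smt (verit) field_sum_of_halves)
qed

lemma second_derivative_bounded_linear_compose:
  assumes "bounded_linear L" "smooth_at f x"
  shows "second_derivative (\<lambda>y. L (f y)) x v w = L (second_derivative f x v w)"
proof -
  have "eventually (\<lambda>y. frechet_derivative (\<lambda>y. L (f y)) (at y) v = L (frechet_derivative f (at y) v)) (nhds x)"
    using eventually_smooth_at[OF assms(2)]
    by eventually_elim (simp add: frechet_derivative_bounded_linear_compose[OF assms(1)])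
  from frechet_derivative_cong_nhds[OF this] show ?thesis
    unfolding second_derivative_def
    by (simp add: frechet_derivative_bounded_linear_compose[OF assms(1)
          smooth_at_frechet_derivative[OF assms(2)]])
qed

lemma second_derivative_commute:
  fixes f :: "'a::real_normed_vector \<Rightarrow> 'b::euclidean_space"
  assumes "smooth_at f x"
  shows "second_derivative f x a b = second_derivative f x b a"
proof (rule euclidean_eqI)
  fix e :: 'b
  have L: "bounded_linear (\<lambda>z. z \<bullet> e)" by (rule bounded_linear_inner_left)
  show "second_derivative f x a b \<bullet> e = second_derivative f x b a \<bullet> e"
    using second_derivative_commute_real[OF smooth_at_bounded_linear_compose[OF L assms], of a b]
    by (simp add: second_derivative_bounded_linear_compose[OF L assms])
qed

subsection \<open>Velocity and acceleration under smooth maps\<close>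

lemma vector_derivative_smooth_at:
  assumes "smooth_at u t"
  shows "vector_derivative u (at t) = frechet_derivative u (at t) 1"
proof -
  interpret D: bounded_linear "frechet_derivative u (at t)"
    by (rule frechet_derivative_bounded_linear[OF assms])
  have "(\<lambda>s. s *\<^sub>R frechet_derivative u (at t) 1) = frechet_derivative u (at t)"
    by (simp flip: D.scaleR)
  then show ?thesis
    using smooth_at_imp_has_derivative[OF assms]
    by (intro vector_derivative_at) (simp add: has_vector_derivative_def)
qed

lemma velocity_eq: "smooth_at (\<phi> \<circ> c) 0 \<Longrightarrow> velocity \<phi> c = frechet_derivative (\<phi> \<circ> c) (at 0) 1"
  unfolding velocity_def by (rule vector_derivative_smooth_at)

lemma acceleration_eq:
  assumes "smooth_at (\<phi> \<circ> c) 0"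
  shows "acceleration \<phi> c = second_derivative (\<phi> \<circ> c) 0 1 1"
proof -
  have *: "eventually (\<lambda>t. vector_derivative (\<phi> \<circ> c) (at t) = frechet_derivative (\<phi> \<circ> c) (at t) 1) (nhds 0)"
    using eventually_smooth_at[OF assms] by eventually_elim (rule vector_derivative_smooth_at)
  have "eventually (\<lambda>t. frechet_derivative (\<phi> \<circ> c) (at t) 1 = vector_derivative (\<phi> \<circ> c) (at t)) (nhds 0)"
    using * by eventually_elim simp
  then have "smooth_at (\<lambda>t. vector_derivative (\<phi> \<circ> c) (at t)) 0"
    by (rule smooth_at_cong[OF smooth_at_frechet_derivative[OF assms]])
  then show ?thesis
    by (simp only: acceleration_def second_derivative_def vector_derivative_smooth_at
        frechet_derivative_cong_nhds[OF *])
qed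

text \<open>The chain rule of second order. It shows why accelerations have no meaning independent of the
coordinates, and it governs both the change of Taylor coordinates and the composition of
flows.\<close>

lemma second_derivative_compose_curve:
  fixes u :: "real \<Rightarrow> 'a::euclidean_space"
  assumes u: "smooth_at u s" and f: "smooth_at f (u s)"
  shows "second_derivative (\<lambda>t. f (u t)) s 1 1 =
    second_derivative f (u s) (frechet_derivative u (at s) 1) (frechet_derivative u (at s) 1) +
    frechet_derivative f (at (u s)) (second_derivative u s 1 1)"
proof -
  let ?u = "\<lambda>t. frechet_derivative u (at t) 1" and ?D = "\<lambda>y. frechet_derivative f (at y)"
  let ?u2 = "second_derivative u s 1"
  have nbh: "eventually (\<lambda>t. smooth_at f (u t)) (nhds s)"
    by (rule isCont_eventually_nhds[OF smooth_at_imp_isCont[OF u] eventually_smooth_at[OF f]])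
  have "eventually (\<lambda>t. frechet_derivative (\<lambda>t. f (u t)) (at t) 1 = (\<Sum>b\<in>Basis. (?u t \<bullet> b) *\<^sub>R ?D (u t) b)) (nhds s)"
    using nbh eventually_smooth_at[OF u]
  proof eventually_elim
    case (elim t)
    interpret D: bounded_linear "?D (u t)"
      by (rule frechet_derivative_bounded_linear[OF elim(1)])
    show ?case
      unfolding frechet_derivative_compose_smooth_at[OF elim(2,1)]
      by (subst (1) euclidean_representation[symmetric]) (simp add: D.sum D.scaleR)
  qed
  from frechet_derivative_cong_nhds[OF this]
  have "second_derivative (\<lambda>t. f (u t)) s 1 1 =
      frechet_derivative (\<lambda>t. \<Sum>b\<in>Basis. (?u t \<bullet> b) *\<^sub>R ?D (u t) b) (at s) 1"
    by (simp only: second_derivative_def)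
  also have "\<dots> = (\<Sum>b\<in>Basis. (?u s \<bullet> b) *\<^sub>R second_derivative f (u s) b (?u s) + (?u2 1 \<bullet> b) *\<^sub>R ?D (u s) b)"
  proof -
    have 1: "((\<lambda>t. ?u t \<bullet> b) has_derivative (\<lambda>v. ?u2 v \<bullet> b)) (at s)" for b
      unfolding second_derivative_def
      by (rule bounded_linear.has_derivative[OF bounded_linear_inner_left
            smooth_at_imp_has_derivative[OF smooth_at_frechet_derivative[OF u]]])
    have 2: "((\<lambda>t. ?D (u t) b) has_derivative
        (\<lambda>v. second_derivative f (u s) b (frechet_derivative u (at s) v))) (at s)" for b
      unfolding second_derivative_def
      by (rule has_derivative_compose[OF smooth_at_imp_has_derivative[OF u]
            smooth_at_imp_has_derivative[OF smooth_at_frechet_derivative[OF f]]])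
    have "((\<lambda>t. \<Sum>b\<in>Basis. (?u t \<bullet> b) *\<^sub>R ?D (u t) b) has_derivative
        (\<lambda>v. \<Sum>b\<in>Basis. (?u s \<bullet> b) *\<^sub>R second_derivative f (u s) b (frechet_derivative u (at s) v) +
          (?u2 v \<bullet> b) *\<^sub>R ?D (u s) b)) (at s)"
      by (intro has_derivative_sum has_derivative_scaleR 1 2)
    from frechet_derivative_apply[OF this, of 1] show ?thesis .
  qed
  also have "\<dots> = (\<Sum>b\<in>Basis. (?u s \<bullet> b) *\<^sub>R second_derivative f (u s) b (?u s)) +
      (\<Sum>b\<in>Basis. (?u2 1 \<bullet> b) *\<^sub>R ?D (u s) b)"
    by (rule sum.distrib)
  also have "(\<Sum>b\<in>Basis. (?u s \<bullet> b) *\<^sub>R second_derivative f (u s) b (?u s)) =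
      second_derivative f (u s) (?u s) (?u s)"
  proof -
    have lin: "linear (\<lambda>v. second_derivative f (u s) v (?u s))"
      using bilinear_second_derivative[OF f] by (simp add: bilinear_def)
    have "second_derivative f (u s) (\<Sum>b\<in>Basis. (?u s \<bullet> b) *\<^sub>R b) (?u s) =
        (\<Sum>b\<in>Basis. (?u s \<bullet> b) *\<^sub>R second_derivative f (u s) b (?u s))"
      using linear_sum[OF lin, of "\<lambda>b. (?u s \<bullet> b) *\<^sub>R b" Basis] linear_scale[OF lin] by simp
    then show ?thesis by (simp add: euclidean_representation)
  qed
  also have "(\<Sum>b\<in>Basis. (?u2 1 \<bullet> b) *\<^sub>R ?D (u s) b) = ?D (u s) (?u2 1)"
  proof -
    interpret D: bounded_linear "?D (u s)"
      by (rule frechet_derivative_bounded_linear[OF f])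
    have "?D (u s) (\<Sum>b\<in>Basis. (?u2 1 \<bullet> b) *\<^sub>R b) = (\<Sum>b\<in>Basis. (?u2 1 \<bullet> b) *\<^sub>R ?D (u s) b)"
      by (simp add: D.sum D.scaleR)
    then show ?thesis by (simp add: euclidean_representation)
  qed
  finally show ?thesis .
qed

text \<open>The computation behind the group law. Here \<open>f\<close> is a flow in coordinates, \<open>X\<close> its generator and
\<open>g\<close> a flow line of a second flow. The condition \<open>f (y, 0) = y\<close> gives \<open>D f (y, 0) (v, 0) = v\<close>
and annihilates the second derivative in two spatial directions, so that the only interaction
of the two flows is twice the mixed derivative. By symmetry the mixed derivative of \<open>f\<close> is the
spatial derivative of \<open>X\<close>.\<close>

lemma second_derivative_flow_composition:
  fixes f :: "'a::euclidean_space \<times> real \<Rightarrow> 'a" and g :: "real \<Rightarrow> 'a"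
  assumes f: "smooth_at f (x, 0)" and g: "smooth_at g 0" "g 0 = x"
    and f0: "eventually (\<lambda>y. f (y, 0) = y) (nhds x)"
  defines "X \<equiv> \<lambda>y. frechet_derivative f (at (y, 0)) (0, 1)"
  shows "frechet_derivative (\<lambda>t. f (g t, t)) (at 0) 1 = X x + frechet_derivative g (at 0) 1"
    and "second_derivative (\<lambda>t. f (g t, t)) 0 1 1 = second_derivative g 0 1 1 +
      second_derivative (\<lambda>t. f (x, t)) 0 1 1 +
      2 *\<^sub>R frechet_derivative X (at x) (frechet_derivative g (at 0) 1)"
    and "frechet_derivative (\<lambda>t. f (x, t)) (at 0) 1 = X x"
    and "smooth_at (\<lambda>t. f (g t, t)) 0" and "smooth_at X x"
proof -
  let ?D = "frechet_derivative f (at (x, 0))" and ?D2 = "second_derivative f (x, 0)"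
  let ?y = "frechet_derivative g (at 0) 1"
  have near: "eventually (\<lambda>y. smooth_at f (y, 0)) (nhds x)"
  proof -
    have "isCont (\<lambda>y. (y, 0::real)) x" by (intro continuous_intros)
    from isCont_eventually_nhds[OF this eventually_smooth_at[OF f]] show ?thesis .
  qed
  have lin: "bounded_linear ?D" by (rule frechet_derivative_bounded_linear[OF f])
  have pair: "smooth_at (\<lambda>y. (y, 0::real)) y" for y :: 'a
    by (intro smooth_at_Pair smooth_at_ident smooth_at_const)
  have dpair: "frechet_derivative (\<lambda>y. (y, 0::real)) (at y) v = (v, 0)" for y v :: 'a
    by (rule frechet_derivative_linear) (intro bounded_linear_Pair bounded_linear_ident bounded_linear_zero)
  have D0_near: "eventually (\<lambda>y. \<forall>v. frechet_derivative f (at (y, 0)) (v, 0) = v) (nhds x)"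
    using near eventually_eventually[THEN iffD2, OF f0]
  proof eventually_elim
    case (elim y)
    have "frechet_derivative (\<lambda>y. f (y, 0)) (at y) v = frechet_derivative f (at (y, 0)) (v, 0)" for v
      using frechet_derivative_compose_smooth_at[of "\<lambda>y. (y, 0::real)" y f v] pair elim(1) dpair by simp
    moreover have "frechet_derivative (\<lambda>y. f (y, 0)) (at y) v = v" for v
      using frechet_derivative_cong_nhds[OF elim(2)] frechet_derivative_linear[OF bounded_linear_ident, of y v]
      by simp
    ultimately show ?case by simp
  qed
  from eventually_nhds_x_imp_x[OF this] have D0: "?D (v, 0) = v" for v
    by simp
  have dir: "second_derivative f (x, 0) v (w, 0) =
      frechet_derivative (\<lambda>y. frechet_derivative f (at (y, 0)) v) (at x) w" for v w
    using frechet_derivative_compose_smooth_at[of "\<lambda>y. (y, 0::real)" x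
        "\<lambda>z. frechet_derivative f (at z) v" w] pair smooth_at_frechet_derivative[OF f, of v] dpair
    by (simp add: second_derivative_def)
  have D2hh: "?D2 (v, 0) (w, 0) = 0" for v w
  proof -
    have "eventually (\<lambda>y. frechet_derivative f (at (y, 0)) (v, 0) = v) (nhds x)"
      using D0_near by eventually_elim simp
    from frechet_derivative_cong_nhds[OF this] show ?thesis
      unfolding dir by (simp add: frechet_derivative_const)
  qed
  have D2th: "?D2 (0, 1) (w, 0) = frechet_derivative X (at x) w" for w
    unfolding dir X_def ..
  show X: "smooth_at X x"
    unfolding X_def using smooth_at_compose[OF pair, of _ x] smooth_at_frechet_derivative[OF f] by blast
  have curve: "smooth_at (\<lambda>t. (g t, t)) 0"
    by (intro smooth_at_Pair smooth_at_ident g)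
  show "smooth_at (\<lambda>t. f (g t, t)) 0"
    using smooth_at_compose[OF curve, of f] f g(2) by simp
  have dcurve: "frechet_derivative (\<lambda>t. (g t, t)) (at t) 1 = (frechet_derivative g (at t) 1, 1)"
    if "smooth_at g t" for t
    by (rule frechet_derivative_apply[OF has_derivative_Pair[OF smooth_at_imp_has_derivative[OF that] has_derivative_ident]])
  have d2curve: "second_derivative (\<lambda>t. (g t, t)) 0 1 1 = (second_derivative g 0 1 1, 0)"
  proof -
    have "eventually (\<lambda>t. frechet_derivative (\<lambda>t. (g t, t)) (at t) 1 = (frechet_derivative g (at t) 1, 1)) (nhds 0)"
      using eventually_smooth_at[OF g(1)] by eventually_elim (rule dcurve)
    from frechet_derivative_cong_nhds[OF this]
    have "second_derivative (\<lambda>t. (g t, t)) 0 1 1 =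
        frechet_derivative (\<lambda>t. (frechet_derivative g (at t) 1, 1::real)) (at 0) 1"
      by (simp only: second_derivative_def)
    also have "\<dots> = (second_derivative g 0 1 1, 0)"
      unfolding second_derivative_def
      by (rule frechet_derivative_apply[OF has_derivative_Pair[OF
            smooth_at_imp_has_derivative[OF smooth_at_frechet_derivative[OF g(1)]] has_derivative_const]])
    finally show ?thesis .
  qed
  have split: "(v, 1) = (v, 0) + (0, 1::real)" for v :: 'a by simp
  have "frechet_derivative (\<lambda>t. f (g t, t)) (at 0) 1 = ?D (?y, 1)"
    using frechet_derivative_compose_smooth_at[OF curve, of f 1] f g dcurve[OF g(1)] by simp
  also have "\<dots> = ?y + X x"
    by (subst split) (simp only: linear_add[OF bounded_linear.linear[OF lin]] D0 X_def)
  finally show "frechet_derivative (\<lambda>t. f (g t, t)) (at 0) 1 = X x + ?y" by simp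
  have line: "smooth_at (\<lambda>t. (x, t)) (0::real)"
    by (intro smooth_at_Pair smooth_at_ident smooth_at_const)
  have dline: "frechet_derivative (\<lambda>t. (x, t)) (at t) 1 = (0, 1)" for t :: real
    by (rule frechet_derivative_apply[OF has_derivative_Pair[OF has_derivative_const has_derivative_ident]])
  have d2line: "second_derivative (\<lambda>t. (x, t)) (0::real) 1 1 = 0"
    unfolding second_derivative_def by (simp add: dline frechet_derivative_const)
  show "frechet_derivative (\<lambda>t. f (x, t)) (at 0) 1 = X x"
    using frechet_derivative_compose_smooth_at[OF line, of f 1] f dline by (simp add: X_def)
  have tt: "second_derivative (\<lambda>t. f (x, t)) 0 1 1 = ?D2 (0, 1) (0, 1)"
    using second_derivative_compose_curve[OF line, of f] f
    by (simp add: dline d2line linear_0[OF bounded_linear.linear[OF lin]])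
  note bil = bilinear_second_derivative[OF f]
  have "second_derivative (\<lambda>t. f (g t, t)) 0 1 1 = ?D2 (?y, 1) (?y, 1) + ?D (second_derivative g 0 1 1, 0)"
    using second_derivative_compose_curve[OF curve, of f] f g by (simp add: dcurve d2curve)
  also have "?D2 (?y, 1) (?y, 1) = ?D2 (?y, 0) (?y, 0) + ?D2 (?y, 0) (0, 1) + (?D2 (0, 1) (?y, 0) + ?D2 (0, 1) (0, 1))"
    by (subst (1 2) split) (simp only: bilinear_ladd[OF bil] bilinear_radd[OF bil] add_ac)
  finally show "second_derivative (\<lambda>t. f (g t, t)) 0 1 1 = second_derivative g 0 1 1 +
      second_derivative (\<lambda>t. f (x, t)) 0 1 1 + 2 *\<^sub>R frechet_derivative X (at x) ?y"
    by (simp add: D0 D2hh tt D2th[symmetric] second_derivative_commute[OF f, of "(?y, 0)"] scaleR_2)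
qed

subsection \<open>Small perturbations of the identity\<close>

text \<open>Bounds that make \<open>y + t X(y)\<close> an injective immersion near \<open>x\<close> for all small \<open>t\<close>.\<close>

lemma smooth_at_local_bound:
  fixes X :: "'a::euclidean_space \<Rightarrow> 'b::real_normed_vector"
  assumes "smooth_at X x"
  obtains r K where "r > 0" "K > 0" "\<And>y. y \<in> ball x r \<Longrightarrow> smooth_at X y"
    "\<And>y v. y \<in> ball x r \<Longrightarrow> norm (frechet_derivative X (at y) v) \<le> K * norm v"
    "\<And>y z. y \<in> ball x r \<Longrightarrow> z \<in> ball x r \<Longrightarrow> norm (X y - X z) \<le> K * norm (y - z)"
proof -
  let ?S = "\<lambda>y. \<Sum>b\<in>Basis. norm (frechet_derivative X (at y) b)"
  define K where "K = ?S x + 1"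
  have "isCont ?S x"
    by (intro continuous_intros smooth_at_imp_isCont smooth_at_frechet_derivative assms)
  moreover have "eventually (\<lambda>z. z < K) (nhds (?S x))"
    by (intro eventually_nhds_in_open[of "{..<K}", simplified]) (simp add: K_def)
  ultimately have "eventually (\<lambda>y. ?S y < K) (nhds x)"
    by (rule isCont_eventually_nhds)
  with eventually_smooth_at[OF assms] have "eventually (\<lambda>y. ?S y < K \<and> smooth_at X y) (nhds x)"
    by eventually_elim simp
  then obtain r where r: "r > 0" "\<And>y. y \<in> ball x r \<Longrightarrow> ?S y < K \<and> smooth_at X y"
    unfolding eventually_nhds_metric by (auto simp: dist_commute)
  have bound: "norm (frechet_derivative X (at y) v) \<le> K * norm v" if "y \<in> ball x r" for y v
  proof -
    interpret D: bounded_linear "frechet_derivative X (at y)"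
      using frechet_derivative_bounded_linear r(2)[OF that] by blast
    have "frechet_derivative X (at y) v = (\<Sum>b\<in>Basis. (v \<bullet> b) *\<^sub>R frechet_derivative X (at y) b)"
      by (subst (1) euclidean_representation[symmetric]) (simp add: D.sum D.scaleR)
    also have "norm \<dots> \<le> (\<Sum>b\<in>Basis. norm v * norm (frechet_derivative X (at y) b))"
      by (rule sum_norm_le) (simp add: Basis_le_norm mult_right_mono)
    also have "\<dots> = norm v * ?S y" by (simp add: sum_distrib_left)
    also have "\<dots> \<le> norm v * K" using r(2)[OF that] by (simp add: mult_left_mono)
    finally show ?thesis by (simp add: mult.commute)
  qed
  show thesis
  proof (rule that)
    show "r > 0" by fact
    show "K > 0" by (simp add: K_def add_nonneg_pos sum_nonneg)
    show "smooth_at X y" if "y \<in> ball x r" for y using r(2)[OF that] by simp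
    show "norm (frechet_derivative X (at y) v) \<le> K * norm v" if "y \<in> ball x r" for y v
      by (rule bound[OF that])
    show "norm (X y - X z) \<le> K * norm (y - z)" if "y \<in> ball x r" "z \<in> ball x r" for y z
    proof (rule differentiable_bound[OF convex_ball[of x r] _ _ that])
      show "(X has_derivative frechet_derivative X (at w)) (at w within ball x r)" if "w \<in> ball x r" for w
        using smooth_at_imp_has_derivative r(2)[OF that] has_derivative_at_withinI by blast
      show "onorm (frechet_derivative X (at w)) \<le> K" if "w \<in> ball x r" for w
        by (rule onorm_bound) (use bound[OF that] \<open>K > 0\<close> in auto)
    qed
  qed
qed

section \<open>Charts, smooth maps and curves\<close>

lemma open_eventually_iff: "open S \<longleftrightarrow> (\<forall>x\<in>S. eventually (\<lambda>y. y \<in> S) (nhds x))"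
  by (subst open_subopen) (auto simp: eventually_nhds subset_eq)

subsection \<open>Changing charts\<close>

lemma chart_inv: "is_chart (U, \<phi>) \<Longrightarrow> x \<in> U \<Longrightarrow> inv_into U \<phi> (\<phi> x) = x"
  by (simp add: is_chart_def)

lemma coord_chart_is_chart: "coord_chart A c \<Longrightarrow> is_chart c"
  by (simp add: coord_chart_def)

lemmas coord_chart_inv = chart_inv[OF coord_chart_is_chart]

lemma is_chart_eventually_image: "is_chart (U, \<phi>) \<Longrightarrow> x \<in> U \<Longrightarrow> eventually (\<lambda>y. y \<in> \<phi> ` U) (nhds (\<phi> x))"
  by (intro eventually_nhds_in_open) (auto simp: is_chart_def)

lemmas coord_chart_eventually_image = is_chart_eventually_image[OF coord_chart_is_chart]

lemma smoothly_compatible_sym: "smoothly_compatible c d \<Longrightarrow> smoothly_compatible d c"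
  by (auto simp: smoothly_compatible_def Int_commute)

lemma smoothly_compatibleD:
  assumes "smoothly_compatible (U, \<phi>) (V, \<psi>)" "is_chart (U, \<phi>)" "x \<in> U" "x \<in> V"
  shows "smooth_at (\<lambda>y. \<psi> (inv_into U \<phi> y)) (\<phi> x)"
    and "eventually (\<lambda>y. inv_into U \<phi> y \<in> V) (nhds (\<phi> x))"
proof -
  have o: "open (\<phi> ` (U \<inter> V))" and sm: "smooth_on (\<phi> ` (U \<inter> V)) (\<psi> \<circ> inv_into U \<phi>)"
    using assms(1) by (auto simp: smoothly_compatible_def)
  have x: "\<phi> x \<in> \<phi> ` (U \<inter> V)" using assms by blast
  show "smooth_at (\<lambda>y. \<psi> (inv_into U \<phi> y)) (\<phi> x)"
    using smooth_atI[OF o x sm] by (simp add: o_def)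
  have "eventually (\<lambda>y. y \<in> \<phi> ` (U \<inter> V)) (nhds (\<phi> x))"
    using o x by (rule eventually_nhds_in_open)
  then show "eventually (\<lambda>y. inv_into U \<phi> y \<in> V) (nhds (\<phi> x))"
    by eventually_elim (use chart_inv[OF assms(2)] in auto)
qed

text \<open>Compatibility is a pointwise matter: the conditions on nearby points also yield that both images
of the overlap are open.\<close>

lemma smoothly_compatibleI:
  assumes "is_chart (U, \<phi>)" "is_chart (V, \<psi>)"
    and "\<And>x. x \<in> U \<Longrightarrow> x \<in> V \<Longrightarrow> smooth_at (\<lambda>y. \<psi> (inv_into U \<phi> y)) (\<phi> x) \<and>
        eventually (\<lambda>y. inv_into U \<phi> y \<in> V) (nhds (\<phi> x))"
    and "\<And>x. x \<in> U \<Longrightarrow> x \<in> V \<Longrightarrow> smooth_at (\<lambda>y. \<phi> (inv_into V \<psi> y)) (\<psi> x) \<and>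
        eventually (\<lambda>y. inv_into V \<psi> y \<in> U) (nhds (\<psi> x))"
  shows "smoothly_compatible (U, \<phi>) (V, \<psi>)"
proof -
  have half: "open (\<phi> ` (U \<inter> V)) \<and> smooth_on (\<phi> ` (U \<inter> V)) (\<psi> \<circ> inv_into U \<phi>)"
    if "is_chart (U, \<phi>)" and
      *: "\<And>x. x \<in> U \<Longrightarrow> x \<in> V \<Longrightarrow> smooth_at (\<lambda>y. \<psi> (inv_into U \<phi> y)) (\<phi> x) \<and>
        eventually (\<lambda>y. inv_into U \<phi> y \<in> V) (nhds (\<phi> x))"
    for U V :: "'a set" and \<phi> :: "'a \<Rightarrow> 'x::euclidean_space" and \<psi> :: "'a \<Rightarrow> 'y::euclidean_space"
  proof
    have "eventually (\<lambda>y. y \<in> \<phi> ` (U \<inter> V)) (nhds (\<phi> x))" if x: "x \<in> U" "x \<in> V" for x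
      using is_chart_eventually_image[OF \<open>is_chart (U, \<phi>)\<close> x(1)] *[OF x, THEN conjunct2]
    proof eventually_elim
      case (elim y)
      then obtain z where "z \<in> U" "y = \<phi> z" by blast
      with elim show ?case using chart_inv[OF \<open>is_chart (U, \<phi>)\<close>, of z] by auto
    qed
    then show "open (\<phi> ` (U \<inter> V))"
      unfolding open_eventually_iff by blast
    have "smooth_at (\<psi> \<circ> inv_into U \<phi>) y" if "y \<in> \<phi> ` (U \<inter> V)" for y
      using that * by (auto simp: o_def)
    then show "smooth_on (\<phi> ` (U \<inter> V)) (\<psi> \<circ> inv_into U \<phi>)"
      by (rule smooth_onI_smooth_at)
  qed
  show ?thesis
    unfolding smoothly_compatible_def
    using half[of U \<phi> V \<psi>, OF assms(1,3)] half[of V \<psi> U \<phi>, OF assms(2,4)] by (simp add: Int_commute)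
qed

lemma smooth_atlas_coord_chart:
  assumes "smooth_atlas A" "c \<in> A"
  shows "coord_chart A c"
proof -
  obtain U \<phi> where c: "c = (U, \<phi>)" by fastforce
  have "U \<subseteq> points A" using assms(2) unfolding points_def c by blast
  then show ?thesis
    using assms unfolding coord_chart_def smooth_atlas_def c by simp
qed

lemma points_atlas_chart:
  assumes "smooth_atlas A" "x \<in> points A"
  obtains W \<xi> where "(W, \<xi>) \<in> A" "x \<in> W" "coord_chart A (W, \<xi>)"
  using assms(2) smooth_atlas_coord_chart[OF assms(1)] unfolding points_def by blast

lemma coord_chart_points: "coord_chart A (U, \<phi>) \<Longrightarrow> x \<in> U \<Longrightarrow> x \<in> points A"
  by (auto simp: coord_chart_def)

text \<open>The transition between two charts of the maximal atlas factors, near the given point, through a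
chart of \<open>A\<close>.\<close>

lemma coord_chart_transition:
  assumes A: "smooth_atlas A" and U: "coord_chart A (U, \<phi>)" "x \<in> U" and V: "coord_chart A (V, \<psi>)" "x \<in> V"
  shows "smooth_at (\<lambda>y. \<psi> (inv_into U \<phi> y)) (\<phi> x)"
    and "eventually (\<lambda>y. inv_into U \<phi> y \<in> V) (nhds (\<phi> x))"
proof -
  obtain W \<xi> where W: "(W, \<xi>) \<in> A" "x \<in> W" "coord_chart A (W, \<xi>)"
    by (rule points_atlas_chart[OF A coord_chart_points[OF U]])
  have 1: "smoothly_compatible (U, \<phi>) (W, \<xi>)" "smoothly_compatible (V, \<psi>) (W, \<xi>)"
    using U(1) V(1) W(1) by (auto simp: coord_chart_def)
  note UW = smoothly_compatibleD[OF 1(1) coord_chart_is_chart[OF U(1)] U(2) W(2)]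
  note WV = smoothly_compatibleD[OF smoothly_compatible_sym[OF 1(2)] coord_chart_is_chart[OF W(3)] W(2) V(2)]
  have x: "inv_into U \<phi> (\<phi> x) = x" using coord_chart_inv[OF U] .
  have "smooth_at (\<lambda>y. \<psi> (inv_into W \<xi> (\<xi> (inv_into U \<phi> y)))) (\<phi> x)"
    by (rule smooth_at_compose[OF UW(1)]) (simp add: x WV(1))
  moreover have "eventually (\<lambda>y. \<psi> (inv_into W \<xi> (\<xi> (inv_into U \<phi> y))) = \<psi> (inv_into U \<phi> y)) (nhds (\<phi> x))"
    using UW(2) by eventually_elim (simp add: coord_chart_inv[OF W(3)])
  ultimately show "smooth_at (\<lambda>y. \<psi> (inv_into U \<phi> y)) (\<phi> x)"
    by (rule smooth_at_cong)
  have "eventually (\<lambda>y. inv_into W \<xi> (\<xi> (inv_into U \<phi> y)) \<in> V) (nhds (\<phi> x))"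
    by (rule isCont_eventually_nhds[OF smooth_at_imp_isCont[OF UW(1)]]) (simp add: x WV(2))
  with UW(2) show "eventually (\<lambda>y. inv_into U \<phi> y \<in> V) (nhds (\<phi> x))"
    by eventually_elim (simp add: coord_chart_inv[OF W(3)])
qed

lemma coord_chart_compatible:
  assumes "smooth_atlas A" "coord_chart A c" "coord_chart A d"
  shows "smoothly_compatible c d"
proof -
  obtain U \<phi> V \<psi> where cd: "c = (U, \<phi>)" "d = (V, \<psi>)" by fastforce
  show ?thesis
    unfolding cd
    by (rule smoothly_compatibleI)
      (use assms cd coord_chart_is_chart coord_chart_transition[OF assms(1)] in auto)
qed

lemma eventually_chart_change:
  assumes A: "smooth_atlas A" and U: "coord_chart A (U, \<phi>)" "x \<in> U" and V: "coord_chart A (V, \<psi>)" "x \<in> V"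
    and P: "eventually (\<lambda>z. P (inv_into V \<psi> z)) (nhds (\<psi> x))"
  shows "eventually (\<lambda>y. P (inv_into U \<phi> y)) (nhds (\<phi> x))"
proof -
  note UV = coord_chart_transition[OF A U V]
  have "eventually (\<lambda>y. P (inv_into V \<psi> (\<psi> (inv_into U \<phi> y)))) (nhds (\<phi> x))"
    by (rule isCont_eventually_nhds[OF smooth_at_imp_isCont[OF UV(1)]]) (simp add: coord_chart_inv[OF U] P)
  with UV(2) show ?thesis
    by eventually_elim (simp add: coord_chart_inv[OF V(1)])
qed

lemma smooth_at_chart_change:
  assumes A: "smooth_atlas A" and U: "coord_chart A (U, \<phi>)" "x \<in> U" and V: "coord_chart A (V, \<psi>)" "x \<in> V"
    and f: "smooth_at (\<lambda>z. f (inv_into V \<psi> z)) (\<psi> x)"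
  shows "smooth_at (\<lambda>y. f (inv_into U \<phi> y)) (\<phi> x)"
proof -
  note UV = coord_chart_transition[OF A U V]
  have "smooth_at (\<lambda>y. f (inv_into V \<psi> (\<psi> (inv_into U \<phi> y)))) (\<phi> x)"
    by (rule smooth_at_compose[OF UV(1)]) (simp add: coord_chart_inv[OF U] f)
  then show ?thesis
    by (rule smooth_at_cong, use UV(2) in eventually_elim) (simp add: coord_chart_inv[OF V(1)])
qed

lemma smooth_at_codomain_chart_change:
  assumes A: "smooth_atlas A" and U: "coord_chart A (U, \<phi>)" "g s \<in> U" and V: "coord_chart A (V, \<psi>)" "g s \<in> V"
    and g: "smooth_at (\<lambda>t. \<phi> (g t)) s" "eventually (\<lambda>t. g t \<in> U) (nhds s)"
  shows "smooth_at (\<lambda>t. \<psi> (g t)) s" "eventually (\<lambda>t. g t \<in> V) (nhds s)"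
proof -
  note UV = coord_chart_transition[OF A U V]
  have "smooth_at (\<lambda>t. \<psi> (inv_into U \<phi> (\<phi> (g t)))) s"
    by (rule smooth_at_compose[OF g(1) UV(1)])
  then show "smooth_at (\<lambda>t. \<psi> (g t)) s"
    by (rule smooth_at_cong, use g(2) in eventually_elim) (simp add: coord_chart_inv[OF U(1)])
  have "eventually (\<lambda>t. inv_into U \<phi> (\<phi> (g t)) \<in> V) (nhds s)"
    by (rule isCont_eventually_nhds[OF smooth_at_imp_isCont[OF g(1)] UV(2)])
  with g(2) show "eventually (\<lambda>t. g t \<in> V) (nhds s)"
    by eventually_elim (simp add: coord_chart_inv[OF U(1)])
qed

text \<open>Restriction of charts is needed because smoothness of a map on a set refers to charts whose
domains are contained in that set and are mapped into a single chart.\<close>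

lemma coord_chart_subset:
  assumes A: "smooth_atlas A" and U: "coord_chart A (U, \<phi>)" and U': "U' \<subseteq> U" "open (\<phi> ` U')"
  shows "coord_chart A (U', \<phi>)"
  unfolding coord_chart_def
proof (intro conjI ballI)
  have inj: "inj_on \<phi> U" using coord_chart_is_chart[OF U] by (simp add: is_chart_def)
  show ch: "is_chart (U', \<phi>)"
    using inj_on_subset[OF inj U'(1)] U'(2) by (simp add: is_chart_def)
  show "fst (U', \<phi>) \<subseteq> points A"
    using U U'(1) by (auto simp: coord_chart_def)
  fix d assume "d \<in> A"
  then have d: "coord_chart A d" by (rule smooth_atlas_coord_chart[OF A])
  obtain W \<xi> where dW: "d = (W, \<xi>)" by fastforce
  have inv: "inv_into U' \<phi> y = inv_into U \<phi> y" if "y \<in> \<phi> ` U'" for y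
    using that chart_inv[OF ch] coord_chart_inv[OF U] U'(1) by auto
  show "smoothly_compatible (U', \<phi>) d"
    unfolding dW
  proof (rule smoothly_compatibleI[OF ch coord_chart_is_chart[OF d[unfolded dW]]])
    fix x assume x: "x \<in> U'" "x \<in> W"
    then have xU: "x \<in> U" using U'(1) by blast
    note UW = coord_chart_transition[OF A U xU d[unfolded dW] x(2)]
    note WU = coord_chart_transition[OF A d[unfolded dW] x(2) U xU]
    have "eventually (\<lambda>y. y \<in> \<phi> ` U') (nhds (\<phi> x))"
      by (rule is_chart_eventually_image[OF ch x(1)])
    then have ev: "eventually (\<lambda>y. inv_into U \<phi> y = inv_into U' \<phi> y) (nhds (\<phi> x))"
      by eventually_elim (simp add: inv)
    have "eventually (\<lambda>y. \<xi> (inv_into U \<phi> y) = \<xi> (inv_into U' \<phi> y)) (nhds (\<phi> x))"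
      using ev by eventually_elim simp
    moreover have "eventually (\<lambda>y. inv_into U' \<phi> y \<in> W) (nhds (\<phi> x))"
      using ev UW(2) by eventually_elim simp
    ultimately show "smooth_at (\<lambda>y. \<xi> (inv_into U' \<phi> y)) (\<phi> x) \<and>
        eventually (\<lambda>y. inv_into U' \<phi> y \<in> W) (nhds (\<phi> x))"
      using smooth_at_cong[OF UW(1), of "\<lambda>y. \<xi> (inv_into U' \<phi> y)"] by simp
    have "eventually (\<lambda>y. \<phi> (inv_into W \<xi> y) \<in> \<phi> ` U') (nhds (\<xi> x))"
      by (rule isCont_eventually_nhds[OF smooth_at_imp_isCont[OF WU(1)]])
        (simp add: coord_chart_inv[OF d[unfolded dW] x(2)] is_chart_eventually_image[OF ch x(1)])
    with WU(2) have "eventually (\<lambda>y. inv_into W \<xi> y \<in> U') (nhds (\<xi> x))"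
      by eventually_elim (use inj U'(1) in \<open>auto simp: inj_on_def\<close>)
    with WU(1) show "smooth_at (\<lambda>y. \<phi> (inv_into W \<xi> y)) (\<xi> x) \<and>
        eventually (\<lambda>y. inv_into W \<xi> y \<in> U') (nhds (\<xi> x))"
      by blast
  qed
qed

subsection \<open>The manifold topology and smooth maps in charts\<close>

lemma eventually_chart_openin:
  assumes A: "smooth_atlas A" and U: "coord_chart A (U, \<phi>)" "x \<in> U"
    and W: "openin (manifold_topology A) W" "x \<in> W"
  shows "eventually (\<lambda>y. inv_into U \<phi> y \<in> W) (nhds (\<phi> x))"
proof -
  obtain V \<psi> where V: "(V, \<psi>) \<in> A" "x \<in> V" "coord_chart A (V, \<psi>)"
    by (rule points_atlas_chart[OF A coord_chart_points[OF U]])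
  have "open (\<psi> ` (V \<inter> W))"
    using W(1) V(1) unfolding openin_manifold_topology[OF A] by blast
  then have "eventually (\<lambda>z. z \<in> \<psi> ` (V \<inter> W)) (nhds (\<psi> x))"
    using V W by (intro eventually_nhds_in_open) auto
  then have "eventually (\<lambda>z. inv_into V \<psi> z \<in> W) (nhds (\<psi> x))"
  proof eventually_elim
    case (elim z)
    then obtain w where "w \<in> V" "w \<in> W" "z = \<psi> w" by blast
    then show ?case by (simp add: coord_chart_inv[OF V(3)])
  qed
  then show ?thesis
    by (rule eventually_chart_change[OF A U V(3,2)])
qed

lemma openin_manifold_topologyI:
  assumes A: "smooth_atlas A"
    and W: "\<And>x. x \<in> W \<Longrightarrow> \<exists>U \<phi>. coord_chart A (U, \<phi>) \<and> x \<in> U \<and>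
        eventually (\<lambda>y. inv_into U \<phi> y \<in> W) (nhds (\<phi> x))"
  shows "openin (manifold_topology A) W"
  unfolding openin_manifold_topology[OF A]
proof (intro conjI subsetI ballI)
  show "x \<in> points A" if "x \<in> W" for x
    using W[OF that] by (elim exE conjE) (rule coord_chart_points)
  fix c assume c: "c \<in> A"
  obtain V \<psi> where cV: "c = (V, \<psi>)" by fastforce
  have V: "coord_chart A (V, \<psi>)" using smooth_atlas_coord_chart[OF A c] by (simp only: cV)
  have "eventually (\<lambda>y. y \<in> \<psi> ` (V \<inter> W)) (nhds (\<psi> x))" if x: "x \<in> V" "x \<in> W" for x
  proof -
    obtain U \<phi> where U: "coord_chart A (U, \<phi>)" "x \<in> U" "eventually (\<lambda>y. inv_into U \<phi> y \<in> W) (nhds (\<phi> x))"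
      using W[OF x(2)] by (elim exE conjE) (rule that)
    have "eventually (\<lambda>y. inv_into V \<psi> y \<in> W) (nhds (\<psi> x))"
      by (rule eventually_chart_change[OF A V x(1) U])
    with coord_chart_eventually_image[OF V x(1)] show ?thesis
    proof eventually_elim
      case (elim y)
      then have "y = \<psi> (inv_into V \<psi> y)" "inv_into V \<psi> y \<in> V"
        by (simp_all add: f_inv_into_f inv_into_into)
      with elim(2) show ?case by blast
    qed
  qed
  then have "open (\<psi> ` (V \<inter> W))"
    unfolding open_eventually_iff by blast
  then show "case c of (U, \<phi>) \<Rightarrow> open (\<phi> ` (U \<inter> W))" by (simp add: cV)
qed

text \<open>The definition of smoothness provides one pair of charts at each point; transition maps carry
the smoothness over to any other pair.\<close>

lemma smooth_mapD:
  assumes A: "smooth_atlas A" and B: "smooth_atlas B" and f: "smooth_map A B S f" and x: "x \<in> S"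
    and U: "coord_chart A (U, \<phi>)" "x \<in> U" and V: "coord_chart B (V, \<psi>)" "f x \<in> V"
  shows "smooth_at (\<lambda>y. \<psi> (f (inv_into U \<phi> y))) (\<phi> x)"
    and "eventually (\<lambda>y. inv_into U \<phi> y \<in> S) (nhds (\<phi> x))"
    and "eventually (\<lambda>y. f (inv_into U \<phi> y) \<in> V) (nhds (\<phi> x))"
proof -
  obtain U' \<phi>' V' \<psi>' where *: "coord_chart A (U', \<phi>')" "coord_chart B (V', \<psi>')" "x \<in> U'" "U' \<subseteq> S"
    "f ` U' \<subseteq> V'" "smooth_on (\<phi>' ` U') (\<psi>' \<circ> f \<circ> inv_into U' \<phi>')"
    using bspec[OF f[unfolded smooth_map_def] x] by (elim exE conjE) (rule that)
  have "open (\<phi>' ` U')" using coord_chart_is_chart[OF *(1)] by (simp add: is_chart_def)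
  then have sm: "smooth_at (\<lambda>y. \<psi>' (f (inv_into U' \<phi>' y))) (\<phi>' x)"
    using smooth_atI[OF _ _ *(6), of "\<phi>' x"] *(3) by (simp add: o_def)
  have inU': "eventually (\<lambda>y. inv_into U' \<phi>' y \<in> U') (nhds (\<phi>' x))"
    using coord_chart_transition(2)[OF A *(1,3) *(1,3)] .
  then have "eventually (\<lambda>y. f (inv_into U' \<phi>' y) \<in> V') (nhds (\<phi>' x))"
    by eventually_elim (use *(5) in blast)
  then have ev: "eventually (\<lambda>y. f (inv_into U \<phi> y) \<in> V') (nhds (\<phi> x))"
    by (rule eventually_chart_change[OF A U *(1,3)])
  have sm': "smooth_at (\<lambda>y. \<psi>' (f (inv_into U \<phi> y))) (\<phi> x)"
    by (rule smooth_at_chart_change[OF A U *(1,3) sm])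
  have x': "inv_into U \<phi> (\<phi> x) = x" using coord_chart_inv[OF U] .
  have fx: "f (inv_into U \<phi> (\<phi> x)) \<in> V'" "f (inv_into U \<phi> (\<phi> x)) \<in> V"
    using x' *(3,5) V(2) by auto
  show "smooth_at (\<lambda>y. \<psi> (f (inv_into U \<phi> y))) (\<phi> x)"
    and "eventually (\<lambda>y. f (inv_into U \<phi> y) \<in> V) (nhds (\<phi> x))"
    using smooth_at_codomain_chart_change[OF B *(2) fx(1) V(1) fx(2) sm' ev] .
  have "eventually (\<lambda>y. inv_into U' \<phi>' y \<in> S) (nhds (\<phi>' x))"
    using inU' by eventually_elim (use *(4) in blast)
  then show "eventually (\<lambda>y. inv_into U \<phi> y \<in> S) (nhds (\<phi> x))"
    by (rule eventually_chart_change[OF A U *(1,3)])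
qed

text \<open>Conversely, one pair of charts around each point suffices, since the first chart can be shrunk
until the containments demanded by the definition hold.\<close>

lemma smooth_mapI:
  assumes A: "smooth_atlas A"
    and f: "\<And>x. x \<in> S \<Longrightarrow> \<exists>U \<phi> V \<psi>. coord_chart A (U, \<phi>) \<and> coord_chart B (V, \<psi>) \<and> x \<in> U \<and> f x \<in> V \<and>
      smooth_at (\<lambda>y. \<psi> (f (inv_into U \<phi> y))) (\<phi> x) \<and>
      eventually (\<lambda>y. inv_into U \<phi> y \<in> S) (nhds (\<phi> x)) \<and>
      eventually (\<lambda>y. f (inv_into U \<phi> y) \<in> V) (nhds (\<phi> x))"
  shows "smooth_map A B S f"
  unfolding smooth_map_def
proof
  fix x assume "x \<in> S"
  obtain U \<phi> V \<psi> where *: "coord_chart A (U, \<phi>)" "coord_chart B (V, \<psi>)" "x \<in> U" "f x \<in> V"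
      "smooth_at (\<lambda>y. \<psi> (f (inv_into U \<phi> y))) (\<phi> x)"
      "eventually (\<lambda>y. inv_into U \<phi> y \<in> S) (nhds (\<phi> x))"
      "eventually (\<lambda>y. f (inv_into U \<phi> y) \<in> V) (nhds (\<phi> x))"
    using f[OF \<open>x \<in> S\<close>] by (elim exE conjE) (rule that)
  have "eventually (\<lambda>y. y \<in> \<phi> ` U \<and> inv_into U \<phi> y \<in> S \<and> f (inv_into U \<phi> y) \<in> V \<and>
      smooth_at (\<lambda>y. \<psi> (f (inv_into U \<phi> y))) y) (nhds (\<phi> x))"
    using coord_chart_eventually_image[OF *(1,3)] *(6,7) eventually_smooth_at[OF *(5)]
    by eventually_elim simp
  then obtain T where T: "open T" "\<phi> x \<in> T"
    "\<And>y. y \<in> T \<Longrightarrow> y \<in> \<phi> ` U \<and> inv_into U \<phi> y \<in> S \<and> f (inv_into U \<phi> y) \<in> V \<and>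
      smooth_at (\<lambda>y. \<psi> (f (inv_into U \<phi> y))) y"
    unfolding eventually_nhds by blast
  \<comment> \<open>The part of the chart domain on which everything required at x holds.\<close>
  define U' where "U' = inv_into U \<phi> ` T"
  have im: "\<phi> ` U' = T"
    unfolding U'_def image_image using T(3) by (auto simp: f_inv_into_f)
  have U': "U' \<subseteq> U" unfolding U'_def using T(3) by (auto intro: inv_into_into)
  have ch: "coord_chart A (U', \<phi>)"
    by (rule coord_chart_subset[OF A *(1) U']) (simp add: im T(1))
  have inv: "inv_into U' \<phi> y = inv_into U \<phi> y" if "y \<in> T" for y
  proof -
    have "inv_into U \<phi> y \<in> U'" unfolding U'_def using that by blast
    then show ?thesis
      using coord_chart_inv[OF ch, of "inv_into U \<phi> y"] T(3)[OF that] by (simp add: f_inv_into_f)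
  qed
  have "smooth_at (\<psi> \<circ> f \<circ> inv_into U' \<phi>) y" if y: "y \<in> T" for y
  proof -
    have "eventually (\<lambda>y. y \<in> T) (nhds y)" using T(1) y by (rule eventually_nhds_in_open)
    then have "eventually (\<lambda>y. \<psi> (f (inv_into U \<phi> y)) = (\<psi> \<circ> f \<circ> inv_into U' \<phi>) y) (nhds y)"
      by eventually_elim (simp add: inv)
    with T(3)[OF y] show ?thesis
      using smooth_at_cong[of "\<lambda>y. \<psi> (f (inv_into U \<phi> y))" y "\<psi> \<circ> f \<circ> inv_into U' \<phi>"] by blast
  qed
  then have "smooth_on (\<phi> ` U') (\<psi> \<circ> f \<circ> inv_into U' \<phi>)"
    unfolding im by (rule smooth_onI_smooth_at)
  moreover have "x \<in> U'"
    unfolding U'_def using imageI[OF T(2), of "inv_into U \<phi>"] coord_chart_inv[OF *(1,3)] by simp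
  moreover have "U' \<subseteq> S" "f ` U' \<subseteq> V"
    unfolding U'_def using T(3) by auto
  ultimately show "\<exists>U \<phi> V \<psi>. coord_chart A (U, \<phi>) \<and> coord_chart B (V, \<psi>) \<and>
        x \<in> U \<and> U \<subseteq> S \<and> f ` U \<subseteq> V \<and> smooth_on (\<phi> ` U) (\<psi> \<circ> f \<circ> inv_into U \<phi>)"
    using ch *(2) by (intro exI[of _ U'] exI[of _ \<phi>] exI[of _ V] exI[of _ \<psi>]) simp
qed

subsection \<open>Products and the real line\<close>

lemma inv_into_map_prod:
  assumes "inj_on \<phi> U" "inj_on \<psi> V" "a \<in> \<phi> ` U" "b \<in> \<psi> ` V"
  shows "inv_into (U \<times> V) (map_prod \<phi> \<psi>) (a, b) = (inv_into U \<phi> a, inv_into V \<psi> b)"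
proof (rule inv_into_f_eq)
  show "inj_on (map_prod \<phi> \<psi>) (U \<times> V)"
    by (rule map_prod_inj_on[OF assms(1,2)])
qed (use assms in \<open>auto simp: inv_into_into f_inv_into_f\<close>)

lemma is_chart_prod:
  assumes "is_chart (U, \<phi>)" "is_chart (V, \<psi>)"
  shows "is_chart (U \<times> V, map_prod \<phi> \<psi>)"
proof -
  have "map_prod \<phi> \<psi> ` (U \<times> V) = \<phi> ` U \<times> \<psi> ` V" by force
  then show ?thesis
    using assms by (simp add: is_chart_def map_prod_inj_on open_Times)
qed

lemma eventually_inv_into_map_prod:
  assumes "is_chart (U, \<phi>)" "is_chart (V, \<psi>)" "x \<in> U" "y \<in> V"
  shows "eventually (\<lambda>z. inv_into (U \<times> V) (map_prod \<phi> \<psi>) z = (inv_into U \<phi> (fst z), inv_into V \<psi> (snd z)))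
    (nhds (\<phi> x, \<psi> y))"
proof -
  have "open (\<phi> ` U \<times> \<psi> ` V)" using assms by (simp add: is_chart_def open_Times)
  then have "eventually (\<lambda>z. z \<in> \<phi> ` U \<times> \<psi> ` V) (nhds (\<phi> x, \<psi> y))"
    using assms(3,4) by (intro eventually_nhds_in_open) auto
  then show ?thesis
    by eventually_elim (use assms in \<open>auto simp: is_chart_def inv_into_map_prod\<close>)
qed

lemma smoothly_compatible_prod_half:
  assumes c: "is_chart (U, \<phi>)" "is_chart (V, \<psi>)" "smoothly_compatible (U, \<phi>) (U', \<phi>')"
    "smoothly_compatible (V, \<psi>) (V', \<psi>')" and p: "p \<in> U \<times> V" "p \<in> U' \<times> V'"
  shows "smooth_at (\<lambda>z. map_prod \<phi>' \<psi>' (inv_into (U \<times> V) (map_prod \<phi> \<psi>) z)) (map_prod \<phi> \<psi> p)"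
    and "eventually (\<lambda>z. inv_into (U \<times> V) (map_prod \<phi> \<psi>) z \<in> U' \<times> V') (nhds (map_prod \<phi> \<psi> p))"
proof -
  obtain x y where xy: "p = (x, y)" "x \<in> U" "y \<in> V" "x \<in> U'" "y \<in> V'" using p by auto
  note 1 = smoothly_compatibleD[OF c(3,1) xy(2,4)] and 2 = smoothly_compatibleD[OF c(4,2) xy(3,5)]
  note ev = eventually_inv_into_map_prod[OF c(1,2) xy(2,3)]
  have "smooth_at (\<lambda>z. (\<phi>' (inv_into U \<phi> (fst z)), \<psi>' (inv_into V \<psi> (snd z)))) (\<phi> x, \<psi> y)"
  proof (rule smooth_at_Pair)
    show "smooth_at (\<lambda>z. \<phi>' (inv_into U \<phi> (fst z))) (\<phi> x, \<psi> y)"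
      by (rule smooth_at_compose[OF smooth_at_bounded_linear[OF bounded_linear_fst]]) (simp add: 1)
    show "smooth_at (\<lambda>z. \<psi>' (inv_into V \<psi> (snd z))) (\<phi> x, \<psi> y)"
      by (rule smooth_at_compose[OF smooth_at_bounded_linear[OF bounded_linear_snd]]) (simp add: 2)
  qed
  moreover have "eventually (\<lambda>z. (\<phi>' (inv_into U \<phi> (fst z)), \<psi>' (inv_into V \<psi> (snd z))) =
      map_prod \<phi>' \<psi>' (inv_into (U \<times> V) (map_prod \<phi> \<psi>) z)) (nhds (\<phi> x, \<psi> y))"
    using ev by eventually_elim simp
  ultimately have "smooth_at (\<lambda>z. map_prod \<phi>' \<psi>' (inv_into (U \<times> V) (map_prod \<phi> \<psi>) z)) (\<phi> x, \<psi> y)"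
    by (rule smooth_at_cong)
  then show "smooth_at (\<lambda>z. map_prod \<phi>' \<psi>' (inv_into (U \<times> V) (map_prod \<phi> \<psi>) z)) (map_prod \<phi> \<psi> p)"
    by (simp add: xy)
  have "isCont fst (\<phi> x, \<psi> y)" "isCont snd (\<phi> x, \<psi> y)" by (intro continuous_intros)+
  from isCont_eventually_nhds[OF this(1), of "\<lambda>w. inv_into U \<phi> w \<in> U'"]
    isCont_eventually_nhds[OF this(2), of "\<lambda>w. inv_into V \<psi> w \<in> V'"] 1 2
  have "eventually (\<lambda>z. inv_into U \<phi> (fst z) \<in> U') (nhds (\<phi> x, \<psi> y))"
    "eventually (\<lambda>z. inv_into V \<psi> (snd z) \<in> V') (nhds (\<phi> x, \<psi> y))" by simp_all
  with ev have "eventually (\<lambda>z. inv_into (U \<times> V) (map_prod \<phi> \<psi>) z \<in> U' \<times> V') (nhds (\<phi> x, \<psi> y))"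
    by eventually_elim simp
  then show "eventually (\<lambda>z. inv_into (U \<times> V) (map_prod \<phi> \<psi>) z \<in> U' \<times> V') (nhds (map_prod \<phi> \<psi> p))"
    by (simp add: xy)
qed

lemma smoothly_compatible_prod:
  assumes "is_chart (U, \<phi>)" "is_chart (V, \<psi>)" "is_chart (U', \<phi>')" "is_chart (V', \<psi>')"
    and "smoothly_compatible (U, \<phi>) (U', \<phi>')" "smoothly_compatible (V, \<psi>) (V', \<psi>')"
  shows "smoothly_compatible (U \<times> V, map_prod \<phi> \<psi>) (U' \<times> V', map_prod \<phi>' \<psi>')"
proof (rule smoothly_compatibleI)
  fix p assume p: "p \<in> U \<times> V" "p \<in> U' \<times> V'"
  show "smooth_at (\<lambda>z. map_prod \<phi>' \<psi>' (inv_into (U \<times> V) (map_prod \<phi> \<psi>) z)) (map_prod \<phi> \<psi> p) \<and>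
      eventually (\<lambda>z. inv_into (U \<times> V) (map_prod \<phi> \<psi>) z \<in> U' \<times> V') (nhds (map_prod \<phi> \<psi> p))"
    using smoothly_compatible_prod_half[OF assms(1,2,5,6) p] by blast
  show "smooth_at (\<lambda>z. map_prod \<phi> \<psi> (inv_into (U' \<times> V') (map_prod \<phi>' \<psi>') z)) (map_prod \<phi>' \<psi>' p) \<and>
      eventually (\<lambda>z. inv_into (U' \<times> V') (map_prod \<phi>' \<psi>') z \<in> U \<times> V) (nhds (map_prod \<phi>' \<psi>' p))"
    using smoothly_compatible_prod_half[OF assms(3,4) assms(5,6)[THEN smoothly_compatible_sym] p(2,1)] by blast
qed (intro is_chart_prod assms)+

lemma smooth_atlas_prod:
  assumes "smooth_atlas A" "smooth_atlas B"
  shows "smooth_atlas (prod_atlas A B)"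
  using assms unfolding smooth_atlas_def prod_atlas_def
  by (auto intro!: is_chart_prod smoothly_compatible_prod)

lemma points_iff: "x \<in> points A \<longleftrightarrow> (\<exists>U \<phi>. (U, \<phi>) \<in> A \<and> x \<in> U)"
  by (auto simp: points_def)

lemma points_prod: "points (prod_atlas A B) = points A \<times> points B"
proof
  show "points (prod_atlas A B) \<subseteq> points A \<times> points B"
  proof
    fix p assume "p \<in> points (prod_atlas A B)"
    then obtain W \<xi> where "(W, \<xi>) \<in> prod_atlas A B" "p \<in> W" unfolding points_iff by blast
    then obtain U \<phi> V \<psi> where "(U, \<phi>) \<in> A" "(V, \<psi>) \<in> B" "p \<in> U \<times> V"
      unfolding prod_atlas_def by blast
    then have "fst p \<in> points A" "snd p \<in> points B" unfolding points_iff mem_Times_iff by blast+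
    then show "p \<in> points A \<times> points B" by (simp add: mem_Times_iff)
  qed
  show "points A \<times> points B \<subseteq> points (prod_atlas A B)"
  proof clarify
    fix x y assume "x \<in> points A" "y \<in> points B"
    then obtain U \<phi> V \<psi> where UV: "(U, \<phi>) \<in> A" "(V, \<psi>) \<in> B" "x \<in> U" "y \<in> V"
      unfolding points_iff by blast
    then have "(U \<times> V, map_prod \<phi> \<psi>) \<in> prod_atlas A B"
      unfolding prod_atlas_def by blast
    moreover have "(x, y) \<in> U \<times> V" using UV by simp
    ultimately show "(x, y) \<in> points (prod_atlas A B)" unfolding points_iff by blast
  qed
qed

lemma coord_chart_prod:
  assumes "smooth_atlas A" "smooth_atlas B" "coord_chart A (U, \<phi>)" "coord_chart B (V, \<psi>)"
  shows "coord_chart (prod_atlas A B) (U \<times> V, map_prod \<phi> \<psi>)"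
  unfolding coord_chart_def
proof (intro conjI ballI)
  show "is_chart (U \<times> V, map_prod \<phi> \<psi>)"
    using assms(3,4) by (intro is_chart_prod coord_chart_is_chart)
  show "fst (U \<times> V, map_prod \<phi> \<psi>) \<subseteq> points (prod_atlas A B)"
    using assms(3,4) unfolding points_prod fst_conv coord_chart_def by (intro Sigma_mono) simp_all
  fix d assume "d \<in> prod_atlas A B"
  then obtain U' \<phi>' V' \<psi>' where d: "d = (U' \<times> V', map_prod \<phi>' \<psi>')" "(U', \<phi>') \<in> A" "(V', \<psi>') \<in> B"
    unfolding prod_atlas_def by blast
  note UV' = smooth_atlas_coord_chart[OF assms(1) d(2)] smooth_atlas_coord_chart[OF assms(2) d(3)]
  show "smoothly_compatible (U \<times> V, map_prod \<phi> \<psi>) d"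
    unfolding d(1)
    by (intro smoothly_compatible_prod coord_chart_is_chart[OF assms(3)] coord_chart_is_chart[OF assms(4)]
        coord_chart_is_chart[OF UV'(1)] coord_chart_is_chart[OF UV'(2)]
        coord_chart_compatible[OF assms(1,3) UV'(1)] coord_chart_compatible[OF assms(2,4) UV'(2)])
qed

lemma smooth_atlas_real: "smooth_atlas real_atlas"
proof -
  have "smooth_on UNIV (\<lambda>x :: real. x)"
    by (intro smooth_onI_smooth_at smooth_at_ident)
  then have "smoothly_compatible (UNIV, id :: real \<Rightarrow> real) (UNIV, id)"
    by (simp add: smoothly_compatible_def o_def id_def inv_id[unfolded id_def])
  then show ?thesis
    by (simp add: smooth_atlas_def real_atlas_def is_chart_def)
qed

lemma coord_chart_real: "coord_chart real_atlas (UNIV, id)"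
  by (intro smooth_atlas_coord_chart smooth_atlas_real) (simp add: real_atlas_def)

subsection \<open>Curves and tangent vectors in a chart\<close>

lemma curve_at_iff:
  assumes A: "smooth_atlas A" and U: "coord_chart A (U, \<phi>)" "m \<in> U"
  shows "curve_at A m c \<longleftrightarrow> c 0 = m \<and> smooth_at (\<phi> \<circ> c) 0 \<and> eventually (\<lambda>t. c t \<in> U) (nhds 0)"
proof
  assume "curve_at A m c"
  then obtain S where S: "c 0 = m" "0 \<in> S" "smooth_map real_atlas A S c"
    unfolding curve_at_def by blast
  have "c 0 \<in> U" using S(1) U(2) by simp
  from smooth_mapD[OF smooth_atlas_real A S(3,2) coord_chart_real UNIV_I U(1) this] S(1)
  show "c 0 = m \<and> smooth_at (\<phi> \<circ> c) 0 \<and> eventually (\<lambda>t. c t \<in> U) (nhds 0)"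
    by (simp add: o_def inv_id[unfolded id_def] id_def)
next
  assume c: "c 0 = m \<and> smooth_at (\<phi> \<circ> c) 0 \<and> eventually (\<lambda>t. c t \<in> U) (nhds 0)"
  then have "eventually (\<lambda>t. smooth_at (\<phi> \<circ> c) t \<and> c t \<in> U) (nhds 0)"
    using eventually_smooth_at[of "\<phi> \<circ> c" 0] by (simp add: eventually_conj)
  then obtain S where S: "open S" "0 \<in> S" "\<And>t. t \<in> S \<Longrightarrow> smooth_at (\<phi> \<circ> c) t \<and> c t \<in> U"
    unfolding eventually_nhds by blast
  have "smooth_map real_atlas A S c"
  proof (rule smooth_mapI[OF smooth_atlas_real])
    fix t assume t: "t \<in> S"
    have ev: "eventually (\<lambda>s. s \<in> S) (nhds t)" using S(1) t by (rule eventually_nhds_in_open)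
    then have "eventually (\<lambda>s. c s \<in> U) (nhds t)" by eventually_elim (simp add: S(3))
    then have "smooth_at (\<lambda>s. \<phi> (c (inv_into UNIV id s))) (id t) \<and>
        eventually (\<lambda>s. inv_into UNIV id s \<in> S) (nhds (id t)) \<and>
        eventually (\<lambda>s. c (inv_into UNIV id s) \<in> U) (nhds (id t))"
      using S(3)[OF t] ev by (simp add: o_def inv_id[unfolded id_def] id_def)
    then show "\<exists>W \<xi> V \<psi>. coord_chart real_atlas (W, \<xi>) \<and> coord_chart A (V, \<psi>) \<and> t \<in> W \<and> c t \<in> V \<and>
        smooth_at (\<lambda>s. \<psi> (c (inv_into W \<xi> s))) (\<xi> t) \<and>
        eventually (\<lambda>s. inv_into W \<xi> s \<in> S) (nhds (\<xi> t)) \<and>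
        eventually (\<lambda>s. c (inv_into W \<xi> s) \<in> V) (nhds (\<xi> t))"
      using coord_chart_real U(1) S(3)[OF t]
      by (intro exI[of _ UNIV] exI[of _ id] exI[of _ U] exI[of _ \<phi>]) simp
  qed
  with S c show "curve_at A m c"
    unfolding curve_at_def by blast
qed

subsection \<open>Velocity and acceleration of curves in a manifold\<close>

lemma velocity_cong:
  assumes "eventually (\<lambda>t. \<phi> (c t) = u t) (nhds 0)" "smooth_at u 0"
  shows "smooth_at (\<phi> \<circ> c) 0" "velocity \<phi> c = frechet_derivative u (at 0) 1"
    "acceleration \<phi> c = second_derivative u 0 1 1"
proof -
  have ev: "eventually (\<lambda>t. (\<phi> \<circ> c) t = u t) (nhds 0)"
    using assms(1) by simp
  have ev': "eventually (\<lambda>t. u t = (\<phi> \<circ> c) t) (nhds 0)"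
    using ev by eventually_elim simp
  show sm: "smooth_at (\<phi> \<circ> c) 0"
    by (rule smooth_at_cong[OF assms(2) ev'])
  show "velocity \<phi> c = frechet_derivative u (at 0) 1"
    by (simp only: velocity_eq[OF sm] frechet_derivative_cong_nhds[OF ev])
  have "eventually (\<lambda>t. eventually (\<lambda>s. (\<phi> \<circ> c) s = u s) (nhds t)) (nhds 0)"
    using ev by (simp only: eventually_eventually)
  then have "eventually (\<lambda>t. frechet_derivative (\<phi> \<circ> c) (at t) 1 = frechet_derivative u (at t) 1) (nhds 0)"
    by eventually_elim (simp only: frechet_derivative_cong_nhds)
  from frechet_derivative_cong_nhds[OF this]
  show "acceleration \<phi> c = second_derivative u 0 1 1"
    by (simp only: acceleration_eq[OF sm] second_derivative_def)
qed

lemma curve_at_chart_curve: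
  assumes A: "smooth_atlas A" and U: "coord_chart A (U, \<phi>)" "m \<in> U" and u: "smooth_at u 0" "u 0 = \<phi> m"
  defines "c \<equiv> \<lambda>t. inv_into U \<phi> (u t)"
  shows "curve_at A m c" "velocity \<phi> c = frechet_derivative u (at 0) 1"
    "acceleration \<phi> c = second_derivative u 0 1 1"
proof -
  have im: "eventually (\<lambda>t. u t \<in> \<phi> ` U) (nhds 0)"
    by (rule isCont_eventually_nhds[OF smooth_at_imp_isCont[OF u(1)]])
      (simp add: u(2) coord_chart_eventually_image[OF U])
  then have ev: "eventually (\<lambda>t. \<phi> (c t) = u t) (nhds 0)"
    by eventually_elim (simp add: c_def f_inv_into_f)
  note jets = velocity_cong[of \<phi> c u, OF ev u(1)]
  have "eventually (\<lambda>t. c t \<in> U) (nhds 0)"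
    using im by eventually_elim (simp add: c_def inv_into_into)
  then show "curve_at A m c"
    unfolding curve_at_iff[OF A U] using jets(1) by (simp add: c_def u(2) coord_chart_inv[OF U])
  show "velocity \<phi> c = frechet_derivative u (at 0) 1"
    "acceleration \<phi> c = second_derivative u 0 1 1" by (rule jets(2,3))+
qed

text \<open>Velocities are transformed by the derivative \<open>D\<theta>\<close> of the transition map, accelerations
additionally acquire \<open>D\<^sup>2\<theta>\<close> of the velocity. The second term is why a parabolic arrow can
only retain part of the acceleration.\<close>

lemma jet_chart_change:
  assumes A: "smooth_atlas A" and U: "coord_chart A (U, \<phi>)" "m \<in> U" and V: "coord_chart A (V, \<psi>)" "m \<in> V"
    and c: "curve_at A m c"
  defines "\<theta> \<equiv> \<lambda>y. \<psi> (inv_into U \<phi> y)"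
  shows "velocity \<psi> c = frechet_derivative \<theta> (at (\<phi> m)) (velocity \<phi> c)"
    and "acceleration \<psi> c = second_derivative \<theta> (\<phi> m) (velocity \<phi> c) (velocity \<phi> c) +
      frechet_derivative \<theta> (at (\<phi> m)) (acceleration \<phi> c)"
proof -
  have c': "c 0 = m" "smooth_at (\<phi> \<circ> c) 0" "eventually (\<lambda>t. c t \<in> U) (nhds 0)"
    using c unfolding curve_at_iff[OF A U] by simp_all
  have \<theta>: "smooth_at \<theta> ((\<phi> \<circ> c) 0)"
    unfolding \<theta>_def using coord_chart_transition(1)[OF A U V] c'(1) by simp
  have ev: "eventually (\<lambda>t. \<psi> (c t) = \<theta> ((\<phi> \<circ> c) t)) (nhds 0)"
    using c'(3) by eventually_elim (simp add: \<theta>_def coord_chart_inv[OF U(1)])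
  note jets = velocity_cong[of \<psi> c "\<lambda>t. \<theta> ((\<phi> \<circ> c) t)", OF ev smooth_at_compose[OF c'(2) \<theta>]]
  have m: "(\<phi> \<circ> c) 0 = \<phi> m" using c'(1) by simp
  show "velocity \<psi> c = frechet_derivative \<theta> (at (\<phi> m)) (velocity \<phi> c)"
    using jets(2) frechet_derivative_compose_smooth_at[OF c'(2) \<theta>, of 1]
    by (simp only: velocity_eq[OF c'(2)] m)
  show "acceleration \<psi> c = second_derivative \<theta> (\<phi> m) (velocity \<phi> c) (velocity \<phi> c) +
      frechet_derivative \<theta> (at (\<phi> m)) (acceleration \<phi> c)"
    using jets(3) second_derivative_compose_curve[OF c'(2) \<theta>]
    by (simp only: velocity_eq[OF c'(2)] acceleration_eq[OF c'(2)] m)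
qed

lemma tangent_coord_tangent_vector:
  assumes "coord_chart A (U, \<phi>)" "m \<in> U" "curve_at A m c"
  shows "tangent_coord \<phi> (tangent_vector A m c) = velocity \<phi> c"
proof -
  have "c \<in> tangent_vector A m c"
    using assms(3) by (simp add: tangent_vector_def)
  then have "(SOME c'. c' \<in> tangent_vector A m c) \<in> tangent_vector A m c"
    by (rule someI[where P = "\<lambda>c'. c' \<in> tangent_vector A m c"])
  then show ?thesis
    unfolding tangent_coord_def using assms(1,2) unfolding tangent_vector_def by blast
qed

lemma tangent_vector_eqI:
  assumes A: "smooth_atlas A" and U: "coord_chart A (U, \<phi>)" "m \<in> U"
    and c: "curve_at A m c" "curve_at A m c'" "velocity \<phi> c = velocity \<phi> c'"
  shows "tangent_vector A m c = tangent_vector A m c'"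
proof -
  have "velocity \<psi> c = velocity \<psi> c'" if "coord_chart A (V, \<psi>)" "m \<in> V" for V \<psi>
    using jet_chart_change(1)[OF A U that c(1)] jet_chart_change(1)[OF A U that c(2)] c(3) by simp
  then show ?thesis
    unfolding tangent_vector_def by (intro Collect_cong) metis
qed

text \<open>A tangent vector is determined by its components in one chart, so membership in \<open>H\<close> can be
tested there.\<close>

lemma tangent_vector_in_iff:
  assumes A: "smooth_atlas A" and U: "coord_chart A (U, \<phi>)" "m \<in> U" and c: "curve_at A m c"
  shows "tangent_vector A m c \<in> H \<longleftrightarrow> velocity \<phi> c \<in> tangent_coord \<phi> ` fibre A H m"
proof
  assume "tangent_vector A m c \<in> H"
  then have "tangent_vector A m c \<in> fibre A H m"
    using c by (auto simp: fibre_def tangent_space_def)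
  then show "velocity \<phi> c \<in> tangent_coord \<phi> ` fibre A H m"
    using tangent_coord_tangent_vector[OF U c] by (metis imageI)
next
  assume "velocity \<phi> c \<in> tangent_coord \<phi> ` fibre A H m"
  then obtain X where X: "X \<in> fibre A H m" "velocity \<phi> c = tangent_coord \<phi> X" by blast
  then obtain c' where c': "X = tangent_vector A m c'" "curve_at A m c'" "X \<in> H"
    unfolding fibre_def tangent_space_def by blast
  have "velocity \<phi> c = velocity \<phi> c'"
    using X(2) tangent_coord_tangent_vector[OF U c'(2)] by (simp add: c'(1))
  then show "tangent_vector A m c \<in> H"
    using tangent_vector_eqI[OF A U c c'(2)] c'(1,3) by simp
qed

text \<open>Every Taylor curve, and every flow line of the flows constructed below, has this form in
coordinates.\<close>

lemma second_order_polynomial_jet: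
  fixes a b c :: "'a::real_normed_vector"
  shows "smooth_at (\<lambda>t. a + t *\<^sub>R b + t\<^sup>2 *\<^sub>R c) s"
    and "frechet_derivative (\<lambda>t. a + t *\<^sub>R b + t\<^sup>2 *\<^sub>R c) (at 0) 1 = b"
    and "second_derivative (\<lambda>t. a + t *\<^sub>R b + t\<^sup>2 *\<^sub>R c) 0 1 1 = 2 *\<^sub>R c"
proof -
  show "smooth_at (\<lambda>t. a + t *\<^sub>R b + t\<^sup>2 *\<^sub>R c) s"
    by (intro smooth_at_add smooth_at_scaleR smooth_at_const smooth_at_ident smooth_at_power2)
  have "((\<lambda>t. a + t *\<^sub>R b + t\<^sup>2 *\<^sub>R c) has_derivative (\<lambda>s. s *\<^sub>R b + (2 * t * s) *\<^sub>R c)) (at t)" for t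
    by (auto intro!: derivative_eq_intros simp: algebra_simps)
  note D = frechet_derivative_apply[OF this, of _ 1]
  show "frechet_derivative (\<lambda>t. a + t *\<^sub>R b + t\<^sup>2 *\<^sub>R c) (at 0) 1 = b"
    by (simp add: D)
  have D': "((\<lambda>t. 1 *\<^sub>R b + (2 * t * 1) *\<^sub>R c) has_derivative (\<lambda>s. (2 * s) *\<^sub>R c)) (at t)" for t
    by (auto intro!: derivative_eq_intros)
  show "second_derivative (\<lambda>t. a + t *\<^sub>R b + t\<^sup>2 *\<^sub>R c) 0 1 1 = 2 *\<^sub>R c"
    unfolding second_derivative_def D using frechet_derivative_apply[OF D', of _ 1] by simp
qed

section \<open>Parabolic arrows and their Taylor coordinates\<close>

subsection \<open>Horizontal and vertical parts\<close>

definition horizontal_part :: "nat \<Rightarrow> real ^ 'n::{finite,linorder} \<Rightarrow> real ^ 'n::{finite,linorder}" where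
  "horizontal_part p x = (\<chi> i. if i \<in> first_coords p then x $ i else 0)"

definition vertical_part :: "nat \<Rightarrow> real ^ 'n::{finite,linorder} \<Rightarrow> real ^ 'n::{finite,linorder}" where
  "vertical_part p x = (\<chi> i. if i \<in> first_coords p then 0 else x $ i)"

lemma bounded_linear_horizontal_part: "bounded_linear (horizontal_part p)"
  unfolding linear_conv_bounded_linear[symmetric]
  by (rule linearI) (simp_all add: horizontal_part_def vec_eq_iff)

lemma bounded_linear_vertical_part: "bounded_linear (vertical_part p)"
  unfolding linear_conv_bounded_linear[symmetric]
  by (rule linearI) (simp_all add: vertical_part_def vec_eq_iff)

lemmas linear_horizontal_part = bounded_linear.linear[OF bounded_linear_horizontal_part]
lemmas linear_vertical_part = bounded_linear.linear[OF bounded_linear_vertical_part]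

lemma horizontal_plus_vertical_part: "horizontal_part p x + vertical_part p x = x"
  by (simp add: horizontal_part_def vertical_part_def vec_eq_iff)

lemma parts_simps [simp]:
  "horizontal_part p (horizontal_part p x) = horizontal_part p x"
  "vertical_part p (vertical_part p x) = vertical_part p x"
  "horizontal_part p (vertical_part p x) = 0"
  "vertical_part p (horizontal_part p x) = 0"
  by (simp_all add: horizontal_part_def vertical_part_def vec_eq_iff)

lemma horizontal_iff: "x \<in> horizontal p \<longleftrightarrow> vertical_part p x = 0"
  by (auto simp: horizontal_def vertical_part_def vec_eq_iff)

lemma horizontal_part_eq: "x \<in> horizontal p \<Longrightarrow> horizontal_part p x = x"
  using horizontal_plus_vertical_part[of p x] by (simp add: horizontal_iff)

lemma horizontal_part_in: "horizontal_part p x \<in> horizontal p"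
  by (simp add: horizontal_iff)

lemma subspace_horizontal: "subspace (horizontal p)"
  by (auto simp: subspace_def horizontal_def)

text \<open>Sending an index to the number of its predecessors is the order isomorphism onto
\<open>{..<CARD('n)}\<close>, and it maps the first indices onto \<open>{..<p}\<close>.\<close>

lemma card_first_coords:
  assumes "p \<le> CARD('n::{finite,linorder})"
  shows "card (first_coords p :: 'n set) = p"
proof -
  let ?r = "\<lambda>i::'n. card {j. j < i}"
  have less: "?r i < ?r j" if "i < j" for i j
    by (rule psubset_card_mono) (use that in auto)
  have inj: "inj ?r"
  proof (rule injI)
    fix i j :: 'n assume "?r i = ?r j"
    then show "i = j" using less[of i j] less[of j i] by (cases i j rule: linorder_cases) auto
  qed
  have "?r i < CARD('n)" for i
    by (rule psubset_card_mono) auto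
  then have "range ?r \<subseteq> {..<CARD('n)}" by blast
  moreover have "card (range ?r) = card {..<CARD('n)}" using card_image[OF inj] by simp
  ultimately have "range ?r = {..<CARD('n)}" by (intro card_subset_eq) auto
  then have "?r ` first_coords p = {..<p}"
  proof (intro equalityI subsetI)
    fix k assume "k \<in> {..<p}"
    with assms have "k \<in> range ?r" using \<open>range ?r = {..<CARD('n)}\<close> by simp
    with \<open>k \<in> {..<p}\<close> show "k \<in> ?r ` first_coords p"
      unfolding first_coords_def by blast
  qed (auto simp: first_coords_def)
  then show ?thesis
    using card_image[OF inj_on_subset[OF inj subset_UNIV], of "first_coords p"] by simp
qed

lemma axis_first_coords_Basis: "(\<lambda>i. axis i (1::real)) ` first_coords p \<subseteq> Basis"
  by (auto simp: Basis_vec_def)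

lemma horizontal_substandard:
  "horizontal p = {x. \<forall>b\<in>Basis. b \<notin> (\<lambda>i. axis i (1::real)) ` first_coords p \<longrightarrow> x \<bullet> b = 0}"
  by (auto simp: horizontal_def Basis_vec_def inner_axis axis_eq_axis)

lemma span_first_coords: "span ((\<lambda>i. axis i (1::real)) ` first_coords p) = horizontal p"
  unfolding horizontal_substandard by (rule span_substd_basis[OF axis_first_coords_Basis])

lemma card_axis_first_coords:
  "p \<le> CARD('n::{finite,linorder}) \<Longrightarrow> card ((\<lambda>i::'n. axis i (1::real)) ` first_coords p) = p"
  by (subst card_image) (auto simp: inj_on_def axis_eq_axis card_first_coords)

lemma dim_horizontal:
  "p \<le> CARD('n::{finite,linorder}) \<Longrightarrow> dim (horizontal p :: (real ^ 'n::{finite,linorder}) set) = p"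
  unfolding horizontal_substandard dim_substandard[OF axis_first_coords_Basis]
  by (rule card_axis_first_coords)

text \<open>A basis of \<open>S\<close>, extended to a basis of the whole space, is sent bijectively to the standard
basis in such a way that the basis of \<open>S\<close> goes to the first \<open>p\<close> vectors.\<close>

lemma linear_iso_onto_horizontal:
  fixes S :: "(real ^ 'n::{finite,linorder}) set"
  assumes S: "subspace S" "dim S = p" and p: "p \<le> CARD('n)"
  obtains L :: "real ^ 'n::{finite,linorder} \<Rightarrow> real ^ 'n::{finite,linorder}" where "linear L" "bij L" "L ` S = horizontal p"
proof -
  obtain B where B: "B \<subseteq> S" "independent B" "S \<subseteq> span B" "card B = dim S"
    by (rule basis_exists)
  obtain C where C: "B \<subseteq> C" "independent C" "UNIV \<subseteq> span C"
    by (rule maximal_independent_subset_extend[OF subset_UNIV B(2)])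
  let ?E = "(\<lambda>i::'n. axis i (1::real)) ` first_coords p"
  have fin: "finite C" by (rule independent_imp_finite[OF C(2)])
  then have finB: "finite B" by (rule finite_subset[OF C(1)])
  have cardC: "card C = card (Basis :: (real ^ 'n::{finite,linorder}) set)"
    using dim_unique[OF subset_UNIV C(3,2) refl] by simp
  have "card B = card ?E" using B(4) S(2) card_axis_first_coords[OF p] by simp
  obtain f where f: "bij_betw f B ?E"
    using finite_same_card_bij[OF finB finite_imageI[OF finite] \<open>card B = card ?E\<close>]
    by (elim exE) (rule that)
  have "card (C - B) = card (Basis - ?E)"
    using card_Diff_subset[OF finB C(1)] card_Diff_subset[OF _ axis_first_coords_Basis[where 'a='n], of p]
      cardC \<open>card B = card ?E\<close> by simp
  from finite_same_card_bij[OF finite_Diff[OF fin] finite_Diff[OF finite_Basis] this]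
  obtain g where g: "bij_betw g (C - B) (Basis - ?E)"
    by (elim exE) (rule that)
  let ?h = "\<lambda>x. if x \<in> B then f x else g x"
  obtain L where L: "linear L" "\<And>x. x \<in> C \<Longrightarrow> L x = ?h x"
    using linear_independent_extend[OF C(2), of ?h] by (elim exE conjE) (rule that, assumption, erule bspec)
  have "L ` B = f ` B"
    by (rule image_cong) (use C(1) L(2) in auto)
  then have LB: "L ` B = ?E"
    using bij_betw_imp_surj_on[OF f] by simp
  have "L ` (C - B) = g ` (C - B)"
    by (rule image_cong) (simp_all add: L(2))
  then have LCB: "L ` (C - B) = Basis - ?E"
    using bij_betw_imp_surj_on[OF g] by simp
  have "C = B \<union> (C - B)" using C(1) by blast
  then have "L ` C = ?E \<union> (Basis - ?E)"
    using image_Un[of L B "C - B"] LB LCB by simp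
  then have "L ` C = Basis" using axis_first_coords_Basis[where 'a='n, of p] by (simp add: Un_absorb1)
  then have "L ` span C = UNIV"
    using linear_span_image[OF L(1), of C] span_Basis by simp
  then have surj: "surj L" by blast
  then have "bij L" using linear_surjective_imp_injective[OF L(1)] by (simp add: bij_def)
  moreover have "L ` S = horizontal p"
  proof -
    have "S = span B" using span_subspace[OF B(1,3) S(1)] by simp
    then have "L ` S = span (L ` B)" using linear_span_image[OF L(1), of B] by simp
    then show ?thesis by (simp add: LB span_first_coords)
  qed
  ultimately show thesis by (rule that[OF L(1)])
qed

subsection \<open>H-coordinates\<close>

text \<open>Needed to turn an arbitrary chart into H-coordinates, by moving the point to the origin and
straightening the fibre of \<open>H\<close> there.\<close>

lemma coord_chart_linear_change:
  fixes A :: "('m, 'e::euclidean_space) chart set"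
  assumes A: "smooth_atlas A" and U: "coord_chart A (U, \<phi>)" and L: "linear L" "bij L"
  shows "coord_chart A (U, \<lambda>x. L (\<phi> x - a))"
proof -
  define G where "G = inv_into UNIV L"
  have G: "L (G y) = y" "G (L y) = y" for y
    using L(2) by (simp_all add: G_def bij_def surj_f_inv_f)
  have linG: "bounded_linear G"
    unfolding G_def linear_conv_bounded_linear[symmetric]
    using inj_linear_imp_inv_linear[OF L(1)] L(2) bij_is_inj by blast
  have linL: "bounded_linear L" using L(1) by (simp add: linear_conv_bounded_linear)
  let ?\<psi> = "\<lambda>x. L (\<phi> x - a)" and ?D = "\<lambda>y. G y + a"
  have ch: "is_chart (U, \<phi>)" by (rule coord_chart_is_chart[OF U])
  have smD: "smooth_at ?D y" for y
    by (intro smooth_at_add smooth_at_const smooth_at_bounded_linear linG)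
  have smL: "smooth_at (\<lambda>y. L (y - a)) y" for y
    by (intro smooth_at_bounded_linear_compose[OF linL] smooth_at_diff smooth_at_const smooth_at_ident)
  have im: "?\<psi> ` U = ?D -` (\<phi> ` U)"
  proof (intro equalityI subsetI)
    fix y assume "y \<in> ?D -` (\<phi> ` U)"
    then obtain x where "x \<in> U" "G y + a = \<phi> x" by auto
    then have "y = ?\<psi> x" using G(1)[of y] by (metis add_diff_cancel_right')
    then show "y \<in> ?\<psi> ` U" using \<open>x \<in> U\<close> by blast
  qed (auto simp: G)
  have injL: "L (y - a) = L (z - a) \<Longrightarrow> y = z" for y z
    using G(2) by (metis diff_add_cancel)
  have "continuous_on UNIV ?D"
    using smooth_at_imp_isCont[OF smD] by (simp add: continuous_at_imp_continuous_on)
  then have "open (?\<psi> ` U)"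
    unfolding im using ch by (intro open_vimage) (simp_all add: is_chart_def)
  moreover have "inj_on ?\<psi> U"
    using ch injL unfolding is_chart_def inj_on_def by blast
  ultimately have ch': "is_chart (U, ?\<psi>)" by (simp add: is_chart_def)
  have inv: "inv_into U ?\<psi> y = inv_into U \<phi> (?D y)" if "y \<in> ?\<psi> ` U" for y
    using that chart_inv[OF ch'] chart_inv[OF ch] by (auto simp: G)
  show ?thesis
    unfolding coord_chart_def
  proof (intro conjI ballI)
    show "is_chart (U, ?\<psi>)" by (rule ch')
    show "fst (U, ?\<psi>) \<subseteq> points A" using U by (simp add: coord_chart_def)
    fix d assume "d \<in> A"
    then have d: "coord_chart A d" by (rule smooth_atlas_coord_chart[OF A])
    obtain W \<xi> where dW: "d = (W, \<xi>)" by fastforce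
    note W = d[unfolded dW]
    show "smoothly_compatible (U, ?\<psi>) d"
      unfolding dW
    proof (rule smoothly_compatibleI[OF ch' coord_chart_is_chart[OF W]])
      fix x assume x: "x \<in> U" "x \<in> W"
      note UW = coord_chart_transition[OF A U x(1) W x(2)] and WU = coord_chart_transition[OF A W x(2) U x(1)]
      have D\<psi>: "?D (?\<psi> x) = \<phi> x" by (simp add: G)
      have ev: "eventually (\<lambda>y. inv_into U \<phi> (?D y) = inv_into U ?\<psi> y) (nhds (?\<psi> x))"
        using is_chart_eventually_image[OF ch' x(1)] by eventually_elim (simp only: inv)
      have "smooth_at (\<lambda>y. \<xi> (inv_into U \<phi> (?D y))) (?\<psi> x)"
        by (rule smooth_at_compose[OF smD]) (simp only: D\<psi> UW)
      moreover have "eventually (\<lambda>y. \<xi> (inv_into U \<phi> (?D y)) = \<xi> (inv_into U ?\<psi> y)) (nhds (?\<psi> x))"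
        using ev by eventually_elim simp
      ultimately have 1: "smooth_at (\<lambda>y. \<xi> (inv_into U ?\<psi> y)) (?\<psi> x)"
        by (rule smooth_at_cong)
      have "eventually (\<lambda>y. inv_into U \<phi> (?D y) \<in> W) (nhds (?\<psi> x))"
        by (rule isCont_eventually_nhds[OF smooth_at_imp_isCont[OF smD]]) (simp only: D\<psi> UW)
      with ev have 2: "eventually (\<lambda>y. inv_into U ?\<psi> y \<in> W) (nhds (?\<psi> x))"
        by eventually_elim simp
      from 1 2 show "smooth_at (\<lambda>y. \<xi> (inv_into U ?\<psi> y)) (?\<psi> x) \<and>
          eventually (\<lambda>y. inv_into U ?\<psi> y \<in> W) (nhds (?\<psi> x))" ..
      show "smooth_at (\<lambda>y. ?\<psi> (inv_into W \<xi> y)) (\<xi> x) \<and> eventually (\<lambda>y. inv_into W \<xi> y \<in> U) (nhds (\<xi> x))"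
        using smooth_at_compose[OF WU(1) smL] WU(2) by simp
    qed
  qed
qed

locale smooth_distribution =
  fixes A :: "('m, real ^ 'n::{finite,linorder}) chart set" and H :: "(real \<Rightarrow> 'm) set set" and p :: nat
  assumes atlas: "smooth_atlas A" and distribution: "distribution A p H" and rank_le: "p \<le> CARD('n)"
begin

lemma fibre_subspace:
  assumes "coord_chart A (U, \<phi>)" "m \<in> U"
  shows "subspace (tangent_coord \<phi> ` fibre A H m)" "dim (tangent_coord \<phi> ` fibre A H m) = p"
proof -
  have "\<forall>m U \<phi>. coord_chart A (U, \<phi>) \<and> m \<in> U \<longrightarrow>
      subspace (tangent_coord \<phi> ` fibre A H m) \<and> dim (tangent_coord \<phi> ` fibre A H m) = p"
    using distribution unfolding distribution_def by (elim conjE)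
  from this[rule_format, OF conjI, OF assms]
  show "subspace (tangent_coord \<phi> ` fibre A H m)" "dim (tangent_coord \<phi> ` fibre A H m) = p"
    by simp_all
qed

lemma ex_H_chart:
  assumes "m \<in> points A"
  obtains U \<phi> where "H_chart A H p m (U, \<phi>)"
proof -
  obtain U \<phi> where "(U, \<phi>) \<in> A" and U: "m \<in> U" "coord_chart A (U, \<phi>)"
    by (rule points_atlas_chart[OF atlas assms])
  obtain L :: "real ^ 'n::{finite,linorder} \<Rightarrow> real ^ 'n::{finite,linorder}"
    where L: "linear L" "bij L" "L ` (tangent_coord \<phi> ` fibre A H m) = horizontal p"
    using linear_iso_onto_horizontal[OF fibre_subspace[OF U(2,1)] rank_le] by blast
  have linL: "bounded_linear L" using L(1) by (simp add: linear_conv_bounded_linear)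
  let ?\<psi> = "\<lambda>x. L (\<phi> x - \<phi> m)"
  have \<psi>: "coord_chart A (U, ?\<psi>)" by (rule coord_chart_linear_change[OF atlas U(2) L(1,2)])
  have "tangent_coord ?\<psi> X = L (tangent_coord \<phi> X)" if X: "X \<in> fibre A H m" for X
  proof -
    obtain c where c: "X = tangent_vector A m c" "curve_at A m c"
      using X unfolding fibre_def tangent_space_def by blast
    then have sm: "smooth_at (\<phi> \<circ> c) 0" using curve_at_iff[OF atlas U(2,1)] by blast
    have "((\<lambda>t. L ((\<phi> \<circ> c) t - \<phi> m)) has_derivative (\<lambda>t. L (frechet_derivative (\<phi> \<circ> c) (at 0) t - 0))) (at 0)"
      by (intro bounded_linear.has_derivative[OF linL] has_derivative_diff has_derivative_const
          smooth_at_imp_has_derivative[OF sm])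
    from frechet_derivative_apply[OF this, of 1]
    have "frechet_derivative (?\<psi> \<circ> c) (at 0) 1 = L (velocity \<phi> c)"
      by (simp add: velocity_eq[OF sm] o_def)
    moreover have "smooth_at (?\<psi> \<circ> c) 0"
      using curve_at_iff[OF atlas \<psi> U(1)] c(2) by blast
    ultimately have "velocity ?\<psi> c = L (velocity \<phi> c)" by (simp add: velocity_eq)
    then show ?thesis
      using tangent_coord_tangent_vector[OF \<psi> U(1) c(2)] tangent_coord_tangent_vector[OF U(2,1) c(2)]
      by (simp add: c(1))
  qed
  then have "tangent_coord ?\<psi> ` fibre A H m = horizontal p"
    unfolding L(3)[symmetric] image_image by (intro image_cong) simp_all
  moreover have "?\<psi> m = 0" using linear_0[OF L(1)] by simp
  ultimately have "H_chart A H p m (U, ?\<psi>)"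
    unfolding H_chart_def using \<psi> U(1) by (simp add: span_first_coords)
  then show thesis by (rule that)
qed

lemma H_chartD:
  assumes "H_chart A H p m (U, \<phi>)"
  shows "coord_chart A (U, \<phi>)" "m \<in> U" "\<phi> m = 0" "tangent_coord \<phi> ` fibre A H m = horizontal p"
  using assms unfolding H_chart_def by (simp_all add: span_first_coords)

lemma tangent_curve_at_iff:
  assumes "H_chart A H p m (U, \<phi>)"
  shows "tangent_curve_at A H m c \<longleftrightarrow> curve_at A m c \<and> velocity \<phi> c \<in> horizontal p"
  unfolding tangent_curve_at_def
  using tangent_vector_in_iff[OF atlas H_chartD(1,2)[OF assms], of c H] H_chartD(4)[OF assms] by auto

subsection \<open>Taylor coordinates\<close>

text \<open>The factor one half makes the curve \<open>(t h, t\<^sup>2 n)\<close>, with acceleration \<open>(0, 2 n)\<close>, have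
the coordinates \<open>(h, n)\<close>.\<close>

definition taylor_coord :: "('m \<Rightarrow> real ^ 'n::{finite,linorder}) \<Rightarrow> (real \<Rightarrow> 'm) \<Rightarrow> real ^ 'n::{finite,linorder}" where
  "taylor_coord \<phi> c = horizontal_part p (velocity \<phi> c) + (1/2) *\<^sub>R vertical_part p (acceleration \<phi> c)"

lemma taylor_coord_parts:
  "horizontal_part p (taylor_coord \<phi> c) = horizontal_part p (velocity \<phi> c)"
  "vertical_part p (taylor_coord \<phi> c) = (1/2) *\<^sub>R vertical_part p (acceleration \<phi> c)"
  by (simp_all add: taylor_coord_def linear_add[OF linear_horizontal_part] linear_add[OF linear_vertical_part]
      linear_scale[OF linear_horizontal_part] linear_scale[OF linear_vertical_part])

text \<open>The effect on Taylor coordinates of passing from one H-chart to another; it is obtained from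
\<open>jet_chart_change\<close> and is polynomial of degree at most two.\<close>

definition taylor_transition ::
    "'m set \<times> ('m \<Rightarrow> real ^ 'n::{finite,linorder}) \<Rightarrow> ('m \<Rightarrow> real ^ 'n::{finite,linorder}) \<Rightarrow> real ^ 'n::{finite,linorder} \<Rightarrow> real ^ 'n::{finite,linorder}" where
  "taylor_transition = (\<lambda>(U, \<phi>) \<psi> x. let \<theta> = \<lambda>y. \<psi> (inv_into U \<phi> y) in
     horizontal_part p (frechet_derivative \<theta> (at 0) (horizontal_part p x)) +
     vertical_part p ((1/2) *\<^sub>R second_derivative \<theta> 0 (horizontal_part p x) (horizontal_part p x) +
       frechet_derivative \<theta> (at 0) (vertical_part p x)))"

text \<open>In both charts the fibre of \<open>H\<close> at \<open>m\<close> is the horizontal subspace.\<close>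

lemma transition_preserves_horizontal:
  assumes U: "H_chart A H p m (U, \<phi>)" and V: "H_chart A H p m (V, \<psi>)" and v: "v \<in> horizontal p"
  shows "frechet_derivative (\<lambda>y. \<psi> (inv_into U \<phi> y)) (at 0) v \<in> horizontal p"
proof -
  let ?u = "\<lambda>t::real. 0 + t *\<^sub>R v + t\<^sup>2 *\<^sub>R 0"
  note jet = second_order_polynomial_jet[of 0 v 0]
  have u: "smooth_at ?u 0" "?u 0 = \<phi> m" using jet(1) H_chartD(3)[OF U] by auto
  note c = curve_at_chart_curve[OF atlas H_chartD(1,2)[OF U] u]
  have "tangent_curve_at A H m (\<lambda>t. inv_into U \<phi> (?u t))"
    unfolding tangent_curve_at_iff[OF U] using c(1,2) jet(2) v by simp
  then have "velocity \<psi> (\<lambda>t. inv_into U \<phi> (?u t)) \<in> horizontal p"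
    unfolding tangent_curve_at_iff[OF V] by blast
  then show ?thesis
    using jet_chart_change(1)[OF atlas H_chartD(1,2)[OF U] H_chartD(1,2)[OF V] c(1)] c(2) jet(2) H_chartD(3)[OF U]
    by simp
qed

text \<open>The horizontal part of the acceleration is not recorded by Taylor coordinates. It does not enter
the new ones either: by \<open>transition_preserves_horizontal\<close> it stays horizontal. This is the
reason why parabolic arrows do not depend on the choice of H-coordinates.\<close>

lemma taylor_coord_change:
  assumes U: "H_chart A H p m (U, \<phi>)" and V: "H_chart A H p m (V, \<psi>)" and c: "tangent_curve_at A H m c"
  shows "taylor_coord \<psi> c = taylor_transition (U, \<phi>) \<psi> (taylor_coord \<phi> c)"
proof -
  define \<theta> where "\<theta> = (\<lambda>y. \<psi> (inv_into U \<phi> y))"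
  let ?D = "frechet_derivative \<theta> (at 0)"
  note UD = H_chartD[OF U] and VD = H_chartD[OF V]
  have c': "curve_at A m c" "velocity \<phi> c \<in> horizontal p"
    using c unfolding tangent_curve_at_iff[OF U] by simp_all
  have lin: "linear ?D"
    using coord_chart_transition(1)[OF atlas UD(1,2) VD(1,2)] UD(3)
    by (intro bounded_linear.linear frechet_derivative_bounded_linear) (simp add: \<theta>_def)
  note jet = jet_chart_change[OF atlas UD(1,2) VD(1,2) c'(1), unfolded UD(3), folded \<theta>_def]
  let ?v = "velocity \<phi> c" and ?a = "acceleration \<phi> c"
  have hv: "horizontal_part p ?v = ?v" by (rule horizontal_part_eq[OF c'(2)])
  have "vertical_part p (?D (horizontal_part p ?a)) = 0"
    using transition_preserves_horizontal[OF U V horizontal_part_in, of ?a]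
    by (simp add: \<theta>_def horizontal_iff)
  then have "vertical_part p (?D ?a) = vertical_part p (?D (vertical_part p ?a))"
    using linear_add[OF lin, of "horizontal_part p ?a" "vertical_part p ?a"]
    by (simp add: horizontal_plus_vertical_part linear_add[OF linear_vertical_part])
  then show ?thesis
    unfolding taylor_transition_def prod.case Let_def \<theta>_def[symmetric] taylor_coord_parts hv
    unfolding taylor_coord_def jet
    by (simp add: linear_add[OF linear_vertical_part] linear_scale[OF linear_vertical_part]
        linear_scale[OF lin] scaleR_add_right)
qed

lemma smooth_taylor_transition:
  assumes U: "H_chart A H p m (U, \<phi>)" and V: "H_chart A H p m (V, \<psi>)"
  shows "smooth_at (taylor_transition (U, \<phi>) \<psi>) x"
proof -
  define \<theta> where "\<theta> = (\<lambda>y. \<psi> (inv_into U \<phi> y))"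
  note UD = H_chartD[OF U] and VD = H_chartD[OF V]
  have sm: "smooth_at \<theta> 0"
    using coord_chart_transition(1)[OF atlas UD(1,2) VD(1,2)] UD(3) by (simp add: \<theta>_def)
  have h: "smooth_at (horizontal_part p) y" "smooth_at (vertical_part p) y" for y :: "real ^ 'n::{finite,linorder}"
    by (intro smooth_at_bounded_linear bounded_linear_horizontal_part bounded_linear_vertical_part)+
  have bil: "bounded_bilinear (second_derivative \<theta> 0)"
    using bilinear_second_derivative[OF sm] by (simp add: bilinear_conv_bounded_bilinear)
  show ?thesis
    unfolding taylor_transition_def prod.case Let_def \<theta>_def[symmetric]
    by (intro smooth_at_add smooth_at_bounded_linear_compose[OF bounded_linear_horizontal_part]
        smooth_at_bounded_linear_compose[OF bounded_linear_vertical_part]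
        smooth_at_bounded_linear_compose[OF frechet_derivative_bounded_linear[OF sm]]
        smooth_at_bounded_linear_compose[OF bounded_linear_scaleR_right]
        smooth_at_bilinear[OF bil] h)
qed

text \<open>Parabolic equivalence can be tested in a single H-chart, because Taylor coordinates in one
determine those in all others.\<close>

lemma parabolic_equiv_iff:
  assumes U: "H_chart A H p m (U, \<phi>)" and c: "tangent_curve_at A H m c" "tangent_curve_at A H m c'"
  shows "parabolic_equiv A H p c c' \<longleftrightarrow> taylor_coord \<phi> c = taylor_coord \<phi> c'"
proof -
  have c0: "c 0 = m" "c' 0 = m" using c by (auto simp: tangent_curve_at_def curve_at_def)
  have iff: "velocity \<psi> c = velocity \<psi> c' \<and> acceleration \<psi> c - acceleration \<psi> c' \<in> horizontal p \<longleftrightarrow>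
      taylor_coord \<psi> c = taylor_coord \<psi> c'" if V: "H_chart A H p m (V, \<psi>)" for V \<psi>
  proof -
    have v: "horizontal_part p (velocity \<psi> c) = velocity \<psi> c"
      "horizontal_part p (velocity \<psi> c') = velocity \<psi> c'"
      using c unfolding tangent_curve_at_iff[OF V] by (simp_all add: horizontal_part_eq)
    have "taylor_coord \<psi> c = taylor_coord \<psi> c' \<longleftrightarrow>
        horizontal_part p (taylor_coord \<psi> c) = horizontal_part p (taylor_coord \<psi> c') \<and>
        vertical_part p (taylor_coord \<psi> c) = vertical_part p (taylor_coord \<psi> c')"
      by (metis horizontal_plus_vertical_part)
    then show ?thesis
      unfolding taylor_coord_parts v horizontal_iff linear_diff[OF linear_vertical_part] by simp
  qed
  show ?thesis
  proof
    assume "parabolic_equiv A H p c c'"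
    then show "taylor_coord \<phi> c = taylor_coord \<phi> c'"
      using iff[OF U] U unfolding parabolic_equiv_def c0 by blast
  next
    assume eq: "taylor_coord \<phi> c = taylor_coord \<phi> c'"
    show "parabolic_equiv A H p c c'"
      unfolding parabolic_equiv_def c0
    proof (intro conjI allI impI)
      fix V \<psi> assume V: "H_chart A H p m (V, \<psi>)"
      have "taylor_coord \<psi> c = taylor_coord \<psi> c'"
        unfolding taylor_coord_change[OF U V c(1)] taylor_coord_change[OF U V c(2)] eq ..
      then show "velocity \<psi> c = velocity \<psi> c'" "acceleration \<psi> c - acceleration \<psi> c' \<in> horizontal p"
        using iff[OF V] by blast+
    qed simp
  qed
qed

lemma parabolic_arrow_eq_iff:
  assumes U: "H_chart A H p m (U, \<phi>)" and c: "tangent_curve_at A H m c" "tangent_curve_at A H m c'"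
  shows "parabolic_arrow A H p c = parabolic_arrow A H p c' \<longleftrightarrow> taylor_coord \<phi> c = taylor_coord \<phi> c'"
proof -
  have c0: "c 0 = m" "c' 0 = m" using c by (auto simp: tangent_curve_at_def curve_at_def)
  have arrow: "parabolic_arrow A H p d = {d'. tangent_curve_at A H m d' \<and> taylor_coord \<phi> d = taylor_coord \<phi> d'}"
    if "tangent_curve_at A H m d" "d 0 = m" for d
    unfolding parabolic_arrow_def that(2) using parabolic_equiv_iff[OF U that(1)] by blast
  show ?thesis
    unfolding arrow[OF c(1) c0(1)] arrow[OF c(2) c0(2)] using c by auto
qed

definition taylor_curve :: "'m set \<times> ('m \<Rightarrow> real ^ 'n::{finite,linorder}) \<Rightarrow> real ^ 'n::{finite,linorder} \<Rightarrow> real \<Rightarrow> 'm" where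
  "taylor_curve = (\<lambda>(U, \<phi>) x t. inv_into U \<phi> (\<chi> i. if i \<in> first_coords p then t * x $ i else t\<^sup>2 * x $ i))"

lemma taylor_arrow_eq: "taylor_arrow A H p c x = parabolic_arrow A H p (taylor_curve c x)"
  by (simp add: taylor_arrow_def taylor_curve_def split: prod.split)

lemma taylor_curve:
  assumes U: "H_chart A H p m (U, \<phi>)"
  shows "tangent_curve_at A H m (taylor_curve (U, \<phi>) x)" "taylor_coord \<phi> (taylor_curve (U, \<phi>) x) = x"
proof -
  let ?u = "\<lambda>t. 0 + t *\<^sub>R horizontal_part p x + t\<^sup>2 *\<^sub>R vertical_part p x"
  note jet = second_order_polynomial_jet[of 0 "horizontal_part p x" "vertical_part p x"]
  have u: "smooth_at ?u 0" "?u 0 = \<phi> m" using jet(1) H_chartD(3)[OF U] by auto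
  note c = curve_at_chart_curve[OF atlas H_chartD(1,2)[OF U] u]
  have eq: "taylor_curve (U, \<phi>) x = (\<lambda>t. inv_into U \<phi> (?u t))"
    unfolding taylor_curve_def prod.case
    by (intro ext arg_cong[where f = "inv_into U \<phi>"])
      (simp add: vec_eq_iff horizontal_part_def vertical_part_def)
  show "tangent_curve_at A H m (taylor_curve (U, \<phi>) x)"
    unfolding tangent_curve_at_iff[OF U] eq using c(1,2) by (simp only: jet horizontal_part_in)
  show "taylor_coord \<phi> (taylor_curve (U, \<phi>) x) = x"
    unfolding eq taylor_coord_def c(2,3) jet
    by (simp add: linear_scale[OF linear_vertical_part] horizontal_plus_vertical_part)
qed

lemma inj_taylor_arrow:
  assumes U: "H_chart A H p m (U, \<phi>)"
  shows "inj (taylor_arrow A H p (U, \<phi>))"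
proof (rule injI)
  fix x y assume "taylor_arrow A H p (U, \<phi>) x = taylor_arrow A H p (U, \<phi>) y"
  then show "x = y"
    unfolding taylor_arrow_eq parabolic_arrow_eq_iff[OF U taylor_curve(1)[OF U] taylor_curve(1)[OF U]]
      taylor_curve(2)[OF U] .
qed

lemma taylor_arrow_taylor_coord:
  assumes U: "H_chart A H p m (U, \<phi>)" and c: "tangent_curve_at A H m c"
  shows "taylor_arrow A H p (U, \<phi>) (taylor_coord \<phi> c) = parabolic_arrow A H p c"
  unfolding taylor_arrow_eq parabolic_arrow_eq_iff[OF U taylor_curve(1)[OF U] c] taylor_curve(2)[OF U] ..

lemma range_taylor_arrow:
  assumes U: "H_chart A H p m (U, \<phi>)"
  shows "range (taylor_arrow A H p (U, \<phi>)) = parabolic_arrows A H p m"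
proof (intro equalityI subsetI)
  fix a assume "a \<in> range (taylor_arrow A H p (U, \<phi>))"
  then show "a \<in> parabolic_arrows A H p m"
    unfolding parabolic_arrows_def taylor_arrow_eq using taylor_curve(1)[OF U] by blast
next
  fix a assume "a \<in> parabolic_arrows A H p m"
  then obtain c where "a = parabolic_arrow A H p c" "tangent_curve_at A H m c"
    unfolding parabolic_arrows_def by blast
  then show "a \<in> range (taylor_arrow A H p (U, \<phi>))"
    using taylor_arrow_taylor_coord[OF U] by (metis rangeI)
qed

lemma inv_taylor_arrow:
  assumes U: "H_chart A H p m (U, \<phi>)" and c: "tangent_curve_at A H m c"
  shows "inv_into UNIV (taylor_arrow A H p (U, \<phi>)) (parabolic_arrow A H p c) = taylor_coord \<phi> c"
  using inv_f_f[OF inj_taylor_arrow[OF U], of "taylor_coord \<phi> c"]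
  by (simp add: taylor_arrow_taylor_coord[OF U c])

end

section \<open>Adapted frames and the group law in Taylor coordinates\<close>

subsection \<open>Frames adapted to H-coordinates\<close>

lemma isCont_tendsto_nhds: "isCont f x \<Longrightarrow> (f \<longlongrightarrow> f x) (nhds x)"
  by (simp add: isCont_def tendsto_at_iff_tendsto_nhds)

lemma span_image_eq_range_sum:
  assumes "finite I"
  shows "span (f ` I) = range (\<lambda>c. \<Sum>i\<in>I. c i *\<^sub>R f i)"
proof
  let ?R = "range (\<lambda>c. \<Sum>i\<in>I. c i *\<^sub>R f i)"
  have "subspace ?R"
  proof (rule subspaceI)
    show "0 \<in> ?R" by (rule image_eqI[of _ _ "\<lambda>_. 0"]) simp_all
    show "x + y \<in> ?R" if xy: "x \<in> ?R" "y \<in> ?R" for x y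
    proof -
      obtain c d where "x = (\<Sum>i\<in>I. c i *\<^sub>R f i)" "y = (\<Sum>i\<in>I. d i *\<^sub>R f i)" using xy by auto
      then show ?thesis
        by (intro image_eqI[of _ _ "\<lambda>i. c i + d i"]) (simp_all add: scaleR_add_left sum.distrib)
    qed
    show "a *\<^sub>R x \<in> ?R" if x: "x \<in> ?R" for a x
    proof -
      obtain c where "x = (\<Sum>i\<in>I. c i *\<^sub>R f i)" using x by auto
      then show ?thesis
        by (intro image_eqI[of _ _ "\<lambda>i. a * c i"]) (simp_all add: scaleR_sum_right)
    qed
  qed
  moreover have "f ` I \<subseteq> ?R"
  proof
    fix x assume "x \<in> f ` I"
    then obtain j where j: "j \<in> I" "x = f j" by blast
    have "(\<Sum>i\<in>I. (if i = j then 1 else 0) *\<^sub>R f i) = (\<Sum>i\<in>I. if i = j then f i else 0)"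
      by (rule sum.cong) simp_all
    then have "x = (\<Sum>i\<in>I. (if i = j then 1 else 0) *\<^sub>R f i)"
      using j assms by simp
    then show "x \<in> ?R" by (intro image_eqI[where x = "\<lambda>i. if i = j then 1 else 0"]) simp_all
  qed
  ultimately show "span (f ` I) \<subseteq> ?R" by (intro span_minimal)
  show "?R \<subseteq> span (f ` I)"
    by (rule image_subsetI) (intro span_sum span_scale span_base imageI)
qed

text \<open>On horizontal \<open>u\<close> this is the combination \<open>\<Sum> u\<^sub>j Z\<^sub>j(y)\<close> of the vector fields \<open>Z\<^sub>j\<close>. It is
extended to all \<open>u\<close> so as to be close to the identity where \<open>Z\<^sub>j(y)\<close> is close to the \<open>j\<close>-th
standard basis vector.\<close>

definition frame_map ::
    "nat \<Rightarrow> ('n \<Rightarrow> 'a \<Rightarrow> real ^ 'n::{finite,linorder}) \<Rightarrow> 'a \<Rightarrow> real ^ 'n::{finite,linorder} \<Rightarrow> real ^ 'n::{finite,linorder}" where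
  "frame_map p Z y u = u + (\<Sum>j\<in>first_coords p. u $ j *\<^sub>R (Z j y - axis j 1))"

lemma linear_frame_map: "linear (frame_map p Z y)"
  by (rule linearI) (simp_all add: frame_map_def sum.distrib scaleR_add_left scaleR_add_right
      scaleR_sum_right add_ac)

lemma sum_axis_horizontal:
  fixes u :: "real ^ 'n::{finite,linorder}"
  assumes "u \<in> horizontal p"
  shows "(\<Sum>j\<in>first_coords p. u $ j *\<^sub>R axis j 1) = u"
proof -
  have "(\<Sum>j\<in>first_coords p. u $ j *\<^sub>R axis j (1::real)) $ i = u $ i" for i
  proof -
    have "(\<Sum>j\<in>first_coords p. u $ j *\<^sub>R axis j (1::real)) $ i = (\<Sum>j\<in>first_coords p. if j = i then u $ j else 0)"
      unfolding sum_component by (rule sum.cong) (auto simp: axis_def)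
    also have "\<dots> = u $ i"
      using assms by (simp add: horizontal_def)
    finally show ?thesis .
  qed
  then show ?thesis by (simp add: vec_eq_iff)
qed

lemma frame_map_horizontal:
  assumes "u \<in> horizontal p"
  shows "frame_map p Z y u = (\<Sum>j\<in>first_coords p. u $ j *\<^sub>R Z j y)"
  using sum_axis_horizontal[OF assms]
  by (simp add: frame_map_def scaleR_diff_right sum_subtractf)

lemma norm_frame_map_diff:
  "norm (frame_map p Z y u - u) \<le> norm u * (\<Sum>j\<in>first_coords p. norm (Z j y - axis j 1))"
proof -
  have "norm (\<Sum>j\<in>first_coords p. u $ j *\<^sub>R (Z j y - axis j 1)) \<le>
      (\<Sum>j\<in>first_coords p. norm u * norm (Z j y - axis j 1))"
    by (rule sum_norm_le) (simp add: component_le_norm_cart mult_right_mono)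
  then show ?thesis by (simp add: frame_map_def sum_distrib_left)
qed

lemma frame_map_adapted:
  assumes "\<And>j. j \<in> first_coords p \<Longrightarrow> Z j y = axis j 1"
  shows "frame_map p Z y u = u"
  using assms by (simp add: frame_map_def)

lemma smooth_at_frame_map:
  assumes "\<And>j. smooth_at (Z j) x"
  shows "smooth_at (\<lambda>y. frame_map p Z y u) x"
  unfolding frame_map_def
  by (intro smooth_at_add smooth_at_const smooth_at_sum smooth_at_scaleR smooth_at_diff assms)

text \<open>With the frame normalised at the origin its vertical components vanish there, which is what the
computation of the group law rests on.\<close>

locale adapted_frame = smooth_distribution A H p
  for A :: "('m, real ^ 'n::{finite,linorder}) chart set" and H :: "(real \<Rightarrow> 'm) set set" and p :: nat +
  fixes m :: 'm and U :: "'m set" and \<phi> :: "'m \<Rightarrow> real ^ 'n::{finite,linorder}"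
    and Z :: "'n \<Rightarrow> real ^ 'n::{finite,linorder} \<Rightarrow> real ^ 'n::{finite,linorder}"
  assumes chart: "H_chart A H p m (U, \<phi>)"
    and smooth_Z: "smooth_at (Z j) 0"
    and Z_0: "j \<in> first_coords p \<Longrightarrow> Z j 0 = axis j 1"
    and frame: "eventually (\<lambda>y. tangent_coord \<phi> ` fibre A H (inv_into U \<phi> y) = frame_map p Z y ` horizontal p) (nhds 0)"

context smooth_distribution
begin

text \<open>At the origin the given local frame spans the horizontal subspace, so constant combinations of
it take the standard basis vectors as values there. They still span the fibres nearby: the frame
map is injective as long as it is close to the identity, and the fibres have the same dimension
as the horizontal subspace.\<close>

lemma ex_adapted_frame:
  assumes chart: "H_chart A H p m (U, \<phi>)"
  obtains Z where "adapted_frame A H p m U \<phi> Z"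
proof -
  note ch = H_chartD[OF chart]
  have m: "m \<in> points A" by (rule coord_chart_points[OF ch(1,2)])
  have "\<forall>m\<in>points A. \<exists>W X. openin (manifold_topology A) W \<and> m \<in> W \<and>
        (\<forall>i<p. smooth_vector_field A W (X i)) \<and>
        (\<forall>x\<in>W. \<forall>U \<phi>. coord_chart A (U, \<phi>) \<and> x \<in> U \<longrightarrow>
           tangent_coord \<phi> ` fibre A H x = span {tangent_coord \<phi> (X i x) | i. i < p})"
    using distribution unfolding distribution_def by (elim conjE)
  from bspec[OF this m] obtain W X where W: "openin (manifold_topology A) W" "m \<in> W"
    and X: "\<forall>i<p. smooth_vector_field A W (X i)"
    and span: "\<forall>x\<in>W. \<forall>U \<phi>. coord_chart A (U, \<phi>) \<and> x \<in> U \<longrightarrow>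
           tangent_coord \<phi> ` fibre A H x = span {tangent_coord \<phi> (X i x) | i. i < p}"
    by (elim exE conjE) (rule that)
  define Y where "Y = (\<lambda>i y. tangent_coord \<phi> (X i (inv_into U \<phi> y)))"
  have im: "eventually (\<lambda>y. y \<in> \<phi> ` U) (nhds 0)"
    using coord_chart_eventually_image[OF ch(1,2)] ch(3) by simp
  have inW: "eventually (\<lambda>y. inv_into U \<phi> y \<in> W) (nhds 0)"
    using eventually_chart_openin[OF atlas ch(1,2) W] ch(3) by simp
  have fibre_span: "tangent_coord \<phi> ` fibre A H (inv_into U \<phi> y) = span ((\<lambda>i. Y i y) ` {..<p})"
    if "y \<in> \<phi> ` U" "inv_into U \<phi> y \<in> W" for y
  proof -
    have "coord_chart A (U, \<phi>) \<and> inv_into U \<phi> y \<in> U" using ch(1) that(1) by (simp add: inv_into_into)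
    from bspec[OF span that(2), THEN spec, THEN spec, THEN mp, OF this]
    have "tangent_coord \<phi> ` fibre A H (inv_into U \<phi> y) = span {Y i y | i. i < p}"
      unfolding Y_def .
    moreover have "{Y i y | i. i < p} = (\<lambda>i. Y i y) ` {..<p}" by blast
    ultimately show ?thesis by simp
  qed
  have o: "open (\<phi> ` (U \<inter> W))"
  proof -
    have "eventually (\<lambda>y. y \<in> \<phi> ` (U \<inter> W)) (nhds (\<phi> x))" if x: "x \<in> U" "x \<in> W" for x
      using coord_chart_eventually_image[OF ch(1) x(1)] eventually_chart_openin[OF atlas ch(1) x(1) W(1) x(2)]
    proof eventually_elim
      case (elim y)
      then have "y = \<phi> (inv_into U \<phi> y)" "inv_into U \<phi> y \<in> U"
        by (simp_all add: f_inv_into_f inv_into_into)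
      with elim(2) show ?case by blast
    qed
    then show ?thesis unfolding open_eventually_iff by blast
  qed
  have 0: "0 \<in> \<phi> ` (U \<inter> W)" using imageI[of m "U \<inter> W" \<phi>] ch(2,3) W(2) by simp
  have smY: "smooth_at (Y i) 0" if "i < p" for i
  proof -
    have "smooth_vector_field A W (X i)" using X that by blast
    then have "\<forall>U \<phi>. coord_chart A (U, \<phi>) \<longrightarrow>
        smooth_on (\<phi> ` (U \<inter> W)) (\<lambda>y. tangent_coord \<phi> (X i (inv_into U \<phi> y)))"
      unfolding smooth_vector_field_def by (elim conjE)
    from this[THEN spec, THEN spec, THEN mp, OF ch(1)]
    have "smooth_on (\<phi> ` (U \<inter> W)) (Y i)" unfolding Y_def .
    then show ?thesis by (rule smooth_atI[OF o 0])
  qed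
  have inv0: "inv_into U \<phi> 0 = m" using coord_chart_inv[OF ch(1,2)] ch(3) by simp
  have span0: "horizontal p = range (\<lambda>c. \<Sum>i<p. c i *\<^sub>R Y i 0)"
  proof -
    have "0 \<in> \<phi> ` U" using 0 by blast
    from fibre_span[OF this] show ?thesis
      using W(2) ch(4) by (simp add: inv0 span_image_eq_range_sum)
  qed
  have "\<forall>j\<in>first_coords p. \<exists>c. axis (j::'n) (1::real) = (\<Sum>i<p. c i *\<^sub>R Y i 0)"
  proof
    fix j :: 'n assume that: "j \<in> first_coords p"
    have "axis j (1::real) \<in> horizontal p"
      unfolding span_first_coords[symmetric] using that by (intro span_base) blast
    then show "\<exists>c. axis j (1::real) = (\<Sum>i<p. c i *\<^sub>R Y i 0)" unfolding span0 by (elim rangeE) (rule exI)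
  qed
  from bchoice[OF this] obtain c where
    c': "\<forall>j\<in>first_coords p. axis (j::'n) (1::real) = (\<Sum>i<p. c j i *\<^sub>R Y i 0)"
    by (elim exE) (rule that)
  note c = bspec[OF c']
  define Z where "Z = (\<lambda>j y. \<Sum>i<p. c j i *\<^sub>R Y i y)"
  have smZ: "smooth_at (Z j) 0" for j
    unfolding Z_def by (intro smooth_at_sum smooth_at_scaleR smooth_at_const) (simp add: smY)
  have Z0: "Z j 0 = axis j 1" if "j \<in> first_coords p" for j
    using c[OF that] by (simp add: Z_def)
  let ?K = "\<lambda>y. \<Sum>j\<in>first_coords p. norm (Z j y - axis j 1)"
  have "isCont ?K 0"
    by (intro continuous_intros smooth_at_imp_isCont smZ)
  moreover have K0: "?K 0 = 0" by (rule sum.neutral) (simp add: Z0)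
  have "eventually (\<lambda>k. k < 1) (nhds (?K 0))"
    unfolding K0 using eventually_nhds_in_open[of "{..<1::real}" 0] by simp
  ultimately have "eventually (\<lambda>y. ?K y < 1) (nhds 0)"
    by (rule isCont_eventually_nhds)
  with im inW have "eventually (\<lambda>y. tangent_coord \<phi> ` fibre A H (inv_into U \<phi> y) = frame_map p Z y ` horizontal p) (nhds 0)"
  proof eventually_elim
    case (elim y)
    let ?H = "tangent_coord \<phi> ` fibre A H (inv_into U \<phi> y)"
    have yU: "inv_into U \<phi> y \<in> U" using elim(1) by (rule inv_into_into)
    note H = fibre_subspace[OF ch(1) yU]
    have ZH: "Z j y \<in> ?H" for j
      unfolding fibre_span[OF elim(1,2)] Z_def by (intro span_sum span_scale span_base imageI)
    have sub: "frame_map p Z y ` horizontal p \<subseteq> ?H"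
    proof
      fix v assume "v \<in> frame_map p Z y ` horizontal p"
      then obtain u where "u \<in> horizontal p" "v = frame_map p Z y u" by blast
      show "v \<in> ?H"
        unfolding \<open>v = frame_map p Z y u\<close> frame_map_horizontal[OF \<open>u \<in> horizontal p\<close>]
        by (intro subspace_sum[OF H(1)] subspace_scale[OF H(1)] ZH)
    qed
    have "\<forall>u. frame_map p Z y u = 0 \<longrightarrow> u = 0"
    proof (intro allI impI, rule ccontr)
      fix u assume that: "frame_map p Z y u = 0"
      assume "u \<noteq> 0"
      then have "norm u * ?K y < norm u" using elim(3) by simp
      with norm_frame_map_diff[of p Z y u] that show False by simp
    qed
    then have inj: "inj (frame_map p Z y)"
      unfolding linear_injective_0[OF linear_frame_map] .
    have "dim (frame_map p Z y ` horizontal p) = dim (horizontal p :: (real ^ 'n::{finite,linorder}) set)"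
      by (rule dim_image_eq[OF linear_frame_map inj_on_subset[OF inj subset_UNIV]])
    then have "dim ?H \<le> dim (frame_map p Z y ` horizontal p)"
      using H(2) dim_horizontal[OF rank_le] by simp
    from subspace_dim_equal[OF linear_subspace_image[OF linear_frame_map subspace_horizontal] H(1) sub this]
    show ?case by simp
  qed
  then have "adapted_frame A H p m U \<phi> Z"
    by (intro adapted_frame.intro adapted_frame_axioms.intro smooth_distribution_axioms chart smZ Z0)
  then show thesis by (rule that)
qed

end

context adapted_frame
begin

lemmas U = H_chartD[OF chart]

lemma inv_0: "inv_into U \<phi> 0 = m"
  using coord_chart_inv[OF U(1,2)] U(3) by simp

lemma eventually_image: "eventually (\<lambda>y. y \<in> \<phi> ` U) (nhds 0)"
  using coord_chart_eventually_image[OF U(1,2)] U(3) by simp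

definition section_near :: "(real ^ 'n::{finite,linorder} \<Rightarrow> real ^ 'n::{finite,linorder}) \<Rightarrow> bool" where
  "section_near X \<longleftrightarrow> smooth_at X 0 \<and>
     eventually (\<lambda>y. X y \<in> tangent_coord \<phi> ` fibre A H (inv_into U \<phi> y)) (nhds 0)"

text \<open>The reason why the product of arrows is well defined: in vertical directions the derivative of
a section \<open>X\<close> of \<open>H\<close> depends on no more than the value of \<open>X\<close> at the origin. Write
\<open>X = \<Sum> u\<^sub>j Z\<^sub>j\<close>. Since \<open>Z\<^sub>j\<close> has no vertical component at the origin, the vertical part of the
difference quotient of \<open>X\<close> is the combination with coefficients \<open>u\<^sub>j\<close> of the difference
quotients of the \<open>Z\<^sub>j\<close>, and for its limit it suffices that \<open>u\<^sub>j\<close> is continuous at the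
origin.\<close>

lemma derivative_of_section:
  assumes X: "section_near X" and i: "i \<notin> first_coords p"
  shows "frechet_derivative X (at 0) w $ i =
    (\<Sum>j\<in>first_coords p. X 0 $ j * frechet_derivative (Z j) (at 0) w $ i)"
proof -
  have smX: "smooth_at X 0" using X by (simp add: section_near_def)
  let ?P = "\<lambda>y u. u \<in> horizontal p \<and> X y = frame_map p Z y u"
  define u where "u = (\<lambda>y. SOME u. ?P y u)"
  let ?K = "\<lambda>y. \<Sum>j\<in>first_coords p. norm (Z j y - axis j 1)"
  have u: "eventually (\<lambda>y. ?P y (u y)) (nhds 0)"
    using frame X[unfolded section_near_def, THEN conjunct2]
  proof eventually_elim
    case (elim y)
    then have "\<exists>u. ?P y u" by auto
    then show ?case unfolding u_def by (rule someI_ex)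
  qed
  have K: "(?K \<longlongrightarrow> 0) (nhds 0)"
  proof -
    have "isCont ?K 0" by (intro continuous_intros smooth_at_imp_isCont smooth_Z)
    from isCont_tendsto_nhds[OF this] show ?thesis by (simp add: Z_0)
  qed
  have Xlim: "(X \<longlongrightarrow> X 0) (nhds 0)"
    by (rule isCont_tendsto_nhds[OF smooth_at_imp_isCont[OF smX]])
  \<comment> \<open>Continuity of u at the origin: X is there close to u because the frame map is close to the identity.\<close>
  have "eventually (\<lambda>y. norm (X y - u y) \<le> 2 * norm (X y) * ?K y) (nhds 0)"
    using u order_tendstoD(2)[OF K, of "1/2", simplified]
  proof eventually_elim
    case (elim y)
    have b: "norm (X y - u y) \<le> norm (u y) * ?K y"
      using norm_frame_map_diff[of p Z y "u y"] elim(1) by simp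
    also have "\<dots> \<le> norm (u y) * (1/2)" using elim(2) by (intro mult_left_mono) simp_all
    finally have "norm (u y) \<le> 2 * norm (X y)"
      using norm_triangle_ineq2[of "u y" "X y"] by (simp add: norm_minus_commute)
    then have "norm (u y) * ?K y \<le> 2 * norm (X y) * ?K y"
      by (intro mult_right_mono sum_nonneg) simp_all
    with b show ?case by linarith
  qed
  moreover have "((\<lambda>y. 2 * norm (X y) * ?K y) \<longlongrightarrow> 0) (nhds 0)"
    using tendsto_mult[OF tendsto_mult[OF tendsto_const[of 2] tendsto_norm[OF Xlim]] K] by simp
  ultimately have "((\<lambda>y. X y - u y) \<longlongrightarrow> 0) (nhds 0)"
    by (rule Lim_null_comparison)
  from tendsto_diff[OF Xlim this] have ulim: "(u \<longlongrightarrow> X 0) (nhds 0)" by simp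
  have X0: "X 0 \<in> horizontal p"
  proof -
    have "?P 0 (u 0)" using eventually_nhds_x_imp_x[OF u] .
    then show ?thesis using frame_map_adapted[of p Z 0 "u 0", OF Z_0] by simp
  qed
  have line: "((\<lambda>s. s *\<^sub>R w) \<longlongrightarrow> 0) (at (0::real))"
    by (rule tendsto_eq_rhs[OF tendsto_scaleR[OF tendsto_ident_at tendsto_const]]) simp
  have quot: "((\<lambda>s. f (s *\<^sub>R w) $ i / s) \<longlongrightarrow> frechet_derivative f (at 0) w $ i) (at 0)"
    if f: "smooth_at f 0" "f 0 $ i = 0" for f :: "real ^ 'n::{finite,linorder} \<Rightarrow> real ^ 'n::{finite,linorder}"
  proof -
    have "smooth_at (\<lambda>y. f y $ i) (0 + 0 *\<^sub>R w)"
      using smooth_at_vec_nth[OF f(1), of i] by simp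
    from has_real_derivative_along_line[OF this]
    have "((\<lambda>s. f (s *\<^sub>R w) $ i) has_real_derivative frechet_derivative (\<lambda>y. f y $ i) (at 0) w) (at 0)"
      by simp
    then show ?thesis
      by (simp add: DERIV_def f(2) frechet_derivative_bounded_linear_compose[OF bounded_linear_vec_nth f(1)])
  qed
  have Xi: "X 0 $ i = 0" using X0 i by (simp add: horizontal_def)
  have Zi: "Z j 0 $ i = 0" if "j \<in> first_coords p" for j
    using Z_0[OF that] that i by (auto simp: axis_def)
  have "eventually (\<lambda>s. ?P (s *\<^sub>R w) (u (s *\<^sub>R w))) (at (0::real))"
    by (rule eventually_compose_filterlim[OF u line])
  then have "eventually (\<lambda>s. (\<Sum>j\<in>first_coords p. u (s *\<^sub>R w) $ j * (Z j (s *\<^sub>R w) $ i / s)) = X (s *\<^sub>R w) $ i / s) (at 0)"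
    by eventually_elim (simp add: frame_map_horizontal sum_component sum_divide_distrib)
  moreover have "((\<lambda>s. \<Sum>j\<in>first_coords p. u (s *\<^sub>R w) $ j * (Z j (s *\<^sub>R w) $ i / s)) \<longlongrightarrow>
      (\<Sum>j\<in>first_coords p. X 0 $ j * frechet_derivative (Z j) (at 0) w $ i)) (at 0)"
    by (intro tendsto_sum tendsto_mult tendsto_vec_nth quot smooth_Z Zi filterlim_compose[OF ulim line])
  ultimately have "((\<lambda>s. X (s *\<^sub>R w) $ i / s) \<longlongrightarrow>
      (\<Sum>j\<in>first_coords p. X 0 $ j * frechet_derivative (Z j) (at 0) w $ i)) (at 0)"
    by (rule Lim_transform_eventually[rotated])
  from tendsto_unique[OF _ quot[OF smX Xi] this] show ?thesis by simp
qed

subsection \<open>The group law\<close>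

text \<open>The bilinear correction of the group law: the vertical part of the derivative, in direction of
the second argument, of a section of \<open>H\<close> whose value at the origin is the horizontal part of the
first argument. Up to sign, its antisymmetrisation is the Levi bracket of the distribution.\<close>

definition bracket :: "real ^ 'n::{finite,linorder} \<Rightarrow> real ^ 'n::{finite,linorder} \<Rightarrow> real ^ 'n::{finite,linorder}" where
  "bracket x y = vertical_part p
     (\<Sum>j\<in>first_coords p. x $ j *\<^sub>R frechet_derivative (Z j) (at 0) (horizontal_part p y))"

definition taylor_mult :: "real ^ 'n::{finite,linorder} \<Rightarrow> real ^ 'n::{finite,linorder} \<Rightarrow> real ^ 'n::{finite,linorder}" where
  "taylor_mult x y = x + y + bracket x y"

lemma bilinear_bracket: "bilinear bracket"
proof -
  note lin = linear_add[OF bounded_linear.linear[OF frechet_derivative_bounded_linear[OF smooth_Z]]]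
    linear_scale[OF bounded_linear.linear[OF frechet_derivative_bounded_linear[OF smooth_Z]]]
    linear_add[OF linear_horizontal_part] linear_scale[OF linear_horizontal_part]
  note lin' = linear_add[OF linear_vertical_part, symmetric] linear_scale[OF linear_vertical_part, symmetric]
  show ?thesis
    unfolding bilinear_def bracket_def
    by (intro conjI allI linearI; simp only: lin lin' vector_add_component vector_scaleR_component
        scaleR_add_left scaleR_add_right sum.distrib scaleR_sum_right scaleR_scaleR real_scaleR_def)
      (simp_all add: mult.commute)
qed

lemma bracket_parts:
  "bracket (horizontal_part p x) y = bracket x y" "bracket x (horizontal_part p y) = bracket x y"
  "bracket (vertical_part p x) y = 0" "bracket x (vertical_part p y) = 0"
proof -
  have nth: "horizontal_part p x $ j = x $ j" if "j \<in> first_coords p" for j and x :: "real ^ 'n::{finite,linorder}"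
    using that by (simp add: horizontal_part_def)
  show h: "bracket (horizontal_part p x) y = bracket x y" "bracket x (horizontal_part p y) = bracket x y" for x y
    by (simp_all add: bracket_def nth)
  show "bracket (vertical_part p x) y = 0" "bracket x (vertical_part p y) = 0"
    using h(1)[of "vertical_part p x" y] h(2)[of x "vertical_part p y"]
    by (simp_all add: bilinear_lzero[OF bilinear_bracket] bilinear_rzero[OF bilinear_bracket])
qed

text \<open>The bracket takes vertical values and ignores the vertical parts of its arguments, so iterated
brackets vanish. This gives associativity of the product and the simple form of inverses.\<close>

lemma bracket_bracket:
  "bracket (bracket x y) z = 0" "bracket x (bracket y z) = 0" "horizontal_part p (bracket x y) = 0"
proof -
  have v: "bracket x y = vertical_part p (bracket x y)" for x y by (simp add: bracket_def)
  show "bracket (bracket x y) z = 0" using bracket_parts(3)[of "bracket x y" z] by (simp only: v[symmetric])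
  show "bracket x (bracket y z) = 0"
    using bracket_parts(4)[of x "bracket y z"] by (simp only: v[symmetric])
  show "horizontal_part p (bracket x y) = 0" by (subst v) simp
qed

lemma taylor_mult_assoc: "taylor_mult (taylor_mult x y) z = taylor_mult x (taylor_mult y z)"
  by (simp add: taylor_mult_def bilinear_ladd[OF bilinear_bracket] bilinear_radd[OF bilinear_bracket] bracket_bracket)

lemma taylor_mult_0: "taylor_mult 0 x = x" "taylor_mult x 0 = x"
  by (simp_all add: taylor_mult_def bilinear_lzero[OF bilinear_bracket] bilinear_rzero[OF bilinear_bracket])

definition taylor_inverse :: "real ^ 'n::{finite,linorder} \<Rightarrow> real ^ 'n::{finite,linorder}" where
  "taylor_inverse x = - x + bracket x x"

lemma taylor_mult_inverse: "taylor_mult (taylor_inverse x) x = 0"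
  by (simp add: taylor_mult_def taylor_inverse_def bilinear_ladd[OF bilinear_bracket]
      bilinear_lneg[OF bilinear_bracket] bilinear_lsub[OF bilinear_bracket] bracket_bracket)

lemma smooth_taylor_mult: "smooth_at (\<lambda>z. taylor_mult (fst z) (snd z)) z"
proof -
  have "bounded_bilinear bracket"
    using bilinear_bracket by (simp add: bilinear_conv_bounded_bilinear)
  then show ?thesis
    unfolding taylor_mult_def
    by (intro smooth_at_add smooth_at_bilinear[of bracket] smooth_at_bounded_linear
        bounded_linear_fst bounded_linear_snd)
qed

lemma smooth_taylor_inverse: "smooth_at taylor_inverse x"
proof -
  have "bounded_bilinear bracket"
    using bilinear_bracket by (simp add: bilinear_conv_bounded_bilinear)
  then show ?thesis
    unfolding taylor_inverse_def
    by (intro smooth_at_add smooth_at_minus smooth_at_bilinear[of bracket] smooth_at_ident)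
qed

subsection \<open>Parabolic flows in the chart\<close>

text \<open>Only the values over the image of the chart matter, where \<open>inv_into\<close> inverts it.\<close>

definition flow_in_chart :: "('m \<times> real \<Rightarrow> 'm) \<Rightarrow> (real ^ 'n::{finite,linorder}) \<times> real \<Rightarrow> real ^ 'n::{finite,linorder}" where
  "flow_in_chart \<Phi> z = \<phi> (\<Phi> (inv_into U \<phi> (fst z), snd z))"

definition generator :: "('m \<times> real \<Rightarrow> 'm) \<Rightarrow> real ^ 'n::{finite,linorder} \<Rightarrow> real ^ 'n::{finite,linorder}" where
  "generator \<Phi> y = frechet_derivative (flow_in_chart \<Phi>) (at (y, 0)) (0, 1)"

lemma flow_in_chart_local:
  assumes F: "local_flow A (V, \<Phi>)" and x: "(x, 0) \<in> V" "x \<in> U"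
  shows "smooth_at (flow_in_chart \<Phi>) (\<phi> x, 0)"
    and "eventually (\<lambda>z. (inv_into U \<phi> (fst z), snd z) \<in> V \<and> \<Phi> (inv_into U \<phi> (fst z), snd z) \<in> U) (nhds (\<phi> x, 0))"
    and "\<Phi> (x, 0) = x"
proof -
  have F': "smooth_map (prod_atlas A real_atlas) A V \<Phi>" "\<And>x. (x, 0) \<in> V \<Longrightarrow> \<Phi> (x, 0) = x"
    using F by (simp_all add: local_flow_def)
  show \<Phi>x: "\<Phi> (x, 0) = x" by (rule F'(2)[OF x(1)])
  have xU: "(x, 0) \<in> U \<times> (UNIV :: real set)" "\<Phi> (x, 0) \<in> U" using x(2) \<Phi>x by simp_all
  note sm = smooth_mapD[OF smooth_atlas_prod[OF atlas smooth_atlas_real] atlas F'(1) x(1)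
      coord_chart_prod[OF atlas smooth_atlas_real U(1) coord_chart_real] xU(1) U(1) xU(2)]
  have ev: "eventually (\<lambda>z. inv_into (U \<times> UNIV) (map_prod \<phi> id) z = (inv_into U \<phi> (fst z), snd z)) (nhds (\<phi> x, 0::real))"
    using eventually_inv_into_map_prod[OF coord_chart_is_chart[OF U(1)] coord_chart_is_chart[OF coord_chart_real] x(2) UNIV_I, of 0]
    by (simp add: inv_id[unfolded id_def] id_def)
  have pt: "map_prod \<phi> id (x, 0::real) = (\<phi> x, 0)" by simp
  have "eventually (\<lambda>z. \<phi> (\<Phi> (inv_into (U \<times> UNIV) (map_prod \<phi> id) z)) = flow_in_chart \<Phi> z) (nhds (\<phi> x, 0))"
    using ev by eventually_elim (simp add: flow_in_chart_def)
  with sm(1) show "smooth_at (flow_in_chart \<Phi>) (\<phi> x, 0)"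
    unfolding pt by (rule smooth_at_cong)
  show "eventually (\<lambda>z. (inv_into U \<phi> (fst z), snd z) \<in> V \<and> \<Phi> (inv_into U \<phi> (fst z), snd z) \<in> U) (nhds (\<phi> x, 0))"
    using ev sm(2,3)[unfolded pt] by eventually_elim simp
qed

lemma flow_line_in_chart:
  assumes F: "local_flow A (V, \<Phi>)" and x: "(x, 0) \<in> V" "x \<in> U"
  shows "curve_at A x (flow_line (V, \<Phi>) x)"
    and "velocity \<phi> (flow_line (V, \<Phi>) x) = generator \<Phi> (\<phi> x)"
    and "acceleration \<phi> (flow_line (V, \<Phi>) x) = second_derivative (\<lambda>t. flow_in_chart \<Phi> (\<phi> x, t)) 0 1 1"
    and "\<phi> (flow_line (V, \<Phi>) x t) = flow_in_chart \<Phi> (\<phi> x, t)"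
proof -
  note loc = flow_in_chart_local[OF F x]
  have eq: "\<phi> (flow_line (V, \<Phi>) x t) = flow_in_chart \<Phi> (\<phi> x, t)" for t
    by (simp add: flow_line_def flow_in_chart_def coord_chart_inv[OF U(1) x(2)])
  then show "\<phi> (flow_line (V, \<Phi>) x t) = flow_in_chart \<Phi> (\<phi> x, t)" .
  have line: "smooth_at (\<lambda>t. (\<phi> x, t)) (0::real)"
    by (intro smooth_at_Pair smooth_at_ident smooth_at_const)
  have sm: "smooth_at (\<lambda>t. flow_in_chart \<Phi> (\<phi> x, t)) 0"
    by (rule smooth_at_compose[OF line loc(1)])
  have "eventually (\<lambda>t. \<phi> (flow_line (V, \<Phi>) x t) = flow_in_chart \<Phi> (\<phi> x, t)) (nhds 0)"
    by (simp add: eq)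
  note jets = velocity_cong[of \<phi> "flow_line (V, \<Phi>) x" "\<lambda>t. flow_in_chart \<Phi> (\<phi> x, t)", OF this sm]
  have "eventually (\<lambda>t. (inv_into U \<phi> (fst (\<phi> x, t)), snd (\<phi> x, t)) \<in> V \<and>
      \<Phi> (inv_into U \<phi> (fst (\<phi> x, t)), snd (\<phi> x, t)) \<in> U) (nhds (0::real))"
    by (rule isCont_eventually_nhds[OF smooth_at_imp_isCont[OF line] loc(2)])
  then have "eventually (\<lambda>t. flow_line (V, \<Phi>) x t \<in> U) (nhds 0)"
    by eventually_elim (simp add: flow_line_def coord_chart_inv[OF U(1) x(2)])
  then show "curve_at A x (flow_line (V, \<Phi>) x)"
    unfolding curve_at_iff[OF atlas U(1) x(2)] using jets(1) loc(3) by (simp add: flow_line_def)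
  have "frechet_derivative (\<lambda>t. (\<phi> x, t)) (at (0::real)) 1 = (0, 1)"
    by (rule frechet_derivative_apply[OF has_derivative_Pair[OF has_derivative_const has_derivative_ident]])
  then show "velocity \<phi> (flow_line (V, \<Phi>) x) = generator \<Phi> (\<phi> x)"
    using jets(2) frechet_derivative_compose_smooth_at[OF line loc(1), of 1]
    by (simp add: generator_def)
  show "acceleration \<phi> (flow_line (V, \<Phi>) x) = second_derivative (\<lambda>t. flow_in_chart \<Phi> (\<phi> x, t)) 0 1 1"
    by (rule jets(3))
qed

lemma flow_near:
  assumes F: "local_flow A (V, \<Phi>)" and m: "(m, 0) \<in> V"
  shows "eventually (\<lambda>y. y \<in> \<phi> ` U \<and> (inv_into U \<phi> y, 0) \<in> V \<and> \<phi> (inv_into U \<phi> y) = y) (nhds 0)"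
proof -
  have "isCont (\<lambda>y. (y, 0::real)) (0 :: real ^ 'n::{finite,linorder})" by (intro continuous_intros)
  from isCont_eventually_nhds[OF this flow_in_chart_local(2)[OF F m U(2), unfolded U(3)]]
  have "eventually (\<lambda>y. (inv_into U \<phi> y, 0) \<in> V) (nhds 0)"
    by eventually_elim simp
  with eventually_image show ?thesis
    by eventually_elim (simp add: f_inv_into_f)
qed

lemma generator_section:
  assumes F: "parabolic_flow A H (V, \<Phi>)" and m: "(m, 0) \<in> V"
  shows "eventually (\<lambda>y. generator \<Phi> y \<in> tangent_coord \<phi> ` fibre A H (inv_into U \<phi> y)) (nhds 0)"
proof -
  have lf: "local_flow A (V, \<Phi>)" and
    tan: "\<And>x. (x, 0) \<in> V \<Longrightarrow> tangent_vector A x (flow_line (V, \<Phi>) x) \<in> H"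
    using F by (simp_all add: parabolic_flow_def defined_near_def)
  show ?thesis
    using flow_near[OF lf m]
  proof eventually_elim
    case (elim y)
    let ?x = "inv_into U \<phi> y"
    have x: "?x \<in> U" using elim by (simp add: inv_into_into)
    have xV: "(?x, 0) \<in> V" using elim by simp
    show ?case
      using tangent_vector_in_iff[OF atlas U(1) x flow_line_in_chart(1)[OF lf xV x], of H]
        tan[OF xV] flow_line_in_chart(2)[OF lf xV x] elim by simp
  qed
qed

lemma flow_in_chart_0:
  assumes F: "local_flow A (V, \<Phi>)" and m: "(m, 0) \<in> V"
  shows "eventually (\<lambda>y. flow_in_chart \<Phi> (y, 0) = y) (nhds 0)"
  using flow_near[OF F m]
proof eventually_elim
  case (elim y)
  then have "\<Phi> (inv_into U \<phi> y, 0) = inv_into U \<phi> y"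
    using flow_in_chart_local(3)[OF F, of "inv_into U \<phi> y"] by (simp add: inv_into_into)
  then show ?case using elim by (simp add: flow_in_chart_def)
qed

lemma tangent_flow_line:
  assumes F: "parabolic_flow A H F" and m: "defined_near F m"
  shows "tangent_curve_at A H m (flow_line F m)"
proof -
  obtain V \<Phi> where VF: "F = (V, \<Phi>)" by fastforce
  have "local_flow A (V, \<Phi>)" "(m, 0) \<in> V" "tangent_vector A m (flow_line F m) \<in> H"
    using F m by (simp_all add: VF parabolic_flow_def defined_near_def)
  then show ?thesis
    unfolding tangent_curve_at_def using flow_line_in_chart(1)[OF _ _ U(2)] by (simp add: VF)
qed

text \<open>In the chart the composed flow line is \<open>f (g t, t)\<close>, and
\<open>second_derivative_flow_composition\<close> gives its velocity and acceleration. The vertical part of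
the interaction term is the bracket by \<open>derivative_of_section\<close>.\<close>

lemma taylor_coord_flow_comp:
  assumes F: "parabolic_flow A H F" "defined_near F m" and G: "parabolic_flow A H G" "defined_near G m"
  shows "tangent_curve_at A H m (flow_line (flow_comp F G) m)"
    and "taylor_coord \<phi> (flow_line (flow_comp F G) m) =
      taylor_mult (taylor_coord \<phi> (flow_line F m)) (taylor_coord \<phi> (flow_line G m))"
proof -
  obtain V \<Phi> where VF: "F = (V, \<Phi>)" by fastforce
  obtain W \<Psi> where WG: "G = (W, \<Psi>)" by fastforce
  have lF: "local_flow A (V, \<Phi>)" "(m, 0) \<in> V" and lG: "local_flow A (W, \<Psi>)" "(m, 0) \<in> W"
    using F G by (simp_all add: VF WG parabolic_flow_def defined_near_def)
  note locF = flow_in_chart_local[OF lF U(2), unfolded U(3)]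
    and locG = flow_in_chart_local[OF lG U(2), unfolded U(3)]
    and lineF = flow_line_in_chart[OF lF U(2), unfolded U(3)]
    and lineG = flow_line_in_chart[OF lG U(2), unfolded U(3)]
  define f where "f = flow_in_chart \<Phi>"
  define g where "g = (\<lambda>t. flow_in_chart \<Psi> (0, t))"
  have pair: "smooth_at (\<lambda>t. (0 :: real ^ 'n::{finite,linorder}, t)) (0::real)"
    by (intro smooth_at_Pair smooth_at_ident smooth_at_const)
  have g: "smooth_at g 0" unfolding g_def by (rule smooth_at_compose[OF pair locG(1)])
  have g0: "g 0 = 0" using eventually_nhds_x_imp_x[OF flow_in_chart_0[OF lG]] by (simp add: g_def)
  have f0: "eventually (\<lambda>y. f (y, 0) = y) (nhds 0)" unfolding f_def by (rule flow_in_chart_0[OF lF])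
  have f: "smooth_at f (0, 0)" unfolding f_def by (rule locF(1))
  note comp = second_derivative_flow_composition[OF f g g0 f0]
  have X: "(\<lambda>y. frechet_derivative f (at (y, 0)) (0, 1)) = generator \<Phi>"
    by (simp add: generator_def f_def fun_eq_iff)
  have X0: "frechet_derivative f (at (0, 0)) (0, 1) = generator \<Phi> 0"
    by (simp add: generator_def f_def)
  have sec: "section_near (generator \<Phi>)"
    unfolding section_near_def using comp(5)[unfolded X] generator_section[OF F(1)[unfolded VF] lF(2)] by blast
  let ?c = "flow_line (flow_comp F G) m"
  have c: "?c t = \<Phi> (\<Psi> (m, t), t)" for t
    by (simp add: flow_line_def flow_comp_def VF WG)
  have "eventually (\<lambda>t. \<Psi> (m, t) \<in> U) (nhds 0)"
    using isCont_eventually_nhds[OF smooth_at_imp_isCont[OF pair] locG(2)]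
    by eventually_elim (simp add: inv_0)
  then have inv_g: "eventually (\<lambda>t. inv_into U \<phi> (g t) = \<Psi> (m, t)) (nhds 0)"
    by eventually_elim (simp add: g_def flow_in_chart_def inv_0 coord_chart_inv[OF U(1)])
  then have eq: "eventually (\<lambda>t. \<phi> (?c t) = f (g t, t)) (nhds 0)"
    by eventually_elim (simp add: c f_def flow_in_chart_def)
  note jets = velocity_cong[of \<phi> ?c "\<lambda>t. f (g t, t)", OF eq comp(4)]
  have "isCont (\<lambda>t. (g t, t)) 0"
    by (intro smooth_at_imp_isCont smooth_at_Pair smooth_at_ident g)
  from isCont_eventually_nhds[OF this, unfolded g0, OF locF(2)] inv_g
  have "eventually (\<lambda>t. ?c t \<in> U) (nhds 0)"
    by eventually_elim (simp add: c)
  then have curve: "curve_at A m ?c"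
    unfolding curve_at_iff[OF atlas U(1,2)] using jets(1) locF(3) locG(3) by (simp add: c)
  have tF: "tangent_curve_at A H m (flow_line F m)" by (rule tangent_flow_line[OF F])
  have tG: "tangent_curve_at A H m (flow_line G m)" by (rule tangent_flow_line[OF G])
  have vF: "velocity \<phi> (flow_line F m) = generator \<Phi> 0" and
    aF: "acceleration \<phi> (flow_line F m) = second_derivative (\<lambda>t. f (0, t)) 0 1 1"
    using lineF(2,3) by (simp_all add: VF f_def)
  have vG: "velocity \<phi> (flow_line G m) = frechet_derivative g (at 0) 1" and
    aG: "acceleration \<phi> (flow_line G m) = second_derivative g 0 1 1"
  proof -
    have "eventually (\<lambda>t. \<phi> (flow_line G m t) = g t) (nhds 0)"
      using lineG(4) by (simp add: WG g_def)
    from velocity_cong(2,3)[of \<phi> "flow_line G m" g, OF this g]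
    show "velocity \<phi> (flow_line G m) = frechet_derivative g (at 0) 1"
      "acceleration \<phi> (flow_line G m) = second_derivative g 0 1 1" .
  qed
  have v: "velocity \<phi> ?c = velocity \<phi> (flow_line F m) + velocity \<phi> (flow_line G m)"
    using jets(2) comp(1) by (simp add: X0 vF vG)
  have a: "acceleration \<phi> ?c = acceleration \<phi> (flow_line G m) + acceleration \<phi> (flow_line F m) +
      2 *\<^sub>R frechet_derivative (generator \<Phi>) (at 0) (velocity \<phi> (flow_line G m))"
    using jets(3) comp(2)[unfolded X] by (simp add: aF aG vG)
  have hF: "velocity \<phi> (flow_line F m) \<in> horizontal p" and hG: "velocity \<phi> (flow_line G m) \<in> horizontal p"
    using tF tG unfolding tangent_curve_at_iff[OF chart] by blast+
  show "tangent_curve_at A H m ?c"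
    unfolding tangent_curve_at_iff[OF chart] v
    using curve subspace_add[OF subspace_horizontal hF hG] by blast
  let ?x = "taylor_coord \<phi> (flow_line F m)" and ?y = "taylor_coord \<phi> (flow_line G m)"
  have br: "vertical_part p (frechet_derivative (generator \<Phi>) (at 0) (velocity \<phi> (flow_line G m))) = bracket ?x ?y"
  proof -
    have "frechet_derivative (generator \<Phi>) (at 0) (velocity \<phi> (flow_line G m)) $ i =
        (\<Sum>j\<in>first_coords p. ?x $ j * frechet_derivative (Z j) (at 0) (horizontal_part p ?y) $ i)"
      if i: "i \<notin> first_coords p" for i
      unfolding derivative_of_section[OF sec i] vF[symmetric] taylor_coord_parts horizontal_part_eq[OF hG]
      by (rule sum.cong) (simp_all add: taylor_coord_def horizontal_part_def vertical_part_def)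
    then show ?thesis
      by (simp add: bracket_def vertical_part_def vec_eq_iff)
  qed
  show "taylor_coord \<phi> ?c = taylor_mult ?x ?y"
    unfolding taylor_mult_def br[symmetric] unfolding taylor_coord_def v a
    by (simp add: linear_add[OF linear_vertical_part] linear_add[OF linear_horizontal_part]
        linear_scale[OF linear_vertical_part] scaleR_add_right)
qed

end

section \<open>Parabolic flows with prescribed arrow\<close>

text \<open>The inverse function theorem \<open>smooth_on_inv_into\<close>, applied to the coordinate expression \<open>k\<close>,
supplies the smooth inverse; openness and smoothness are then carried back to the manifold.\<close>

lemma local_diffeo_chartI:
  fixes A :: "('m, real ^ 'n) chart set"
  assumes A: "smooth_atlas A" and U: "coord_chart A (U, \<phi>)"
    and S: "open S" "S \<subseteq> \<phi> ` U" and k: "smooth_on S k" "inj_on k S" "k ` S \<subseteq> \<phi> ` U"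
    and k': "\<And>y v. y \<in> S \<Longrightarrow> frechet_derivative k (at y) v = 0 \<Longrightarrow> v = 0"
    and D: "D = {x \<in> U. \<phi> x \<in> S}" and g: "\<And>x. x \<in> D \<Longrightarrow> g x = inv_into U \<phi> (k (\<phi> x))"
  shows "local_diffeo A D g"
proof -
  have ch: "inj_on \<phi> U" "open (\<phi> ` U)"
    using coord_chart_is_chart[OF U] by (simp_all add: is_chart_def)
  note kS = smooth_on_inv_into[OF S(1) k(1,2) k']
  have \<phi>inv: "\<phi> (inv_into U \<phi> y) = y" "inv_into U \<phi> y \<in> U" if "y \<in> \<phi> ` U" for y
    using that by (simp_all add: f_inv_into_f inv_into_into)
  have D_inv: "inv_into U \<phi> y \<in> D" if "y \<in> S" for y
    using that \<phi>inv[OF subsetD[OF S(2) that]] by (simp add: D)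
  have \<phi>g: "\<phi> (g x) = k (\<phi> x)" "g x \<in> U" if "x \<in> D" for x
  proof -
    have "\<phi> x \<in> S" using that by (simp add: D)
    then have "k (\<phi> x) \<in> \<phi> ` U" by (rule subsetD[OF k(3) imageI])
    from \<phi>inv[OF this] show "\<phi> (g x) = k (\<phi> x)" "g x \<in> U" by (simp_all only: g[OF that])
  qed
  have evS: "eventually (\<lambda>y. y \<in> S) (nhds y)" if "y \<in> S" for y
    using S(1) that by (rule eventually_nhds_in_open)
  have evkS: "eventually (\<lambda>y. y \<in> k ` S) (nhds y)" if "y \<in> k ` S" for y
    using kS(1) that by (rule eventually_nhds_in_open)
  have gD: "g ` D = inv_into U \<phi> ` (k ` S)"
  proof (intro equalityI subsetI)
    fix x assume "x \<in> g ` D"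
    then obtain w where w: "w \<in> D" "x = g w" by (elim imageE) (rule that)
    have "\<phi> w \<in> S" using w(1) by (simp add: D)
    then show "x \<in> inv_into U \<phi> ` (k ` S)" unfolding w(2) g[OF w(1)] by (intro imageI)
  next
    fix x assume "x \<in> inv_into U \<phi> ` (k ` S)"
    then obtain y where y: "y \<in> S" "x = inv_into U \<phi> (k y)" by (elim imageE) (simp add: that)
    have "g (inv_into U \<phi> y) = x"
      using g[OF D_inv[OF y(1)]] y(2) \<phi>inv(1)[OF subsetD[OF S(2) y(1)]] by simp
    then show "x \<in> g ` D" using imageI[OF D_inv[OF y(1)], of g] by simp
  qed
  have gD_inv: "inv_into U \<phi> z \<in> g ` D" if "z \<in> k ` S" for z
    unfolding gD by (rule imageI[OF that])
  have injg: "inj_on g D"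
  proof (rule inj_onI)
    fix x y assume xy: "x \<in> D" "y \<in> D" "g x = g y"
    then have "k (\<phi> x) = k (\<phi> y)" using \<phi>g(1)[of x] \<phi>g(1)[of y] by simp
    then have "\<phi> x = \<phi> y" by (rule inj_onD[OF k(2)]) (use xy(1,2) in \<open>simp_all add: D\<close>)
    then show "x = y" by (rule inj_onD[OF ch(1)]) (use xy(1,2) in \<open>simp_all add: D\<close>)
  qed
  have openD: "openin (manifold_topology A) D"
  proof (rule openin_manifold_topologyI[OF A])
    fix x assume x: "x \<in> D"
    then have "\<phi> x \<in> S" by (simp add: D)
    from evS[OF this] have "eventually (\<lambda>y. inv_into U \<phi> y \<in> D) (nhds (\<phi> x))"
      by eventually_elim (rule D_inv)
    then show "\<exists>U \<phi>. coord_chart A (U, \<phi>) \<and> x \<in> U \<and> eventually (\<lambda>y. inv_into U \<phi> y \<in> D) (nhds (\<phi> x))"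
      using U x unfolding D by (intro exI[of _ U] exI[of _ \<phi>]) simp
  qed
  have image: "x \<in> U \<and> \<phi> x \<in> k ` S" if "x \<in> g ` D" for x
  proof -
    obtain z where z: "z \<in> k ` S" "x = inv_into U \<phi> z"
      using \<open>x \<in> g ` D\<close> unfolding gD by (elim imageE[of _ "inv_into U \<phi>"]) (rule that)
    from \<phi>inv[OF subsetD[OF k(3) z(1)]] z(1) show ?thesis unfolding z(2) by simp
  qed
  have ev_image: "eventually (\<lambda>z. inv_into U \<phi> z \<in> g ` D) (nhds (\<phi> x))" if "x \<in> g ` D" for x
    using evkS[OF image[OF that, THEN conjunct2]] by eventually_elim (rule gD_inv)
  have openg: "openin (manifold_topology A) (g ` D)"
  proof (rule openin_manifold_topologyI[OF A])
    fix x assume x: "x \<in> g ` D"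
    show "\<exists>U \<phi>. coord_chart A (U, \<phi>) \<and> x \<in> U \<and> eventually (\<lambda>y. inv_into U \<phi> y \<in> g ` D) (nhds (\<phi> x))"
      using U image[OF x] ev_image[OF x] by (intro exI[of _ U] exI[of _ \<phi>]) simp
  qed
  have smg: "smooth_map A A D g"
  proof (rule smooth_mapI[OF A])
    fix x assume x: "x \<in> D"
    then have x': "x \<in> U" "\<phi> x \<in> S" unfolding D by simp_all
    have "eventually (\<lambda>y. k y = \<phi> (g (inv_into U \<phi> y)) \<and> inv_into U \<phi> y \<in> D \<and> g (inv_into U \<phi> y) \<in> U) (nhds (\<phi> x))"
      using evS[OF x'(2)]
    proof eventually_elim
      case (elim y)
      then show ?case using \<phi>g[OF D_inv[OF elim]] D_inv[OF elim] \<phi>inv(1)[OF subsetD[OF S(2) elim]] by simp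
    qed
    note ev = this[unfolded eventually_conj_iff]
    have "smooth_at (\<lambda>y. \<phi> (g (inv_into U \<phi> y))) (\<phi> x)"
      by (rule smooth_at_cong[OF smooth_atI[OF S(1) x'(2) k(1)] ev[THEN conjunct1]])
    then show "\<exists>U \<phi> V \<psi>. coord_chart A (U, \<phi>) \<and> coord_chart A (V, \<psi>) \<and> x \<in> U \<and> g x \<in> V \<and>
      smooth_at (\<lambda>y. \<psi> (g (inv_into U \<phi> y))) (\<phi> x) \<and>
      eventually (\<lambda>y. inv_into U \<phi> y \<in> D) (nhds (\<phi> x)) \<and>
      eventually (\<lambda>y. g (inv_into U \<phi> y) \<in> V) (nhds (\<phi> x))"
      using U x'(1) \<phi>g(2)[OF x] ev by (intro exI[of _ U] exI[of _ \<phi>]) simp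
  qed
  have sminv: "smooth_map A A (g ` D) (inv_into D g)"
  proof (rule smooth_mapI[OF A])
    fix x assume x: "x \<in> g ` D"
    note x' = image[OF x]
    have inv: "\<phi> (inv_into D g (inv_into U \<phi> z)) = inv_into S k z" if z: "z \<in> k ` S" for z
    proof -
      let ?w = "inv_into D g (inv_into U \<phi> z)"
      have w: "?w \<in> D" "g ?w = inv_into U \<phi> z"
        using gD_inv[OF z] by (simp_all add: inv_into_into f_inv_into_f)
      have "k (\<phi> ?w) = z" using \<phi>g(1)[OF w(1)] w(2) \<phi>inv(1)[OF subsetD[OF k(3) z]] by simp
      moreover have "\<phi> ?w \<in> S" using w(1) by (simp add: D)
      ultimately show ?thesis using inv_into_f_f[OF k(2), of "\<phi> ?w"] by simp
    qed
    have "eventually (\<lambda>z. inv_into S k z = \<phi> (inv_into D g (inv_into U \<phi> z))) (nhds (\<phi> x))"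
      using evkS[OF x'[THEN conjunct2]] by eventually_elim (simp add: inv)
    from smooth_at_cong[OF smooth_atI[OF kS(1) x'[THEN conjunct2] kS(2)] this]
    have sm: "smooth_at (\<lambda>z. \<phi> (inv_into D g (inv_into U \<phi> z))) (\<phi> x)" .
    have DU: "inv_into D g y \<in> U" if "y \<in> g ` D" for y
      using inv_into_into[OF that] by (simp add: D)
    have "eventually (\<lambda>z. inv_into D g (inv_into U \<phi> z) \<in> U) (nhds (\<phi> x))"
      using ev_image[OF x] by eventually_elim (rule DU)
    then show "\<exists>U \<phi> V \<psi>. coord_chart A (U, \<phi>) \<and> coord_chart A (V, \<psi>) \<and> x \<in> U \<and> inv_into D g x \<in> V \<and>
      smooth_at (\<lambda>y. \<psi> (inv_into D g (inv_into U \<phi> y))) (\<phi> x) \<and>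
      eventually (\<lambda>y. inv_into U \<phi> y \<in> g ` D) (nhds (\<phi> x)) \<and>
      eventually (\<lambda>y. inv_into D g (inv_into U \<phi> y) \<in> V) (nhds (\<phi> x))"
      using U x' DU[OF x] sm ev_image[OF x] by (intro exI[of _ U] exI[of _ \<phi>]) simp
  qed
  show ?thesis
    unfolding local_diffeo_def
    by (intro ballI exI[of _ D] conjI openD openg injg smg sminv subset_refl)
qed

context adapted_frame
begin

text \<open>For \<open>x = (h, n)\<close> let \<open>X\<close> be the section of \<open>H\<close> with constant coefficients \<open>h\<close> in the frame.
In coordinates the flow is \<open>y + t X(y) + t\<^sup>2 n\<close>: its generator is \<open>X\<close>, its line through the
origin is to second order the Taylor curve of \<open>x\<close>, and for small \<open>t\<close> it is a small
perturbation of the identity and therefore an injective immersion on a fixed ball.\<close>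

lemma ex_parabolic_flow:
  obtains F where "parabolic_flow A H F" "defined_near F m" "taylor_coord \<phi> (flow_line F m) = x"
proof -
  define h where "h = horizontal_part p x"
  define n where "n = vertical_part p x"
  define X where "X = (\<lambda>y. frame_map p Z y h)"
  have h: "h \<in> horizontal p" by (simp add: h_def horizontal_part_in)
  have X0: "X 0 = h" unfolding X_def by (rule frame_map_adapted[of p Z 0 h, OF Z_0])
  have smX: "smooth_at X 0" unfolding X_def by (rule smooth_at_frame_map[OF smooth_Z])
  obtain r1 K where r1: "r1 > 0" and K: "K > 0" and smX1: "\<And>y. y \<in> ball 0 r1 \<Longrightarrow> smooth_at X y"
    and X': "\<And>y v. y \<in> ball 0 r1 \<Longrightarrow> norm (frechet_derivative X (at y) v) \<le> K * norm v"
    and lip: "\<And>y z. y \<in> ball 0 r1 \<Longrightarrow> z \<in> ball 0 r1 \<Longrightarrow> norm (X y - X z) \<le> K * norm (y - z)"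
    by (rule smooth_at_local_bound[OF smX]) (rule that)
  let ?good = "\<lambda>y. y \<in> \<phi> ` U \<and>
      tangent_coord \<phi> ` fibre A H (inv_into U \<phi> y) = frame_map p Z y ` horizontal p"
  obtain r2 where r2': "r2 > 0" "\<forall>y. dist y 0 < r2 \<longrightarrow> ?good y"
    using eventually_conj[OF eventually_image frame] unfolding eventually_nhds_metric
    by (elim exE conjE) (rule that)
  have r2_good: "?good y" if "y \<in> ball 0 r2" for y
    using r2'(2)[THEN spec, of y] that by (simp only: mem_ball dist_commute)
  note r2 = r2'(1) r2_good
  define R where "R = min r1 r2"
  have R: "R > 0" "ball 0 R \<subseteq> (ball 0 r1 :: (real ^ 'n::{finite,linorder}) set)"
    "ball 0 R \<subseteq> (ball 0 r2 :: (real ^ 'n::{finite,linorder}) set)"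
    using r1 r2(1) by (auto simp: R_def)
  \<comment> \<open>A bound for the displacement: for |t| at most 1, a point of the ball moves by at most |t| M.\<close>
  define M where "M = norm h + K * R + norm n + 1"
  have M: "M > 0" using K R(1) by (simp add: M_def add_nonneg_pos)
  \<comment> \<open>The first bound makes t X a contraction, the other two keep the image of the half-size ball inside the chart.\<close>
  define \<epsilon> where "\<epsilon> = min (1 / (K + 1)) (min 1 (R / (2 * M)))"
  have "\<epsilon> \<le> R / (2 * M)" by (simp add: \<epsilon>_def)
  then have "\<epsilon> * M \<le> R / (2 * M) * M" using M by (intro mult_right_mono) simp_all
  then have \<epsilon>: "\<epsilon> > 0" "\<epsilon> \<le> 1" "\<epsilon> * M \<le> R / 2"
    using K M R(1) by (simp_all add: \<epsilon>_def)
  have \<epsilon>K: "\<bar>t\<bar> * K < 1" if "\<bar>t\<bar> < \<epsilon>" for t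
  proof -
    have "\<bar>t\<bar> * K \<le> 1 / (K + 1) * K"
      using that K by (intro mult_right_mono) (simp_all add: \<epsilon>_def)
    also have "\<dots> < 1" using K by (simp add: field_simps)
    finally show ?thesis .
  qed
  define S where "S = ball (0 :: real ^ 'n::{finite,linorder}) (R / 2)"
  have S: "open S" "0 \<in> S" "S \<subseteq> ball 0 R" using R(1) by (auto simp: S_def)
  have SU: "S \<subseteq> \<phi> ` U"
  proof
    fix y assume "y \<in> S"
    from r2(2)[OF subsetD[OF R(3) subsetD[OF S(3) this]]] show "y \<in> \<phi> ` U" ..
  qed
  define f where "f = (\<lambda>(y, t). y + t *\<^sub>R X y + t\<^sup>2 *\<^sub>R n)"
  have fU: "f (y, t) \<in> \<phi> ` U" if y: "y \<in> S" and t: "\<bar>t\<bar> < \<epsilon>" for y t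
  proof -
    have "y \<in> ball 0 r1" "0 \<in> ball (0 :: real ^ 'n::{finite,linorder}) r1" using y S R r1 by auto
    from lip[OF this] have "norm (X y - h) \<le> K * norm y" by (simp add: X0)
    also have "\<dots> \<le> K * R" using y S(3) K by (auto intro!: mult_left_mono simp: less_imp_le)
    finally have Xy: "norm (X y) \<le> norm h + K * R"
      using norm_triangle_ineq2[of "X y" h] by linarith
    have "\<bar>t\<bar> \<le> 1" using t \<epsilon>(2) by simp
    then have t2: "t\<^sup>2 \<le> \<bar>t\<bar>"
      using mult_left_le[of "\<bar>t\<bar>" "\<bar>t\<bar>"] by (simp add: power2_eq_square flip: abs_mult)
    have "norm (t *\<^sub>R X y + t\<^sup>2 *\<^sub>R n) \<le> \<bar>t\<bar> * norm (X y) + t\<^sup>2 * norm n"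
      using norm_triangle_ineq[of "t *\<^sub>R X y" "t\<^sup>2 *\<^sub>R n"] by simp
    also have "\<dots> \<le> \<bar>t\<bar> * (norm h + K * R) + \<bar>t\<bar> * norm n"
      using Xy t2 by (intro add_mono mult_left_mono mult_right_mono) simp_all
    also have "\<dots> \<le> \<bar>t\<bar> * M" by (simp add: M_def algebra_simps)
    also have "\<dots> \<le> \<epsilon> * M" using t M by (intro mult_right_mono) simp_all
    also have "\<dots> \<le> R / 2" by (rule \<epsilon>(3))
    finally have "norm (f (y, t)) < R"
      using y norm_triangle_ineq[of y "t *\<^sub>R X y + t\<^sup>2 *\<^sub>R n"] by (simp add: f_def S_def add.assoc)
    then have "f (y, t) \<in> ball 0 R" by simp
    from r2(2)[OF subsetD[OF R(3) this]] show ?thesis ..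
  qed
  have smf: "smooth_at f (y, t)" if "y \<in> S" for y t
  proof -
    have y: "y \<in> ball 0 r1" using that S(3) R(2) by blast
    have fst: "smooth_at fst (y, t)" and snd: "smooth_at snd (y, t)"
      by (intro smooth_at_bounded_linear bounded_linear_fst bounded_linear_snd)+
    have "smooth_at (\<lambda>z. X (fst z)) (y, t)"
      by (rule smooth_at_compose[OF fst]) (simp add: smX1[OF y])
    then have "smooth_at (\<lambda>z. fst z + snd z *\<^sub>R X (fst z) + (snd z)\<^sup>2 *\<^sub>R n) (y, t)"
      by (intro smooth_at_add smooth_at_scaleR smooth_at_power2 smooth_at_const fst snd)
    then show ?thesis by (simp add: f_def case_prod_unfold)
  qed
  define D where "D = {q \<in> U. \<phi> q \<in> S}"
  define V where "V = {(q, t). q \<in> D \<and> \<bar>t\<bar> < \<epsilon>}"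
  define \<Phi> where "\<Phi> = (\<lambda>(q, t). inv_into U \<phi> (f (\<phi> q, t)))"
  have \<phi>inv: "\<phi> (inv_into U \<phi> y) = y" "inv_into U \<phi> y \<in> U" if "y \<in> \<phi> ` U" for y
    using that by (simp_all add: f_inv_into_f inv_into_into)
  have \<phi>\<Phi>: "\<phi> (\<Phi> (q, t)) = f (\<phi> q, t)" "\<Phi> (q, t) \<in> U" if "(q, t) \<in> V" for q t
    using that \<phi>inv[OF fU[of "\<phi> q" t]] by (auto simp: V_def D_def \<Phi>_def)
  have V0: "(q, 0) \<in> V \<longleftrightarrow> q \<in> D" for q using \<epsilon>(1) by (simp add: V_def)
  have \<Phi>0: "\<Phi> (q, 0) = q" if "(q, 0) \<in> V" for q
    using that coord_chart_inv[OF U(1), of q] by (simp add: V_def D_def \<Phi>_def f_def)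
  have near: "eventually (\<lambda>z. inv_into (U \<times> UNIV) (map_prod \<phi> id) z = (inv_into U \<phi> (fst z), snd z) \<and>
      (inv_into U \<phi> (fst z), snd z) \<in> V \<and> fst z \<in> \<phi> ` U) (nhds (map_prod \<phi> id (q, t)))"
    if qt: "(q, t) \<in> V" for q t
  proof -
    have q: "q \<in> U" "\<phi> q \<in> S" "\<bar>t\<bar> < \<epsilon>" using qt by (auto simp: V_def D_def)
    have "open (S \<times> {t. \<bar>t\<bar> < \<epsilon>})"
      by (intro open_Times S(1) open_Collect_less continuous_intros)
    then have "eventually (\<lambda>z. z \<in> S \<times> {t. \<bar>t\<bar> < \<epsilon>}) (nhds (\<phi> q, t))"
      using q by (intro eventually_nhds_in_open) simp_all
    with eventually_inv_into_map_prod[OF coord_chart_is_chart[OF U(1)] coord_chart_is_chart[OF coord_chart_real] q(1) UNIV_I, of t]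
    have "eventually (\<lambda>z. inv_into (U \<times> UNIV) (map_prod \<phi> id) z = (inv_into U \<phi> (fst z), snd z) \<and>
      (inv_into U \<phi> (fst z), snd z) \<in> V \<and> fst z \<in> \<phi> ` U) (nhds (\<phi> q, t))"
      unfolding id_apply
    proof eventually_elim
      case (elim z)
      then have z: "fst z \<in> S" "\<bar>snd z\<bar> < \<epsilon>" by (simp_all add: mem_Times_iff)
      then have "fst z \<in> \<phi> ` U" using SU by blast
      with z elim(1) show ?case using \<phi>inv[of "fst z"] by (simp add: V_def D_def inv_id[unfolded id_def] id_def)
    qed
    then show ?thesis by simp
  qed
  note prodU = coord_chart_prod[OF atlas smooth_atlas_real U(1) coord_chart_real]
  have openV: "openin (manifold_topology (prod_atlas A real_atlas)) V"
  proof (rule openin_manifold_topologyI[OF smooth_atlas_prod[OF atlas smooth_atlas_real]])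
    fix z assume z: "z \<in> V"
    obtain q t where qt: "z = (q, t)" by fastforce
    have "z \<in> U \<times> UNIV" using z by (auto simp: qt V_def D_def)
    moreover have "eventually (\<lambda>y. inv_into (U \<times> UNIV) (map_prod \<phi> id) y \<in> V) (nhds (map_prod \<phi> id z))"
      using near[OF z[unfolded qt]] unfolding qt by eventually_elim simp
    ultimately show "\<exists>W \<xi>. coord_chart (prod_atlas A real_atlas) (W, \<xi>) \<and> z \<in> W \<and>
        eventually (\<lambda>y. inv_into W \<xi> y \<in> V) (nhds (\<xi> z))"
      using prodU by (intro exI[of _ "U \<times> UNIV"] exI[of _ "map_prod \<phi> id"]) simp
  qed
  have sm\<Phi>: "smooth_map (prod_atlas A real_atlas) A V \<Phi>"
  proof (rule smooth_mapI[OF smooth_atlas_prod[OF atlas smooth_atlas_real]])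
    fix z assume z: "z \<in> V"
    obtain q t where qt: "z = (q, t)" by fastforce
    have q: "q \<in> U" "\<phi> q \<in> S" using z by (auto simp: qt V_def D_def)
    note ev = near[OF z[unfolded qt], folded qt]
    have "eventually (\<lambda>y. f y = \<phi> (\<Phi> (inv_into (U \<times> UNIV) (map_prod \<phi> id) y))) (nhds (map_prod \<phi> id z))"
      using ev
    proof eventually_elim
      case (elim y)
      then have "(inv_into U \<phi> (fst y), snd y) \<in> V" "\<phi> (inv_into U \<phi> (fst y)) = fst y"
        using \<phi>inv(1)[of "fst y"] by simp_all
      then show ?case using elim \<phi>\<Phi>(1)[of "inv_into U \<phi> (fst y)" "snd y"] by simp
    qed
    moreover have "smooth_at f (map_prod \<phi> id z)" using smf[OF q(2)] by (simp add: qt)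
    ultimately have 1: "smooth_at (\<lambda>y. \<phi> (\<Phi> (inv_into (U \<times> UNIV) (map_prod \<phi> id) y))) (map_prod \<phi> id z)"
      by (rule smooth_at_cong[of f, rotated])
    have 2: "eventually (\<lambda>y. inv_into (U \<times> UNIV) (map_prod \<phi> id) y \<in> V) (nhds (map_prod \<phi> id z))"
      using ev by eventually_elim simp
    have \<Phi>U: "\<Phi> y \<in> U" if "y \<in> V" for y using \<phi>\<Phi>(2)[of "fst y" "snd y"] that by simp
    have 3: "eventually (\<lambda>y. \<Phi> (inv_into (U \<times> UNIV) (map_prod \<phi> id) y) \<in> U) (nhds (map_prod \<phi> id z))"
      using 2 by eventually_elim (rule \<Phi>U)
    show "\<exists>W \<xi> V' \<psi>. coord_chart (prod_atlas A real_atlas) (W, \<xi>) \<and> coord_chart A (V', \<psi>) \<and> z \<in> W \<and> \<Phi> z \<in> V' \<and>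
      smooth_at (\<lambda>y. \<psi> (\<Phi> (inv_into W \<xi> y))) (\<xi> z) \<and>
      eventually (\<lambda>y. inv_into W \<xi> y \<in> V) (nhds (\<xi> z)) \<and>
      eventually (\<lambda>y. \<Phi> (inv_into W \<xi> y) \<in> V') (nhds (\<xi> z))"
      using prodU U(1) q(1) \<phi>\<Phi>(2)[of q t] z 1 2 3
      by (intro exI[of _ "U \<times> UNIV"] exI[of _ "map_prod \<phi> id"] exI[of _ U] exI[of _ \<phi>]) (simp add: qt)
  qed
  have diffeo: "local_diffeo A {q. (q, t) \<in> V} (\<lambda>q. \<Phi> (q, t))" for t
  proof (cases "\<bar>t\<bar> < \<epsilon>")
    \<comment> \<open>For such t the slice of the domain is empty.\<close>
    case False
    then have "{q. (q, t) \<in> V} = {}" by (simp add: V_def)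
    then show ?thesis by (simp add: local_diffeo_def)
  next
    case t: True
    have D': "{q. (q, t) \<in> V} = {q \<in> U. \<phi> q \<in> S}" using t by (auto simp: V_def D_def)
    let ?k = "\<lambda>y. f (y, t)"
    have Sr: "y \<in> ball 0 r1" if "y \<in> S" for y using that S(3) R(2) by blast
    have smk: "smooth_at ?k y" if "y \<in> S" for y
      by (rule smooth_at_compose[OF smooth_at_Pair[OF smooth_at_ident smooth_at_const] smf[OF that]])
    have derk: "frechet_derivative ?k (at y) v = v + t *\<^sub>R frechet_derivative X (at y) v" if "y \<in> S" for y v
    proof -
      have "((\<lambda>y. y + t *\<^sub>R X y + t\<^sup>2 *\<^sub>R n) has_derivative (\<lambda>v. v + t *\<^sub>R frechet_derivative X (at y) v + 0)) (at y)"
        by (intro has_derivative_add has_derivative_ident has_derivative_const has_derivative_scaleR_right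
            smooth_at_imp_has_derivative[OF smX1[OF Sr[OF that]]])
      from frechet_derivative_apply[OF this, of v] show ?thesis by (simp add: f_def)
    qed
    show ?thesis
      unfolding D'
    proof (rule local_diffeo_chartI[OF atlas U(1) S(1) SU, of ?k])
      show "smooth_on S ?k" by (rule smooth_onI_smooth_at[OF smk])
      show "inj_on ?k S"
      proof (rule inj_onI)
        fix y z assume yz: "y \<in> S" "z \<in> S" "f (y, t) = f (z, t)"
        then have "y - z = t *\<^sub>R (X z - X y)" by (simp add: f_def algebra_simps)
        then have "norm (y - z) = \<bar>t\<bar> * norm (X z - X y)" by simp
        also have "\<dots> \<le> \<bar>t\<bar> * (K * norm (z - y))"
          by (intro mult_left_mono lip Sr yz) simp
        finally have le: "norm (y - z) \<le> \<bar>t\<bar> * K * norm (y - z)"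
          by (simp add: norm_minus_commute mult.assoc)
        show "y = z"
        proof (rule ccontr)
          assume "y \<noteq> z"
          then have "\<bar>t\<bar> * K * norm (y - z) < 1 * norm (y - z)"
            by (intro mult_strict_right_mono \<epsilon>K t) simp
          with le show False by simp
        qed
      qed
      show "?k ` S \<subseteq> \<phi> ` U" by (rule image_subsetI) (rule fU[OF _ t])
      show "v = 0" if y: "y \<in> S" and v: "frechet_derivative ?k (at y) v = 0" for y v
      proof (rule ccontr)
        assume "v \<noteq> 0"
        have "v = - (t *\<^sub>R frechet_derivative X (at y) v)"
          using v unfolding derk[OF y] by (simp add: add_eq_0_iff2)
        from arg_cong[OF this, of norm]
        have "norm v = \<bar>t\<bar> * norm (frechet_derivative X (at y) v)" by simp
        also have "\<dots> \<le> \<bar>t\<bar> * (K * norm v)"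
          by (intro mult_left_mono X' Sr y) simp
        also have "\<dots> = \<bar>t\<bar> * K * norm v" by (simp add: mult.assoc)
        also have "\<dots> < 1 * norm v"
          using \<open>v \<noteq> 0\<close> by (intro mult_strict_right_mono \<epsilon>K t) simp
        finally show False by simp
      qed
    qed (simp_all add: \<Phi>_def)
  qed
  have local: "local_flow A (V, \<Phi>)"
    unfolding local_flow_def prod.case by (intro conjI allI impI openV sm\<Phi> \<Phi>0 diffeo)
  have line: "curve_at A q (flow_line (V, \<Phi>) q)" "velocity \<phi> (flow_line (V, \<Phi>) q) = X (\<phi> q)"
    "acceleration \<phi> (flow_line (V, \<Phi>) q) = 2 *\<^sub>R n" if q: "q \<in> D" for q
  proof -
    note jet = second_order_polynomial_jet[of "\<phi> q" "X (\<phi> q)" n]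
    have "flow_line (V, \<Phi>) q = (\<lambda>t. inv_into U \<phi> (\<phi> q + t *\<^sub>R X (\<phi> q) + t\<^sup>2 *\<^sub>R n))"
      by (simp add: flow_line_def \<Phi>_def f_def)
    moreover have qU: "q \<in> U" using q by (simp add: D_def)
    ultimately show "curve_at A q (flow_line (V, \<Phi>) q)" "velocity \<phi> (flow_line (V, \<Phi>) q) = X (\<phi> q)"
      "acceleration \<phi> (flow_line (V, \<Phi>) q) = 2 *\<^sub>R n"
      using curve_at_chart_curve[OF atlas U(1) qU jet(1)] by (simp_all add: jet(2,3))
  qed
  have "parabolic_flow A H (V, \<Phi>)"
    unfolding parabolic_flow_def
  proof (intro conjI local allI impI)
    fix q assume "defined_near (V, \<Phi>) q"
    then have q: "q \<in> D" using V0 by (simp add: defined_near_def)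
    then have qU: "q \<in> U" "\<phi> q \<in> S" by (simp_all add: D_def)
    then have "\<phi> q \<in> ball 0 r2" using S(3) R(3) by blast
    from r2(2)[OF this] have "tangent_coord \<phi> ` fibre A H q = frame_map p Z (\<phi> q) ` horizontal p"
      by (simp add: coord_chart_inv[OF U(1) qU(1)])
    then show "tangent_vector A q (flow_line (V, \<Phi>) q) \<in> H"
      unfolding tangent_vector_in_iff[OF atlas U(1) qU(1) line(1)[OF q]] line(2)[OF q] X_def
      using imageI[OF h] by (simp only:)
  qed
  moreover have mD: "m \<in> D" using U(2,3) S(2) by (simp add: D_def)
  then have "defined_near (V, \<Phi>) m" using V0 by (simp add: defined_near_def)
  moreover have "taylor_coord \<phi> (flow_line (V, \<Phi>) m) = x"
    unfolding taylor_coord_def line(2,3)[OF mD] U(3) X0 h_def n_def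
    by (simp add: linear_scale[OF linear_vertical_part] horizontal_plus_vertical_part)
  ultimately show thesis by (rule that)
qed

end

section \<open>The Lie group of parabolic arrows\<close>

subsection \<open>Manifolds with a global chart\<close>

text \<open>A global chart onto the whole Euclidean space is a homeomorphism, so separation and countability
are inherited from there.\<close>

lemma smooth_manifold_global_chart:
  assumes A: "smooth_atlas A" and c: "(P, \<tau>) \<in> A" and P: "points A = P" and bij: "bij_betw \<tau> P UNIV"
  shows "smooth_manifold A"
proof -
  have ch: "coord_chart A (P, \<tau>)" by (rule smooth_atlas_coord_chart[OF A c])
  have inj: "inj_on \<tau> P" and surj: "\<tau> ` P = UNIV" using bij by (simp_all add: bij_betw_def)
  have openI: "openin (manifold_topology A) {x \<in> P. \<tau> x \<in> T}" if "open T" for T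
  proof (rule openin_manifold_topologyI[OF A])
    fix x assume x: "x \<in> {x \<in> P. \<tau> x \<in> T}"
    have inv: "inv_into P \<tau> y \<in> P" "\<tau> (inv_into P \<tau> y) = y" for y
      using surj by (simp_all add: inv_into_into f_inv_into_f)
    have "eventually (\<lambda>y. y \<in> T) (nhds (\<tau> x))"
      using that x by (intro eventually_nhds_in_open) simp_all
    then have "eventually (\<lambda>y. inv_into P \<tau> y \<in> {x \<in> P. \<tau> x \<in> T}) (nhds (\<tau> x))"
      by eventually_elim (simp add: inv)
    then show "\<exists>U \<phi>. coord_chart A (U, \<phi>) \<and> x \<in> U \<and>
        eventually (\<lambda>y. inv_into U \<phi> y \<in> {x \<in> P. \<tau> x \<in> T}) (nhds (\<phi> x))"
      using ch x by (intro exI[of _ P] exI[of _ \<tau>]) simp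
  qed
  have openD: "W \<subseteq> P" "open (\<tau> ` W)" if "openin (manifold_topology A) W" for W
  proof -
    note W' = that[unfolded openin_manifold_topology[OF A]]
    note W = W'[THEN conjunct1] W'[THEN conjunct2]
    show "W \<subseteq> P" using W(1) P by simp
    then have "P \<inter> W = W" by (rule Int_absorb1)
    with bspec[OF W(2) c] show "open (\<tau> ` W)" by simp
  qed
  have space: "topspace (manifold_topology A) \<subseteq> P"
    using openD(1)[OF openin_topspace] .
  have "Hausdorff_space (manifold_topology A)"
    unfolding Hausdorff_space_def
  proof (intro allI impI, elim conjE)
    fix x y assume "x \<in> topspace (manifold_topology A)" "y \<in> topspace (manifold_topology A)" "x \<noteq> y"
    then have xy: "x \<in> P" "y \<in> P" "\<tau> x \<noteq> \<tau> y" using space inj by (auto simp: inj_on_def)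
    obtain T T' where T: "open T" "open T'" "\<tau> x \<in> T" "\<tau> y \<in> T'" "T \<inter> T' = {}"
      using hausdorff[OF xy(3)] by (elim exE conjE) (rule that)
    show "\<exists>U V. openin (manifold_topology A) U \<and> openin (manifold_topology A) V \<and> x \<in> U \<and> y \<in> V \<and> disjnt U V"
      using openI[OF T(1)] openI[OF T(2)] xy T
      by (intro exI[of _ "{x \<in> P. \<tau> x \<in> T}"] exI[of _ "{x \<in> P. \<tau> x \<in> T'}"]) (auto simp: disjnt_def)
  qed
  moreover have "second_countable (manifold_topology A)"
  proof -
    obtain B :: "'b set set" where B: "countable B" "topological_basis B"
      using ex_countable_basis by (elim exE conjE) (rule that)
    let ?B = "(\<lambda>T. {x \<in> P. \<tau> x \<in> T}) ` B"
    have 1: "\<forall>V\<in>?B. openin (manifold_topology A) V"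
      using openI topological_basis_open[OF B(2)] by blast
    have 2: "\<exists>V\<in>?B. x \<in> V \<and> V \<subseteq> W" if W: "openin (manifold_topology A) W" "x \<in> W" for W x
    proof -
      obtain T where T: "T \<in> B" "\<tau> x \<in> T" "T \<subseteq> \<tau> ` W"
        by (rule topological_basisE[OF B(2) openD(2)[OF W(1)] imageI[OF W(2)]])
      have "{x \<in> P. \<tau> x \<in> T} \<subseteq> W"
      proof
        fix y assume "y \<in> {x \<in> P. \<tau> x \<in> T}"
        then obtain w where "y \<in> P" "w \<in> W" "\<tau> y = \<tau> w" using T(3) by blast
        then show "y \<in> W" using inj_onD[OF inj, of y w] openD(1)[OF W(1)] by blast
      qed
      moreover have "x \<in> {x \<in> P. \<tau> x \<in> T}" using T(2) W(2) openD(1)[OF W(1)] by blast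
      ultimately show ?thesis using T(1) by blast
    qed
    show ?thesis
      unfolding second_countable_def
    proof (intro exI[of _ ?B] conjI allI impI)
      show "countable ?B" using B(1) by simp
      show "\<forall>V\<in>?B. openin (manifold_topology A) V" by (rule 1)
      show "\<exists>V\<in>?B. x \<in> V \<and> V \<subseteq> W" if "openin (manifold_topology A) W \<and> x \<in> W" for W x
        using 2 that by (elim conjE)
    qed
  qed
  ultimately show ?thesis using A by (simp add: smooth_manifold_def)
qed

text \<open>The chart transports to \<open>P\<close> a group law \<open>M\<close> on Euclidean space with neutral element \<open>0\<close> and
inversion \<open>I\<close>.\<close>

lemma lie_group_global_chart:
  fixes A :: "('a, 'e::euclidean_space) chart set"
  assumes A: "smooth_atlas A" and c: "(P, \<tau>) \<in> A" and P: "points A = P" and bij: "bij_betw \<tau> P UNIV"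
    and closed: "\<And>a b. a \<in> P \<Longrightarrow> b \<in> P \<Longrightarrow> mul a b \<in> P"
    and mul: "\<And>a b. a \<in> P \<Longrightarrow> b \<in> P \<Longrightarrow> \<tau> (mul a b) = M (\<tau> a) (\<tau> b)"
    and e: "e \<in> P" "\<tau> e = 0"
    and assoc: "\<And>x y z. M (M x y) z = M x (M y z)" and M0: "\<And>x. M 0 x = x" and inv: "\<And>x. M (I x) x = 0"
    and smM: "\<And>z. smooth_at (\<lambda>z. M (fst z) (snd z)) z" and smI: "\<And>x. smooth_at I x"
  shows "lie_group A \<lparr>carrier = P, mult = mul, one = e\<rparr>"
proof -
  let ?G = "\<lparr>carrier = P, mult = mul, one = e\<rparr>"
  have ch: "coord_chart A (P, \<tau>)" by (rule smooth_atlas_coord_chart[OF A c])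
  have inj: "inj_on \<tau> P" and surj: "\<tau> ` P = UNIV" using bij by (simp_all add: bij_betw_def)
  have tau_inv: "inv_into P \<tau> y \<in> P" "\<tau> (inv_into P \<tau> y) = y" for y
    using surj by (simp_all add: inv_into_into f_inv_into_f)
  have eqI: "a = b" if "a \<in> P" "b \<in> P" "\<tau> a = \<tau> b" for a b
    using inj_onD[OF inj that(3,1,2)] .
  have left_inv: "mul (inv_into P \<tau> (I (\<tau> a))) a = e" if "a \<in> P" for a
    by (rule eqI) (simp_all add: closed tau_inv that e mul inv)
  have G: "group ?G"
  proof (rule groupI)
    show "\<exists>y\<in>carrier ?G. y \<otimes>\<^bsub>?G\<^esub> a = \<one>\<^bsub>?G\<^esub>" if "a \<in> carrier ?G" for a
      using left_inv[of a] that tau_inv(1)[of "I (\<tau> a)"]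
      by (intro bexI[of _ "inv_into P \<tau> (I (\<tau> a))"]) simp_all
  next
    fix a b d assume "a \<in> carrier ?G" "b \<in> carrier ?G" "d \<in> carrier ?G"
    then have "mul (mul a b) d = mul a (mul b d)"
      by (intro eqI) (simp_all add: closed mul assoc)
    then show "a \<otimes>\<^bsub>?G\<^esub> b \<otimes>\<^bsub>?G\<^esub> d = a \<otimes>\<^bsub>?G\<^esub> (b \<otimes>\<^bsub>?G\<^esub> d)" by simp
  next
    fix a assume "a \<in> carrier ?G"
    then have "mul e a = a" by (intro eqI) (simp_all add: closed mul e M0)
    then show "\<one>\<^bsub>?G\<^esub> \<otimes>\<^bsub>?G\<^esub> a = a" by simp
  qed (simp_all add: closed e)
  have m_inv: "m_inv ?G a = inv_into P \<tau> (I (\<tau> a))" if "a \<in> P" for a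
    using group.inv_equality[OF G, of "inv_into P \<tau> (I (\<tau> a))" a] left_inv[OF that] tau_inv(1) that
    by simp
  have all: "eventually (\<lambda>y. Q y) F" if "\<And>y. Q y" for Q :: "'x \<Rightarrow> bool" and F
    using that by (simp add: eventually_mono)
  have inv_prod: "inv_into (P \<times> P) (map_prod \<tau> \<tau>) z = (inv_into P \<tau> (fst z), inv_into P \<tau> (snd z))" for z
    using inv_into_map_prod[OF inj inj, of "fst z" "snd z"] surj by simp
  have "smooth_map (prod_atlas A A) A (points A \<times> points A) (\<lambda>(x, y). mul x y)"
    unfolding P
  proof (rule smooth_mapI[OF smooth_atlas_prod[OF A A]])
    fix z assume z: "z \<in> P \<times> P"
    have "(\<lambda>y. \<tau> (case inv_into (P \<times> P) (map_prod \<tau> \<tau>) y of (x, y) \<Rightarrow> mul x y)) = (\<lambda>z. M (fst z) (snd z))"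
      by (simp add: inv_prod mul tau_inv)
    then have "smooth_at (\<lambda>y. \<tau> (case inv_into (P \<times> P) (map_prod \<tau> \<tau>) y of (x, y) \<Rightarrow> mul x y)) (map_prod \<tau> \<tau> z)"
      using smM by simp
    moreover have "inv_into (P \<times> P) (map_prod \<tau> \<tau>) y \<in> P \<times> P"
      "(case inv_into (P \<times> P) (map_prod \<tau> \<tau>) y of (x, y) \<Rightarrow> mul x y) \<in> P" for y
      by (simp_all add: inv_prod tau_inv closed)
    ultimately show "\<exists>U \<phi> V \<psi>. coord_chart (prod_atlas A A) (U, \<phi>) \<and> coord_chart A (V, \<psi>) \<and> z \<in> U \<and>
        (case z of (x, y) \<Rightarrow> mul x y) \<in> V \<and>
        smooth_at (\<lambda>y. \<psi> (case inv_into U \<phi> y of (x, y) \<Rightarrow> mul x y)) (\<phi> z) \<and>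
        eventually (\<lambda>y. inv_into U \<phi> y \<in> P \<times> P) (nhds (\<phi> z)) \<and>
        eventually (\<lambda>y. (case inv_into U \<phi> y of (x, y) \<Rightarrow> mul x y) \<in> V) (nhds (\<phi> z))"
      using coord_chart_prod[OF A A ch ch] ch z closed
      by (intro exI[of _ "P \<times> P"] exI[of _ "map_prod \<tau> \<tau>"] exI[of _ P] exI[of _ \<tau>])
        (simp add: mem_Times_iff case_prod_unfold)
  qed
  moreover have "smooth_map A A (points A) (m_inv ?G)"
    unfolding P
  proof (rule smooth_mapI[OF A])
    fix a assume a: "a \<in> P"
    have "smooth_at (\<lambda>y. \<tau> (m_inv ?G (inv_into P \<tau> y))) (\<tau> a)"
      using smI by (simp add: m_inv tau_inv)
    moreover have "m_inv ?G (inv_into P \<tau> y) \<in> P" for y by (simp add: m_inv tau_inv)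
    ultimately show "\<exists>U \<phi> V \<psi>. coord_chart A (U, \<phi>) \<and> coord_chart A (V, \<psi>) \<and> a \<in> U \<and> m_inv ?G a \<in> V \<and>
        smooth_at (\<lambda>y. \<psi> (m_inv ?G (inv_into U \<phi> y))) (\<phi> a) \<and>
        eventually (\<lambda>y. inv_into U \<phi> y \<in> P) (nhds (\<phi> a)) \<and>
        eventually (\<lambda>y. m_inv ?G (inv_into U \<phi> y) \<in> V) (nhds (\<phi> a))"
      using ch a m_inv[OF a] tau_inv(1)
      by (intro exI[of _ P] exI[of _ \<tau>]) simp
  qed
  ultimately show ?thesis
    unfolding lie_group_def using smooth_manifold_global_chart[OF A c P bij] G P by simp
qed

subsection \<open>Multiplication of parabolic arrows\<close>

context smooth_distribution
begin

lemma bij_inv_taylor_arrow: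
  assumes "H_chart A H p m c"
  shows "bij_betw (inv_into UNIV (taylor_arrow A H p c)) (parabolic_arrows A H p m) UNIV"
proof -
  obtain U \<phi> where c: "c = (U, \<phi>)" by fastforce
  have "bij_betw (taylor_arrow A H p c) UNIV (parabolic_arrows A H p m)"
    using inj_taylor_arrow range_taylor_arrow assms unfolding c bij_betw_def by blast
  then show ?thesis by (rule bij_betw_inv_into)
qed

lemma smooth_atlas_arrow_atlas: "smooth_atlas (arrow_atlas A H p m)"
proof -
  let ?P = "parabolic_arrows A H p m" and ?\<tau> = "\<lambda>c. inv_into UNIV (taylor_arrow A H p c)"
  have ch: "is_chart (?P, ?\<tau> c)" if "H_chart A H p m c" for c
    using bij_inv_taylor_arrow[OF that] by (simp add: is_chart_def bij_betw_def)
  have compat: "smoothly_compatible (?P, ?\<tau> c) (?P, ?\<tau> d)" if cd: "H_chart A H p m c" "H_chart A H p m d" for c d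
  proof -
    have tr: "smooth_at (\<lambda>y. ?\<tau> d (inv_into ?P (?\<tau> c) y)) x \<and> inv_into ?P (?\<tau> c) y \<in> ?P"
      if cd: "H_chart A H p m c" "H_chart A H p m d" for c d x y
    proof
      obtain U \<phi> where c: "c = (U, \<phi>)" by fastforce
      obtain V \<psi> where d: "d = (V, \<psi>)" by fastforce
      note U = cd(1)[unfolded c] and V = cd(2)[unfolded d]
      have inv: "inv_into ?P (?\<tau> c) y = parabolic_arrow A H p (taylor_curve c y)" for y
      proof (rule inv_into_f_eq)
        show "inj_on (?\<tau> c) ?P" using bij_inv_taylor_arrow[OF cd(1)] by (simp add: bij_betw_def)
        show "parabolic_arrow A H p (taylor_curve c y) \<in> ?P"
          unfolding parabolic_arrows_def c using taylor_curve(1)[OF U] by blast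
        show "?\<tau> c (parabolic_arrow A H p (taylor_curve c y)) = y"
          unfolding c inv_taylor_arrow[OF U taylor_curve(1)[OF U]] by (rule taylor_curve(2)[OF U])
      qed
      show "inv_into ?P (?\<tau> c) y \<in> ?P"
        unfolding inv unfolding parabolic_arrows_def c using taylor_curve(1)[OF U] by blast
      have "?\<tau> d (inv_into ?P (?\<tau> c) y) = taylor_transition (U, \<phi>) \<psi> y" for y
        unfolding inv unfolding c d inv_taylor_arrow[OF V taylor_curve(1)[OF U]]
          taylor_coord_change[OF U V taylor_curve(1)[OF U]] taylor_curve(2)[OF U] ..
      then show "smooth_at (\<lambda>y. ?\<tau> d (inv_into ?P (?\<tau> c) y)) x"
        using smooth_taylor_transition[OF U V, of x] by simp
    qed
    show ?thesis
      by (rule smoothly_compatibleI[OF ch[OF cd(1)] ch[OF cd(2)]]) (simp_all add: tr[OF cd] tr[OF cd(2,1)])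
  qed
  show ?thesis
    unfolding smooth_atlas_def arrow_atlas_def using ch compat by blast
qed

end

context adapted_frame
begin

lemma taylor_chart_of_flow:
  assumes "parabolic_flow A H F" "defined_near F m"
  shows "flow_arrow A H p m F \<in> parabolic_arrows A H p m"
    and "inv_into UNIV (taylor_arrow A H p (U, \<phi>)) (flow_arrow A H p m F) = taylor_coord \<phi> (flow_line F m)"
proof -
  note tan = tangent_flow_line[OF assms]
  show "flow_arrow A H p m F \<in> parabolic_arrows A H p m"
    unfolding flow_arrow_def parabolic_arrows_def using tan by blast
  show "inv_into UNIV (taylor_arrow A H p (U, \<phi>)) (flow_arrow A H p m F) = taylor_coord \<phi> (flow_line F m)"
    unfolding flow_arrow_def by (rule inv_taylor_arrow[OF chart tan])
qed

lemma ex_flow_of_arrow: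
  assumes "a \<in> parabolic_arrows A H p m"
  obtains F where "parabolic_flow A H F" "defined_near F m" "flow_arrow A H p m F = a"
proof -
  obtain c where c: "a = parabolic_arrow A H p c" "tangent_curve_at A H m c"
    using assms unfolding parabolic_arrows_def by blast
  obtain F where F: "parabolic_flow A H F" "defined_near F m" "taylor_coord \<phi> (flow_line F m) = taylor_coord \<phi> c"
    by (rule ex_parabolic_flow)
  have "flow_arrow A H p m F = a"
    unfolding flow_arrow_def c(1) parabolic_arrow_eq_iff[OF chart tangent_flow_line[OF F(1,2)] c(2)] by (rule F(3))
  with F(1,2) show thesis by (rule that)
qed

text \<open>The right-hand side depends on the two arrows only, not on the flows that represent them.\<close>

lemma flow_arrow_comp:
  assumes "parabolic_flow A H F" "defined_near F m" "parabolic_flow A H G" "defined_near G m"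
  shows "flow_arrow A H p m (flow_comp F G) \<in> parabolic_arrows A H p m"
    and "flow_arrow A H p m (flow_comp F G) = taylor_arrow A H p (U, \<phi>)
      (taylor_mult (inv_into UNIV (taylor_arrow A H p (U, \<phi>)) (flow_arrow A H p m F))
        (inv_into UNIV (taylor_arrow A H p (U, \<phi>)) (flow_arrow A H p m G)))"
proof -
  note comp = taylor_coord_flow_comp[OF assms]
  show "flow_arrow A H p m (flow_comp F G) \<in> parabolic_arrows A H p m"
    unfolding flow_arrow_def parabolic_arrows_def using comp(1) by blast
  show "flow_arrow A H p m (flow_comp F G) = taylor_arrow A H p (U, \<phi>)
      (taylor_mult (inv_into UNIV (taylor_arrow A H p (U, \<phi>)) (flow_arrow A H p m F))
        (inv_into UNIV (taylor_arrow A H p (U, \<phi>)) (flow_arrow A H p m G)))"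
    unfolding taylor_chart_of_flow(2)[OF assms(1,2)] taylor_chart_of_flow(2)[OF assms(3,4)] comp(2)[symmetric]
      taylor_arrow_taylor_coord[OF chart comp(1)] by (rule flow_arrow_def)
qed

text \<open>By \<open>flow_arrow_comp\<close> any other pair of representing flows leads to the same arrow, so the
definite description in the definition of the product denotes it.\<close>

lemma arrow_mult_flow_arrow:
  assumes F: "parabolic_flow A H F" "defined_near F m" and G: "parabolic_flow A H G" "defined_near G m"
  shows "arrow_mult A H p m (flow_arrow A H p m F) (flow_arrow A H p m G) = flow_arrow A H p m (flow_comp F G)"
  unfolding arrow_mult_def
proof (rule the_equality)
  show "\<exists>F' G'. parabolic_flow A H F' \<and> defined_near F' m \<and> flow_arrow A H p m F' = flow_arrow A H p m F \<and>
     parabolic_flow A H G' \<and> defined_near G' m \<and> flow_arrow A H p m G' = flow_arrow A H p m G \<and>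
     flow_arrow A H p m (flow_comp F G) = flow_arrow A H p m (flow_comp F' G')"
    using F G by (intro exI[of _ F] exI[of _ G]) simp
  fix c
  assume "\<exists>F' G'. parabolic_flow A H F' \<and> defined_near F' m \<and> flow_arrow A H p m F' = flow_arrow A H p m F \<and>
     parabolic_flow A H G' \<and> defined_near G' m \<and> flow_arrow A H p m G' = flow_arrow A H p m G \<and>
     c = flow_arrow A H p m (flow_comp F' G')"
  then obtain F' G' where *: "parabolic_flow A H F'" "defined_near F' m" "flow_arrow A H p m F' = flow_arrow A H p m F"
     "parabolic_flow A H G'" "defined_near G' m" "flow_arrow A H p m G' = flow_arrow A H p m G"
     "c = flow_arrow A H p m (flow_comp F' G')"
    by (elim exE conjE) (rule that)
  show "c = flow_arrow A H p m (flow_comp F G)"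
    unfolding *(7) flow_arrow_comp(2)[OF *(1,2,4,5)] flow_arrow_comp(2)[OF F G] *(3,6) ..
qed

lemma lie_group_parabolic_arrows:
  "\<exists>e. lie_group (arrow_atlas A H p m)
    \<lparr>carrier = parabolic_arrows A H p m, mult = arrow_mult A H p m, one = e\<rparr>"
proof -
  let ?P = "parabolic_arrows A H p m" and ?T = "taylor_arrow A H p (U, \<phi>)"
  let ?\<tau> = "inv_into UNIV ?T"
  have inj: "inj ?T" and range: "range ?T = ?P"
    using inj_taylor_arrow[OF chart] range_taylor_arrow[OF chart] .
  have c: "(?P, ?\<tau>) \<in> arrow_atlas A H p m" unfolding arrow_atlas_def using chart by blast
  have P: "points (arrow_atlas A H p m) = ?P"
    unfolding points_def using c by (auto simp: arrow_atlas_def)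
  have mult: "arrow_mult A H p m a b \<in> ?P \<and> ?\<tau> (arrow_mult A H p m a b) = taylor_mult (?\<tau> a) (?\<tau> b)"
    if ab: "a \<in> ?P" "b \<in> ?P" for a b
  proof -
    obtain F where F: "parabolic_flow A H F" "defined_near F m" "flow_arrow A H p m F = a"
      by (rule ex_flow_of_arrow[OF ab(1)])
    obtain G where G: "parabolic_flow A H G" "defined_near G m" "flow_arrow A H p m G = b"
      by (rule ex_flow_of_arrow[OF ab(2)])
    have "arrow_mult A H p m a b = flow_arrow A H p m (flow_comp F G)"
      using arrow_mult_flow_arrow[OF F(1,2) G(1,2)] by (simp only: F(3) G(3))
    then show ?thesis
      using flow_arrow_comp[OF F(1,2) G(1,2)] by (simp add: F(3) G(3) inv_f_f[OF inj])
  qed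
  have "?T 0 \<in> ?P" unfolding range[symmetric] by (rule rangeI)
  from lie_group_global_chart[OF smooth_atlas_arrow_atlas c P bij_inv_taylor_arrow[OF chart]
      mult[THEN conjunct1] mult[THEN conjunct2] this inv_f_f[OF inj] taylor_mult_assoc taylor_mult_0(1)
      taylor_mult_inverse smooth_taylor_mult smooth_taylor_inverse]
  show ?thesis by (rule exI)
qed

end

theorem corollary13:
  fixes A :: "('m, real ^ 'n::{finite,linorder}) chart set"
    and H :: "(real \<Rightarrow> 'm) set set"
    and p q :: nat and m :: 'm
  assumes "CARD('n) = p + q"
    and "smooth_manifold A"
    and "distribution A p H"
    and "m \<in> points A"
  shows "(\<forall>a\<in>parabolic_arrows A H p m.
            \<exists>F. parabolic_flow A H F \<and> defined_near F m \<and> flow_arrow A H p m F = a) \<and>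
         (\<forall>F G. parabolic_flow A H F \<and> defined_near F m \<and>
                parabolic_flow A H G \<and> defined_near G m \<longrightarrow>
            flow_arrow A H p m F \<in> parabolic_arrows A H p m \<and>
            flow_arrow A H p m G \<in> parabolic_arrows A H p m \<and>
            flow_arrow A H p m (flow_comp F G) \<in> parabolic_arrows A H p m \<and>
            arrow_mult A H p m (flow_arrow A H p m F) (flow_arrow A H p m G) =
              flow_arrow A H p m (flow_comp F G)) \<and>
         (\<exists>e. lie_group (arrow_atlas A H p m)
            \<lparr>carrier = parabolic_arrows A H p m, mult = arrow_mult A H p m, one = e\<rparr>)"
proof -
  interpret smooth_distribution A H p
    using assms by unfold_locales (simp_all add: smooth_manifold_def)
  obtain U \<phi> where "H_chart A H p m (U, \<phi>)"
    by (rule ex_H_chart[OF assms(4)])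
  then obtain Z where "adapted_frame A H p m U \<phi> Z"
    by (rule ex_adapted_frame)
  then interpret adapted_frame A H p m U \<phi> Z .
  show ?thesis
  proof (intro conjI ballI allI impI)
    show "\<exists>F. parabolic_flow A H F \<and> defined_near F m \<and> flow_arrow A H p m F = a"
      if a: "a \<in> parabolic_arrows A H p m" for a
      using ex_flow_of_arrow[OF a] by blast
    show "\<exists>e. lie_group (arrow_atlas A H p m)
        \<lparr>carrier = parabolic_arrows A H p m, mult = arrow_mult A H p m, one = e\<rparr>"
      by (rule lie_group_parabolic_arrows)
    fix F G
    assume FG: "parabolic_flow A H F \<and> defined_near F m \<and> parabolic_flow A H G \<and> defined_near G m"
    then have F: "parabolic_flow A H F" "defined_near F m" and G: "parabolic_flow A H G" "defined_near G m"
      by simp_all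
    show "flow_arrow A H p m F \<in> parabolic_arrows A H p m" "flow_arrow A H p m G \<in> parabolic_arrows A H p m"
      by (rule taylor_chart_of_flow(1)[OF F] taylor_chart_of_flow(1)[OF G])+
    show "flow_arrow A H p m (flow_comp F G) \<in> parabolic_arrows A H p m"
      by (rule flow_arrow_comp(1)[OF F G])
    show "arrow_mult A H p m (flow_arrow A H p m F) (flow_arrow A H p m G) = flow_arrow A H p m (flow_comp F G)"
      by (rule arrow_mult_flow_arrow[OF F G])
  qed
qed

end
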